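(* Let $\Omega=[0,1[^2$ with periodic boundary conditions, and let $\mathbf D:\mathbb R^2\to S_2^+$ be $\mathbb Z^2$-periodic and Lipschitz continuous. There exist $h_0>0$ and $c>0$, depending only on $\mathbf D$, such that for every $h=1/n\le h_0$ ($n\ge 1$ an integer) the following hold. (a) $\mathcal Q_h$ is a polygonization of $\mathbb R^2$ into strictly convex polygons with vertex set $h\mathbb Z^2$, so that Anisotropic Delaunay Triangulations exist. (b) For every Anisotropic Delaunay Triangulation $\mathcal T_h$ and every $u:\Omega_h\to\mathbb R$, $$(1-ch)\,\mathcal E_h(u)\le \mathcal E'_h(u)\le (1+ch)\,\mathcal E_h(u).$$
   Context: Let $S_2^+$ be the set of symmetric positive definite $2\times2$ matrices. For $M\in S_2^+$ set $\|e\|_M:=\sqrt{\langle e,Me\rangle}$. For $u=(a,b)\in\mathbb R^2$ set $u^\perp:=(-b,a)$. A basis of $\mathbb Z^2$ is a pair $(e_1,e_2)$ of elements of $\mathbb Z^2$ with $|\det(e_1,e_2)|=1$. A superbase of $\mathbb Z^2$ is a triple $(e_0,e_1,e_2)$ of elements of $\mathbb Z^2$ with $e_0+e_1+e_2=0$ and $(e_1,e_2)$ a basis. The triple is $M$-obtuse if $\langle e_i,Me_j\rangle\le0$ for all $i\ne j$. For every $M\in S_2^+$, an $M$-obtuse superbase exists. Set $\delta(z):=\det(\mathbf D(z))^{1/2}$ and $\mathbf M(z):=\delta(z)\mathbf D(z)^{-1}$, so that $\det \mathbf M(z)=1$. AD-LBR stencil and weights at $z$: choose an $\mathbf M(z)$-obtuse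 superbase $(e_0,e_1,e_2)$ of $\mathbb Z^2$. Set $V(z):=\{\pm e_0,\pm e_1,\pm e_2\}$ and $$\gamma_z(\pm e_i):=-\tfrac12\langle e_{i+1}^\perp,\mathbf D(z)e_{i+2}^\perp\rangle,$$ with indices taken mod $3$; set $\gamma_z:=0$ on $\mathbb Z^2\setminus V(z)$. Grid and energies: $\Omega_h:=\Omega\cap h\mathbb Z^2$. Functions $u:\Omega_h\to\mathbb R$ are extended $\mathbb Z^2$-periodically to $h\mathbb Z^2$. Define $$\mathcal E_h(u):=\sum_{z\in\Omega_h}\sum_{e\in V(z)}\gamma_z(e)\,|u(z+he)-u(z)|^2 .$$ Anisotropic Delaunay Triangulation (ADT): for $p,q\in\mathbb R^2$ let $\delta_p(q):=\|q-p\|_{\mathbf M(p)}$ and $\Delta_h(q):=\min_{p\in h\mathbb Z^2}\delta_p(q)$. The Voronoi cell of $p\in h\mathbb Z^2$ is $\mathrm{Vor}_h(p):=\{q:\delta_p(q)=\Delta_h(q)\}$. A Voronoi vertex is a point $q$ lying in the Voronoi cells of at least three distinct grid points; if $p_1,\dots,p_k$ are all the grid points whose cells contain $q$, set $T_q:=\mathrm{conv}\{p_1,\dots,p_k\}$. Let $\mathcal Q_h$ be the collection of all $T_q$. When $\mathcal Q_h$ is a polygonization of $\mathbb R^2$ into strictly convex polygons with vertex set $h\mathbb Z^2$, an ADT $\mathcal T_h$ is any $\mathbb Z^2$-periodic triangulation obtained by triangulating each element of $\mathcal Q_h$ without adding vertices. Finite element energy: $\mathcal E'_h(u):=\int_\Omega\|\nabla(I_{\mathcal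 T_h}u)(z)\|^2_{\mathbf D(z)}\,dz$, where $I_{\mathcal T_h}u$ is the continuous piecewise linear interpolant of (the periodic extension of) $u$ on $\mathcal T_h$. *)

theory Defs
  imports "HOL-Analysis.Analysis"
begin

type_synonym vec2 = "real^2"
type_synonym mat2 = "real^2^2"

definition lattice :: "real \<Rightarrow> vec2 set" where
  "lattice h = {p. \<forall>i. \<exists>k::int. p $ i = h * of_int k}"

definition Omega :: "vec2 set" where
  "Omega = {x. \<forall>i. 0 \<le> x $ i \<and> x $ i < 1}"

definition Omega_h :: "real \<Rightarrow> vec2 set" where
  "Omega_h h = Omega \<inter> lattice h"

definition spd :: "mat2 \<Rightarrow> bool" where
  "spd M \<longleftrightarrow> transpose M = M \<and> (\<forall>x. x \<noteq> 0 \<longrightarrow> x \<bullet> (M *v x) > 0)"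

definition Mnorm :: "mat2 \<Rightarrow> vec2 \<Rightarrow> real" where
  "Mnorm M e = sqrt (e \<bullet> (M *v e))"

definition perp :: "vec2 \<Rightarrow> vec2" where
  "perp u = vector [- (u $ 2), u $ 1]"

definition det2 :: "vec2 \<Rightarrow> vec2 \<Rightarrow> real" where
  "det2 a b = a $ 1 * b $ 2 - a $ 2 * b $ 1"

definition is_basis :: "vec2 \<Rightarrow> vec2 \<Rightarrow> bool" where
  "is_basis e1 e2 \<longleftrightarrow> e1 \<in> lattice 1 \<and> e2 \<in> lattice 1 \<and> \<bar>det2 e1 e2\<bar> = 1"

definition superbase :: "(nat \<Rightarrow> vec2) \<Rightarrow> bool" where
  "superbase e \<longleftrightarrow> e 0 \<in> lattice 1 \<and> e 0 + e 1 + e 2 = 0 \<and> is_basis (e 1) (e 2)"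

definition obtuse :: "mat2 \<Rightarrow> (nat \<Rightarrow> vec2) \<Rightarrow> bool" where
  "obtuse M e \<longleftrightarrow> (\<forall>i<3. \<forall>j<3. i \<noteq> j \<longrightarrow> e i \<bullet> (M *v e j) \<le> 0)"

definition Mfield :: "(vec2 \<Rightarrow> mat2) \<Rightarrow> vec2 \<Rightarrow> mat2" where
  "Mfield D z = sqrt (det (D z)) *\<^sub>R matrix_inv (D z)"

text \<open>sb z is the chosen M(z)-obtuse superbase at z.\<close>
definition stencil :: "(vec2 \<Rightarrow> nat \<Rightarrow> vec2) \<Rightarrow> vec2 \<Rightarrow> vec2 set" where
  "stencil sb z = (\<lambda>i. sb z i) ` {0..<3} \<union> (\<lambda>i. - sb z i) ` {0..<3}"

definition lbr_weight :: "(vec2 \<Rightarrow> mat2) \<Rightarrow> (vec2 \<Rightarrow> nat \<Rightarrow> vec2) \<Rightarrow> vec2 \<Rightarrow> nat \<Rightarrow> real" where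
  "lbr_weight D sb z i =
     - (1/2) * (perp (sb z ((i + 1) mod 3)) \<bullet> (D z *v perp (sb z ((i + 2) mod 3))))"

text \<open>gamma_z(+-e_i) = weight i, and 0 outside V(z) (the six vectors are distinct)\<close>
definition gamma :: "(vec2 \<Rightarrow> mat2) \<Rightarrow> (vec2 \<Rightarrow> nat \<Rightarrow> vec2) \<Rightarrow> vec2 \<Rightarrow> vec2 \<Rightarrow> real" where
  "gamma D sb z v = (\<Sum>i<3. if v = sb z i \<or> v = - sb z i then lbr_weight D sb z i else 0)"

definition energy_h :: "real \<Rightarrow> (vec2 \<Rightarrow> mat2) \<Rightarrow> (vec2 \<Rightarrow> nat \<Rightarrow> vec2) \<Rightarrow> (vec2 \<Rightarrow> real) \<Rightarrow> real" where
  "energy_h h D sb u =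
     (\<Sum>z\<in>Omega_h h. \<Sum>e\<in>stencil sb z. gamma D sb z e * (u (z + h *\<^sub>R e) - u z)\<^sup>2)"

definition delta_p :: "(vec2 \<Rightarrow> mat2) \<Rightarrow> vec2 \<Rightarrow> vec2 \<Rightarrow> real" where
  "delta_p D p q = Mnorm (Mfield D p) (q - p)"

definition Delta_h :: "real \<Rightarrow> (vec2 \<Rightarrow> mat2) \<Rightarrow> vec2 \<Rightarrow> real" where
  "Delta_h h D q = Inf {delta_p D p q | p. p \<in> lattice h}"

definition Vor :: "real \<Rightarrow> (vec2 \<Rightarrow> mat2) \<Rightarrow> vec2 \<Rightarrow> vec2 set" where
  "Vor h D p = {q. delta_p D p q = Delta_h h D q}"

definition voronoi_vertex :: "real \<Rightarrow> (vec2 \<Rightarrow> mat2) \<Rightarrow> vec2 \<Rightarrow> bool" where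
  "voronoi_vertex h D q \<longleftrightarrow>
     (\<exists>p1 p2 p3. distinct [p1, p2, p3] \<and> p1 \<in> lattice h \<and> p2 \<in> lattice h \<and> p3 \<in> lattice h
        \<and> q \<in> Vor h D p1 \<and> q \<in> Vor h D p2 \<and> q \<in> Vor h D p3)"

definition vor_sites :: "real \<Rightarrow> (vec2 \<Rightarrow> mat2) \<Rightarrow> vec2 \<Rightarrow> vec2 set" where
  "vor_sites h D q = {p \<in> lattice h. q \<in> Vor h D p}"

definition T_q :: "real \<Rightarrow> (vec2 \<Rightarrow> mat2) \<Rightarrow> vec2 \<Rightarrow> vec2 set" where
  "T_q h D q = convex hull (vor_sites h D q)"

definition Q_h :: "real \<Rightarrow> (vec2 \<Rightarrow> mat2) \<Rightarrow> vec2 set set" where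
  "Q_h h D = {T_q h D q | q. voronoi_vertex h D q}"

definition vertices :: "vec2 set \<Rightarrow> vec2 set" where
  "vertices P = {v. v extreme_point_of P}"

definition polygon :: "vec2 set \<Rightarrow> bool" where
  "polygon P \<longleftrightarrow> compact P \<and> convex P \<and> finite (vertices P)
      \<and> P = convex hull (vertices P) \<and> interior P \<noteq> {}"

definition polygonization :: "vec2 set set \<Rightarrow> vec2 set \<Rightarrow> bool" where
  "polygonization Q V \<longleftrightarrow>
     (\<forall>P\<in>Q. polygon P) \<and> \<Union>Q = UNIV
     \<and> (\<forall>P\<in>Q. \<forall>P'\<in>Q. P \<noteq> P' \<longrightarrow>
          interior P \<inter> interior P' = {} \<and> P \<inter> P' = convex hull (vertices P \<inter> vertices P'))
     \<and> \<Union>(vertices ` Q) = V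
     \<and> (\<forall>B. bounded B \<longrightarrow> finite {P\<in>Q. P \<inter> B \<noteq> {}})"

text \<open>Q_h is a polygonization into strictly convex polygons with vertex set hZ^2:
  each T_q is strictly convex, i.e. every grid point p_i generating T_q is a vertex of T_q.\<close>
definition Qh_strictly_convex_polygonization :: "real \<Rightarrow> (vec2 \<Rightarrow> mat2) \<Rightarrow> bool" where
  "Qh_strictly_convex_polygonization h D \<longleftrightarrow>
     polygonization (Q_h h D) (lattice h)
     \<and> (\<forall>q. voronoi_vertex h D q \<longrightarrow> vor_sites h D q \<subseteq> vertices (T_q h D q))"

definition triangle :: "vec2 set \<Rightarrow> bool" where
  "triangle t \<longleftrightarrow> (\<exists>a b c. \<not> collinear {a, b, c} \<and> t = convex hull {a, b, c})"

definition ADT :: "real \<Rightarrow> (vec2 \<Rightarrow> mat2) \<Rightarrow> vec2 set set \<Rightarrow> bool" where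
  "ADT h D T \<longleftrightarrow>
     (\<forall>t\<in>T. triangle t)
     \<and> (\<forall>t\<in>T. \<exists>P\<in>Q_h h D. t \<subseteq> P \<and> vertices t \<subseteq> vertices P)
     \<and> (\<forall>P\<in>Q_h h D. P = \<Union>{t\<in>T. t \<subseteq> P})
     \<and> (\<forall>t\<in>T. \<forall>t'\<in>T. t \<noteq> t' \<longrightarrow> t \<inter> t' = convex hull (vertices t \<inter> vertices t'))
     \<and> (\<forall>t\<in>T. \<forall>k\<in>lattice 1. (\<lambda>x. x + k) ` t \<in> T)"

definition pl_interpolant :: "vec2 set set \<Rightarrow> (vec2 \<Rightarrow> real) \<Rightarrow> (vec2 \<Rightarrow> real) \<Rightarrow> bool" where
  "pl_interpolant T u I \<longleftrightarrow>
     (\<forall>t\<in>T. \<exists>g c. \<forall>x\<in>t. I x = g \<bullet> x + c) \<and> (\<forall>t\<in>T. \<forall>v\<in>vertices t. I v = u v)"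

definition grad :: "(vec2 \<Rightarrow> real) \<Rightarrow> vec2 \<Rightarrow> vec2" where
  "grad f z = (SOME g. GDERIV f z :> g)"

definition energy_fe :: "(vec2 \<Rightarrow> mat2) \<Rightarrow> (vec2 \<Rightarrow> real) \<Rightarrow> real" where
  "energy_fe D I = integral Omega (\<lambda>z. (Mnorm (D z) (grad I z))\<^sup>2)"

end

(*
For a superbase (f0, f1, f2) of Z^2 and a symmetric matrix A, Selling's expansion reads
v.Aw = sum_i s_i det(f_i, v) det(f_i, w) with s_i = - f_{i+1}.A f_{i+2}. Pairing the expansions
of two superbases with the hexagonal perfect form of each shows that the weights s_i are unique, and
Lipschitz in A, as a function of the lattice vector, also for superbases obtuse only up to O(h).

(a) If q is nearest to the sites P(q), freezing the metric at q costs O(h^3), while a lattice point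
of conv P(q) other than its vertices would be closer to q by a multiple of h^2; hence conv P(q) has
exactly the points of P(q) as its lattice points and as its vertices. For q /= q' the midpoint rule
for quadratic functions gives (i - j).n >= - C h^2 |n| for all i in P(q), j in P(q'), where n = M d
and d = q - q'. There are finitely many relative positions, so for small h some line separates P(q)
weakly from P(q'), and conv P(q) and conv P(q') meet in a common face. Brouwer's theorem applied to
y |-> y + x - (average of the almost nearest sites of y) shows that every x lies in some conv P(y);
the points y that are not Voronoi vertices only contribute segments, a null set.

(b) The triangles of an ADT are empty, hence unimodular, and acute up to O(h). Every point m of
(h/2) Z^2 outside h Z^2 is the midpoint of exactly one edge of the triangulation, which lies in exactly two
triangles. Grouping both energies by these midpoints, the coefficients agree up to O(h), and the
error is absorbed by the coercivity of the stencil energy, since at every point two stencil vectors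
forming a basis of Z^2 have weights bounded below.
*)
theory Submission
  imports Defs
begin

text \<open>The difficulty is that each site carries its own metric: cells need not be convex, and
  the classical Voronoi-Delaunay duality survives only approximately. Incidences must nevertheless
  hold exactly, and only the discreteness of the lattice turns approximate statements into exact
  ones. A second difficulty is that an obtuse superbase is neither unique nor continuous in the
  matrix; the stencil cannot be matched with the triangles vector by vector, and only the weight
  carried by a lattice vector is stable. The two energies meet in the identity <a^perp, D b^perp> =
  <a, cof(D) b>. It makes 2 gamma a Selling parameter of cof(D), which is a positive multiple of M
  and so has the same obtuse superbases. Expanding the same matrix in the edge superbase of a
  triangle gives the usual weights of linear finite elements, because the determinant of an edge
  with the rotated gradient is, up to sign, the difference of u along that edge. Midpoints are the
  right labels since the members of a superbase are distinct modulo 2, so that a midpoint fixes the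
  parity class of the step through it.\<close>

section \<open>Planar vectors, determinants and the lattice h Z^2\<close>

lemma inner_vec2: "(v::vec2) \<bullet> w = v $ 1 * w $ 1 + v $ 2 * w $ 2"
  by (simp add: inner_vec_def sum_2)

lemma mat2_mult_vec:
  fixes A :: mat2
  shows "(A *v w) $ 1 = A $ 1 $ 1 * w $ 1 + A $ 1 $ 2 * w $ 2"
    and "(A *v w) $ 2 = A $ 2 $ 1 * w $ 1 + A $ 2 $ 2 * w $ 2"
  by (simp_all add: matrix_vector_mult_def sum_2)

lemma perp_components [simp]: "perp v $ 1 = - (v $ 2)" "perp v $ 2 = v $ 1"
  by (simp_all add: perp_def)

lemma norm_perp [simp]: "norm (perp v) = norm v"
  by (simp add: norm_eq_sqrt_inner inner_vec2)

lemma abs_det2_le: "\<bar>det2 v w\<bar> \<le> norm v * norm w"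
proof -
  have "det2 v w = perp v \<bullet> w" by (simp add: det2_def inner_vec2)
  then show ?thesis using Cauchy_Schwarz_ineq2[of "perp v" w] by simp
qed

lemma lattice_iff: "p \<in> lattice h \<longleftrightarrow> (\<exists>a b::int. p $ 1 = h * of_int a \<and> p $ 2 = h * of_int b)"
  by (auto simp: lattice_def forall_2)

lemma lattice_1_iff: "p \<in> lattice 1 \<longleftrightarrow> p $ 1 \<in> \<int> \<and> p $ 2 \<in> \<int>"
  by (auto simp: lattice_iff Ints_def)

lemma lattice_add: "p \<in> lattice h \<Longrightarrow> q \<in> lattice h \<Longrightarrow> p + q \<in> lattice h"
  unfolding lattice_def by clarsimp (metis distrib_left of_int_add)

lemma lattice_minus: "p \<in> lattice h \<Longrightarrow> - p \<in> lattice h"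
  unfolding lattice_def by clarsimp (metis mult_minus_right of_int_minus)

lemma lattice_diff: "p \<in> lattice h \<Longrightarrow> q \<in> lattice h \<Longrightarrow> p - q \<in> lattice h"
  using lattice_add[of p h "- q"] lattice_minus by auto

lemma lattice_0 [simp]: "0 \<in> lattice h"
  unfolding lattice_def by (auto intro!: exI[of _ 0])

lemma scaleR_lattice: "k \<in> lattice 1 \<Longrightarrow> h *\<^sub>R k \<in> lattice h"
  unfolding lattice_def by auto

lemma lattice_scaleRE:
  assumes "p \<in> lattice h"
  obtains k where "k \<in> lattice 1" "p = h *\<^sub>R k"
proof -
  obtain a b :: int where ab: "p $ 1 = h * of_int a" "p $ 2 = h * of_int b"
    using assms by (auto simp: lattice_iff)
  have "p = h *\<^sub>R (vector [of_int a, of_int b] :: vec2)"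
    using ab by (simp add: vec_eq_iff forall_2)
  moreover have "(vector [of_int a, of_int b] :: vec2) \<in> lattice 1"
    by (simp add: lattice_1_iff)
  ultimately show ?thesis using that by blast
qed

lemma lattice_of_int: "k \<in> lattice 1 \<Longrightarrow> of_int a *\<^sub>R k \<in> lattice 1"
  by (simp add: lattice_1_iff)

lemma det2_Ints: "v \<in> lattice 1 \<Longrightarrow> w \<in> lattice 1 \<Longrightarrow> det2 v w \<in> \<int>"
  by (simp add: det2_def lattice_1_iff)

section \<open>Selling parameters\<close>

definition sel :: "mat2 \<Rightarrow> (nat \<Rightarrow> vec2) \<Rightarrow> nat \<Rightarrow> real" where
  "sel A e i = - (e ((i + 1) mod 3) \<bullet> (A *v e ((i + 2) mod 3)))"

text \<open>The weights as an even function on the lattice rather than a list indexed by 0, 1, 2.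
  Two superbases for the same matrix share no indexing, so their weights are compared in this
  form.\<close>

definition gam :: "mat2 \<Rightarrow> (nat \<Rightarrow> vec2) \<Rightarrow> vec2 \<Rightarrow> real" where
  "gam A e v = (\<Sum>i<3. if v = e i \<or> v = - e i then sel A e i else 0)"

lemma sum_less_3: "(\<Sum>i<3. g i) = g 0 + g 1 + (g (2::nat) :: real)"
  by (simp add: numeral_3_eq_3 numeral_2_eq_2)

lemma less_3D: "i < 3 \<Longrightarrow> i = 0 \<or> i = 1 \<or> i = (2::nat)" by auto

lemma sel_012:
  "sel A e 0 = - (e 1 \<bullet> (A *v e 2))" "sel A e 1 = - (e 2 \<bullet> (A *v e 0))"
  "sel A e 2 = - (e 0 \<bullet> (A *v e 1))" "sel A e (Suc 0) = - (e 2 \<bullet> (A *v e 0))"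
  by (simp_all add: sel_def flip: numeral_2_eq_2)

lemma superbase_sum:
  assumes "superbase e"
  shows "e 0 = - e 1 - e 2"
proof -
  have s: "e 0 + e 1 + e 2 = 0" using assms by (simp only: superbase_def)
  have "e 0 = (e 0 + e 1 + e 2) - e 1 - e 2" by (simp add: algebra_simps)
  then show ?thesis unfolding s by simp
qed

lemma superbase_dets:
  assumes "superbase e"
  shows "det2 (e 0) (e 1) = det2 (e 1) (e 2)" "det2 (e 2) (e 0) = det2 (e 1) (e 2)"
    "det2 (e 1) (e 0) = - det2 (e 1) (e 2)" "det2 (e 2) (e 1) = - det2 (e 1) (e 2)"
    "det2 (e 0) (e 2) = - det2 (e 1) (e 2)" "(det2 (e 1) (e 2))\<^sup>2 = 1"
    "\<And>i. det2 (e i) (e i) = 0"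
proof -
  have e0: "e 0 = - e 1 - e 2" using superbase_sum[OF assms] .
  show "det2 (e 0) (e 1) = det2 (e 1) (e 2)" "det2 (e 2) (e 0) = det2 (e 1) (e 2)"
    "det2 (e 1) (e 0) = - det2 (e 1) (e 2)" "det2 (e 2) (e 1) = - det2 (e 1) (e 2)"
    "det2 (e 0) (e 2) = - det2 (e 1) (e 2)" "\<And>i. det2 (e i) (e i) = 0"
    unfolding e0 by (simp_all add: det2_def algebra_simps)
  have "\<bar>det2 (e 1) (e 2)\<bar> = 1" using assms by (simp add: superbase_def is_basis_def)
  then show "(det2 (e 1) (e 2))\<^sup>2 = 1" by (simp add: abs_square_eq_1)
qed

lemma superbase_lattice: "superbase e \<Longrightarrow> i < 3 \<Longrightarrow> e i \<in> lattice 1"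
  by (auto simp: superbase_def is_basis_def dest!: less_3D)

lemma superbase_distinct:
  assumes "superbase e" "i < 3" "j < 3" "i \<noteq> j"
  shows "e i \<noteq> e j" "e i \<noteq> - e j"
proof -
  have "det2 (e i) (e j) \<noteq> 0"
    using assms superbase_dets[OF assms(1)] by (auto dest!: less_3D)
  then show "e i \<noteq> e j" "e i \<noteq> - e j" by (auto simp: det2_def)
qed

lemma superbase_nonzero:
  assumes "superbase e" "i < 3"
  shows "e i \<noteq> 0"
  using superbase_dets[OF assms(1)] assms(2) by (auto dest!: less_3D simp: det2_def)

lemma gam_superbase:
  assumes "superbase e" "j < 3" "v = e j \<or> v = - e j"
  shows "gam A e v = sel A e j"
proof -
  have "v = e i \<or> v = - e i \<longleftrightarrow> i = j" if "i < 3" for i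
    using superbase_distinct[OF assms(1) that assms(2)] assms(3)
      superbase_distinct[OF assms(1,2) that]
    by (metis minus_minus)
  then have "gam A e v = (\<Sum>i<3. if i = j then sel A e i else 0)"
    unfolding gam_def by (intro sum.cong) auto
  then show ?thesis using assms(2) by simp
qed

lemma gam_outside: "(\<And>j. j < 3 \<Longrightarrow> v \<noteq> e j \<and> v \<noteq> - e j) \<Longrightarrow> gam A e v = 0"
  unfolding gam_def by (intro sum.neutral) auto

lemma selling_expansion_reals:
  fixes a b c x1 x2 y1 y2 v1 v2 w1 w2 :: real
  assumes "z1 = - x1 - y1" "z2 = - x2 - y2"
  shows "- (x1 * (a * y1 + b * y2) + x2 * (b * y1 + c * y2)) * (z1 * v2 - z2 * v1) * (z1 * w2 - z2 * w1)
    + - (y1 * (a * z1 + b * z2) + y2 * (b * z1 + c * z2)) * (x1 * v2 - x2 * v1) * (x1 * w2 - x2 * w1)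
    + - (z1 * (a * x1 + b * x2) + z2 * (b * x1 + c * x2)) * (y1 * v2 - y2 * v1) * (y1 * w2 - y2 * w1)
    = (x1 * y2 - x2 * y1)\<^sup>2 * (v1 * (a * w1 + b * w2) + v2 * (b * w1 + c * w2))"
  unfolding assms by (simp add: algebra_simps power2_eq_square)

text \<open>Substituting e 0 = - e 1 - e 2 makes the claim a polynomial identity in coordinates in
  which the form is multiplied by det(e 1, e 2)^2, and this factor is 1.\<close>

lemma selling_expansion:
  assumes A: "transpose A = A" and e: "superbase e"
  shows "v \<bullet> (A *v w) = (\<Sum>i<3. sel A e i * det2 (e i) v * det2 (e i) w)"
proof -
  have "transpose A $ 1 $ 2 = A $ 1 $ 2" using A by simp
  then have A21: "A $ 2 $ 1 = A $ 1 $ 2" by (simp add: transpose_def)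
  have z: "e 0 $ 1 = - e 1 $ 1 - e 2 $ 1" "e 0 $ 2 = - e 1 $ 2 - e 2 $ 2"
    unfolding superbase_sum[OF e] by simp_all
  have "(\<Sum>i<3. sel A e i * det2 (e i) v * det2 (e i) w) = (det2 (e 1) (e 2))\<^sup>2 * (v \<bullet> (A *v w))"
    unfolding sum_less_3 sel_012 det2_def inner_vec2 mat2_mult_vec A21
    by (rule selling_expansion_reals[OF z])
  then show ?thesis using superbase_dets(6)[OF e] by simp
qed

lemma int_zero_sum_squares:
  fixes a b c :: int
  assumes "a + b + c = 0" "a \<noteq> 0" "b \<noteq> 0" "c \<noteq> 0"
  shows "a\<^sup>2 + b\<^sup>2 + c\<^sup>2 \<ge> 3"
proof -
  have "a\<^sup>2 \<ge> 1" "b\<^sup>2 \<ge> 1" "c\<^sup>2 \<ge> 1" using assms by (simp_all add: int_one_le_iff_zero_less)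
  then show ?thesis by linarith
qed

text \<open>Cramer's rule. The determinant is 1 or -1, so multiplying by it replaces dividing by it,
  and the coordinates of a lattice vector are visibly integers.\<close>

lemma superbase_coord:
  assumes "superbase e"
  shows "v = (det2 (e 1) (e 2) * det2 v (e 2)) *\<^sub>R e 1 + (det2 (e 1) (e 2) * det2 (e 1) v) *\<^sub>R e 2"
proof -
  have sq: "(det2 (e 1) (e 2))\<^sup>2 = 1" using superbase_dets(6)[OF assms] .
  have "(det2 (e 1) (e 2))\<^sup>2 *\<^sub>R v
    = (det2 (e 1) (e 2) * det2 v (e 2)) *\<^sub>R e 1 + (det2 (e 1) (e 2) * det2 (e 1) v) *\<^sub>R e 2"
    by (simp add: vec_eq_iff forall_2 det2_def) algebra
  then show ?thesis using sq by simp
qed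

text \<open>The form \<open>v \<mapsto> \<Sum>j det(v, e j)\<^sup>2 / 2\<close> is the hexagonal perfect form whose minimal
  vectors on the lattice are exactly \<open>\<plusminus>e j\<close>.\<close>

lemma superbase_perfect_form:
  assumes e: "superbase e" and v: "v \<in> lattice 1" "v \<noteq> 0"
  shows "(\<Sum>j<3. (det2 v (e j))\<^sup>2) \<ge> 2"
    and "(\<And>j. j < 3 \<Longrightarrow> v \<noteq> e j \<and> v \<noteq> - e j) \<Longrightarrow> (\<Sum>j<3. (det2 v (e j))\<^sup>2) \<ge> 3"
proof -
  obtain a where a: "det2 v (e 0) = of_int a" using det2_Ints[OF v(1) superbase_lattice[OF e]] by (metis Ints_cases zero_less_numeral)
  obtain b where b: "det2 v (e 1) = of_int b" using det2_Ints[OF v(1) superbase_lattice[OF e]] by (metis Ints_cases one_less_numeral_iff semiring_norm(77))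
  obtain c where c: "det2 v (e 2) = of_int c" using det2_Ints[OF v(1) superbase_lattice[OF e]] by (metis Ints_cases lessI numeral_2_eq_2 numeral_3_eq_3)
  obtain d where d: "det2 (e 1) (e 2) = of_int d" and d1: "d = 1 \<or> d = -1"
  proof -
    have "\<bar>det2 (e 1) (e 2)\<bar> = 1" using e by (simp add: superbase_def is_basis_def)
    then have "det2 (e 1) (e 2) = of_int 1 \<or> det2 (e 1) (e 2) = of_int (-1)" by auto
    then show ?thesis using that by blast
  qed
  have "det2 v (e 0) + det2 v (e 1) + det2 v (e 2) = 0"
    unfolding superbase_sum[OF e] by (simp add: det2_def algebra_simps)
  then have "of_int (a + b + c) = (0::real)" using a b c by simp
  then have s: "a + b + c = 0" by linarith
  have bc: "det2 (e 1) v = - of_int b" using b by (simp add: det2_def algebra_simps)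
  have co: "v = (of_int d * of_int c) *\<^sub>R e 1 + (of_int d * (- of_int b)) *\<^sub>R e 2"
    using superbase_coord[OF e, of v] unfolding d c bc .
  have S: "(\<Sum>j<3. (det2 v (e j))\<^sup>2) = of_int (a\<^sup>2 + b\<^sup>2 + c\<^sup>2)"
    by (simp add: sum_less_3 a b c flip: One_nat_def)
  have nz: "\<not> (b = 0 \<and> c = 0)" using co v(2) by auto
  \<comment> \<open>Integers with sum zero that are not all zero have at least two nonzero
    entries.\<close>
  have two: "a\<^sup>2 + b\<^sup>2 + c\<^sup>2 \<ge> 2"
  proof -
    have sq1: "x\<^sup>2 \<ge> 1" if "x \<noteq> 0" for x :: int using that by (simp add: int_one_le_iff_zero_less)
    consider "a \<noteq> 0" "b \<noteq> 0" | "a \<noteq> 0" "c \<noteq> 0" | "b \<noteq> 0" "c \<noteq> 0" using nz s by linarith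
    then show ?thesis
    proof cases
      case 1 then show ?thesis using sq1[of a] sq1[of b] zero_le_power2[of c] by linarith
    next
      case 2 then show ?thesis using sq1[of a] sq1[of c] zero_le_power2[of b] by linarith
    next
      case 3 then show ?thesis using sq1[of b] sq1[of c] zero_le_power2[of a] by linarith
    qed
  qed
  show "(\<Sum>j<3. (det2 v (e j))\<^sup>2) \<ge> 2" unfolding S using two by linarith
  show "(\<Sum>j<3. (det2 v (e j))\<^sup>2) \<ge> 3" if out: "\<And>j. j < 3 \<Longrightarrow> v \<noteq> e j \<and> v \<noteq> - e j"
  proof (rule ccontr)
    assume "\<not> ?thesis"
    then have lt: "a\<^sup>2 + b\<^sup>2 + c\<^sup>2 < 3" unfolding S by linarith
    have bound: "x = -1 \<or> x = 0 \<or> x = 1" if "x\<^sup>2 < 3" for x :: int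
    proof -
      have "\<bar>x\<bar> < 2"
      proof (rule ccontr)
        assume "\<not> \<bar>x\<bar> < 2"
        then have "2\<^sup>2 \<le> \<bar>x\<bar>\<^sup>2" by (intro power_mono) auto
        then show False using that by simp
      qed
      then show ?thesis by linarith
    qed
    have "a\<^sup>2 < 3" "b\<^sup>2 < 3" "c\<^sup>2 < 3"
      using lt zero_le_power2[of a] zero_le_power2[of b] zero_le_power2[of c] by linarith+
    then have cases: "a = -1 \<or> a = 0 \<or> a = 1" "b = -1 \<or> b = 0 \<or> b = 1" "c = -1 \<or> c = 0 \<or> c = 1"
      using bound by blast+
    \<comment> \<open>A zero-sum triple without zero entry has too large a sum of squares, so one
      entry vanishes and the other two are opposite units. These six cases are the vectors plus or
      minus e i.\<close>
    have z: "a = 0 \<or> b = 0 \<or> c = 0" using int_zero_sum_squares[of a b c] s lt by linarith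
    have "(b = 0 \<and> (c = 1 \<or> c = -1)) \<or> (c = 0 \<and> (b = 1 \<or> b = -1)) \<or> (b = 1 \<and> c = -1) \<or> (b = -1 \<and> c = 1)"
      using cases z s nz by linarith
    then have "v = e 1 \<or> v = - e 1 \<or> v = e 2 \<or> v = - e 2 \<or> v = e 0 \<or> v = - e 0"
      using co d1 superbase_sum[OF e] by (elim disjE conjE) simp_all
    then show False using out[of 0] out[of 1] out[of 2] by auto
  qed
qed

lemma abs_sum3_le:
  fixes g :: "nat \<Rightarrow> real"
  assumes "\<And>i. i < 3 \<Longrightarrow> \<bar>g i\<bar> \<le> K"
  shows "\<bar>\<Sum>i<3. g i\<bar> \<le> 3 * K"
proof -
  have "(\<Sum>i<3. \<bar>g i\<bar>) \<le> of_nat (card {..<3::nat}) * K"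
    using assms by (intro sum_bounded_above) auto
  then show ?thesis by (intro order_trans[OF sum_abs]) simp
qed

text \<open>For fixed k the three numbers det(f k, e j) have sum zero, so minus the sum of their
  pairwise products is half the sum of their squares. Expanding each parameter of \<open>e\<close>
  in \<open>f\<close> produces exactly these products.\<close>

lemma sum_sel_perfect_form:
  assumes A: "transpose A = A" and e: "superbase e" and f: "superbase f"
  shows "(\<Sum>j<3. sel A e j) = (\<Sum>k<3. sel A f k * ((\<Sum>j<3. (det2 (f k) (e j))\<^sup>2) / 2))"
proof -
  have z: "det2 (f k) (e 0) = - det2 (f k) (e 1) - det2 (f k) (e 2)" for k
    unfolding superbase_sum[OF e] by (simp add: det2_def algebra_simps)
  have "2 * (\<Sum>j<3. sel A e j) = 2 * (sel A e 0 + sel A e 1 + sel A e 2)" by (simp only: sum_less_3)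
  also have "\<dots> = 2 * (\<Sum>k<3. sel A f k * ((\<Sum>j<3. (det2 (f k) (e j))\<^sup>2) / 2))"
    unfolding sel_012(1-3)[of A e] selling_expansion[OF A f] sum_less_3 z
    by (simp add: power2_eq_square algebra_simps add_divide_distrib)
  finally show ?thesis by simp
qed

text \<open>Comparing the two Selling expansions through the perfect forms of both superbases bounds the
  weights of the vectors that are not shared.\<close>

lemma sel_not_common_small:
  assumes A: "transpose A = A" and e: "superbase e" and f: "superbase f"
    and se: "\<And>i. i < 3 \<Longrightarrow> sel A e i \<ge> 0" and sf: "\<And>i. i < 3 \<Longrightarrow> sel A f i \<ge> - \<epsilon>"
    and ne: "\<And>i. i < 3 \<Longrightarrow> norm (e i) \<le> R" and nf: "\<And>i. i < 3 \<Longrightarrow> norm (f i) \<le> R"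
    and R: "R \<ge> 1" and eps: "\<epsilon> \<ge> 0" and i: "i < 3"
    and out: "\<And>j. j < 3 \<Longrightarrow> f i \<noteq> e j \<and> f i \<noteq> - e j"
  shows "\<bar>sel A f i\<bar> \<le> 6 * R ^ 4 * \<epsilon>"
proof -
  define P where "P = (\<lambda>k. (\<Sum>j<3. (det2 (f k) (e j))\<^sup>2) / 2)"
  define P' where "P' = (\<lambda>j. (\<Sum>k<3. (det2 (e j) (f k))\<^sup>2) / 2)"
  have dd: "\<bar>det2 (f k) (e j)\<bar> \<le> R\<^sup>2" if "k < 3" "j < 3" for j k
    using abs_det2_le[of "f k" "e j"] mult_mono[OF nf[OF that(1)] ne[OF that(2)]] R
    by (simp add: power2_eq_square)
  have Pge: "P k \<ge> 1" if "k < 3" for k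
    using superbase_perfect_form(1)[OF e superbase_lattice[OF f that] superbase_nonzero[OF f that]]
    unfolding P_def by simp
  have P'ge: "P' k \<ge> 1" if "k < 3" for k
    using superbase_perfect_form(1)[OF f superbase_lattice[OF e that] superbase_nonzero[OF e that]]
    unfolding P'_def by simp
  have Pi: "P i \<ge> 3/2"
    using superbase_perfect_form(2)[OF e superbase_lattice[OF f i] superbase_nonzero[OF f i] out]
    unfolding P_def by simp
  have Ple: "P k \<le> 3/2 * R ^ 4" if "k < 3" for k
  proof -
    have "(det2 (f k) (e j))\<^sup>2 \<le> R ^ 4" if "j < 3" for j
    proof -
      have "\<bar>det2 (f k) (e j)\<bar>\<^sup>2 \<le> (R\<^sup>2)\<^sup>2" using dd[OF \<open>k < 3\<close> that] by (intro power_mono) auto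
      then show ?thesis by (simp flip: power_mult)
    qed
    then have "(\<Sum>j<3. (det2 (f k) (e j))\<^sup>2) \<le> of_nat (card {..<3::nat}) * R ^ 4"
      by (intro sum_bounded_above) auto
    then show ?thesis unfolding P_def by simp
  qed
  have s1: "(\<Sum>j<3. sel A e j) = (\<Sum>k<3. sel A f k * P k)"
    unfolding P_def by (rule sum_sel_perfect_form[OF A e f])
  have "(\<Sum>j<3. sel A f j) = (\<Sum>k<3. sel A e k * P' k)"
    unfolding P'_def by (rule sum_sel_perfect_form[OF A f e])
  \<comment> \<open>The form of \<open>f\<close> is at least 1 on nonzero lattice vectors and the
    weights of \<open>e\<close> are nonnegative, so the total weight of \<open>e\<close> is at most
    that of \<open>f\<close>.\<close>
  also have "\<dots> \<ge> (\<Sum>k<3. sel A e k)"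
  proof (rule sum_mono)
    fix k :: nat assume "k \<in> {..<3}"
    then show "sel A e k \<le> sel A e k * P' k"
      using mult_left_mono[OF P'ge[of k] se[of k]] by simp
  qed
  finally have "(\<Sum>k<3. sel A f k * P k) \<le> (\<Sum>k<3. sel A f k)" using s1 by simp
  then have le0: "(\<Sum>k<3. sel A f k * (P k - 1)) \<le> 0"
    by (simp add: algebra_simps sum_subtractf)
  have "(\<Sum>k<3. sel A f k * (P k - 1)) = sel A f i * (P i - 1) + (\<Sum>k\<in>{..<3}-{i}. sel A f k * (P k - 1))"
    using i by (simp add: sum.remove)
  moreover have "(\<Sum>k\<in>{..<3}-{i}. sel A f k * (P k - 1)) \<ge> of_nat (card ({..<3} - {i})) * (- (\<epsilon> * (3/2 * R ^ 4)))"
  proof (rule sum_bounded_below)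
    fix k assume "k \<in> {..<3} - {i}"
    then have k: "k < 3" by auto
    have "- \<epsilon> * (P k - 1) \<le> sel A f k * (P k - 1)"
      using sf[OF k] Pge[OF k] by (intro mult_right_mono) auto
    moreover have "\<epsilon> * (P k - 1) \<le> \<epsilon> * (3/2 * R ^ 4)"
      using Ple[OF k] eps by (intro mult_left_mono) auto
    ultimately show "- (\<epsilon> * (3/2 * R ^ 4)) \<le> sel A f k * (P k - 1)" by linarith
  qed
  \<comment> \<open>The two other terms cost at most (3/2) R^4 \<epsilon> each. Below, dividing by
    the gap P i - 1 \<ge> 1/2 doubles this, which is the origin of the constant 6.\<close>
  ultimately have u: "sel A f i * (P i - 1) \<le> 3 * R ^ 4 * \<epsilon>"
    using le0 i by (simp add: algebra_simps)
  have R4: "R ^ 4 \<ge> 1" using R by simp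
  have eR: "\<epsilon> \<le> 6 * R ^ 4 * \<epsilon>"
    using mult_right_mono[OF R4 eps] eps by linarith
  have "sel A f i \<le> 6 * R ^ 4 * \<epsilon>"
  proof (cases "sel A f i \<ge> 0")
    case True
    have "sel A f i * (1/2) \<le> sel A f i * (P i - 1)" using True Pi by (intro mult_left_mono) auto
    then show ?thesis using u by linarith
  next
    case False then show ?thesis using eR eps by linarith
  qed
  then show ?thesis using sf[OF i] eR by linarith
qed

text \<open>Expand the parameter of \<open>e\<close> in the superbase \<open>f\<close>. A vector of
  \<open>f\<close> shared with \<open>e\<close> contributes its own weight if it is plus or minus e
  j and nothing otherwise; an unshared one has weight O(\<epsilon>), multiplied by two determinants
  of size at most R^2. Three terms and R^4 R^4 give 18 R^8.\<close>

lemma sel_common_gap: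
  assumes A: "transpose A = A" and e: "superbase e" and f: "superbase f"
    and se: "\<And>i. i < 3 \<Longrightarrow> sel A e i \<ge> 0" and sf: "\<And>i. i < 3 \<Longrightarrow> sel A f i \<ge> - \<epsilon>"
    and ne: "\<And>i. i < 3 \<Longrightarrow> norm (e i) \<le> R" and nf: "\<And>i. i < 3 \<Longrightarrow> norm (f i) \<le> R"
    and R: "R \<ge> 1" and eps: "\<epsilon> \<ge> 0" and j: "j < 3"
  shows "\<bar>sel A e j - gam A f (e j)\<bar> \<le> 18 * R ^ 8 * \<epsilon>"
proof -
  have E: "sel A e j = - (\<Sum>k<3. sel A f k * det2 (f k) (e ((j+1) mod 3)) * det2 (f k) (e ((j+2) mod 3)))"
    unfolding sel_def[of A e] selling_expansion[OF A f, symmetric] ..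
  have dd: "\<bar>det2 (f k) (e j)\<bar> \<le> R\<^sup>2" if "k < 3" "j < 3" for j k
    using abs_det2_le[of "f k" "e j"] mult_mono[OF nf[OF that(1)] ne[OF that(2)]] R
    by (simp add: power2_eq_square)
  define g where "g = (\<lambda>k. - (sel A f k * det2 (f k) (e ((j+1) mod 3)) * det2 (f k) (e ((j+2) mod 3)))
      - (if e j = f k \<or> e j = - f k then sel A f k else 0))"
  have nonneg: "0 \<le> 6 * R ^ 8 * \<epsilon>" using R eps by simp
  have "\<bar>g k\<bar> \<le> 6 * R ^ 8 * \<epsilon>" if k: "k < 3" for k
  proof (cases "\<exists>l<3. f k = e l \<or> f k = - e l")
    case True
    then obtain l where l: "l < 3" "f k = e l \<or> f k = - e l" by blast
    have iff: "e j = f k \<or> e j = - f k \<longleftrightarrow> l = j"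
      using superbase_distinct[OF e l(1) j] superbase_distinct[OF e j l(1)] l(2) by (metis minus_minus)
    have "det2 (f k) (e ((j+1) mod 3)) * det2 (f k) (e ((j+2) mod 3))
        = det2 (e l) (e ((j+1) mod 3)) * det2 (e l) (e ((j+2) mod 3))"
      using l(2) by (auto simp: det2_def algebra_simps)
    also have "\<dots> = (if l = j then - 1 else 0)"
      using superbase_dets[OF e] less_3D[OF j] less_3D[OF l(1)]
      by (elim disjE) (simp_all add: power2_eq_square flip: numeral_2_eq_2)
    finally have "g k = 0" unfolding g_def iff by (simp add: mult.assoc)
    then show ?thesis using nonneg by simp
  next
    case False
    have small: "\<bar>sel A f k\<bar> \<le> 6 * R ^ 4 * \<epsilon>"
      using sel_not_common_small[OF A e f se sf ne nf R eps k] False by blast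
    have ne': "\<not> (e j = f k \<or> e j = - f k)" using False j by (metis minus_minus)
    have m: "(j+1) mod 3 < 3" "(j+2) mod 3 < 3" by simp_all
    have "\<bar>g k\<bar> = \<bar>sel A f k\<bar> * (\<bar>det2 (f k) (e ((j+1) mod 3))\<bar> * \<bar>det2 (f k) (e ((j+2) mod 3))\<bar>)"
      unfolding g_def using ne' by (simp add: abs_mult)
    also have "\<dots> \<le> (6 * R ^ 4 * \<epsilon>) * (R\<^sup>2 * R\<^sup>2)"
      using small dd[OF k m(1)] dd[OF k m(2)] R eps by (intro mult_mono) auto
    also have "\<dots> = 6 * R ^ 8 * \<epsilon>" by (simp flip: power_add)
    finally show ?thesis .
  qed
  then have "\<bar>\<Sum>k<3. g k\<bar> \<le> 3 * (6 * R ^ 8 * \<epsilon>)" by (rule abs_sum3_le)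
  moreover have "(\<Sum>k<3. g k) = sel A e j - gam A f (e j)"
    unfolding g_def sum_subtractf E gam_def sum_negf ..
  ultimately show ?thesis by simp
qed

text \<open>A quantitative uniqueness of the weights: the second superbase is obtuse only up to
  \<epsilon>, which is all that is known of the edges of a triangle, or of a superbase chosen at a
  neighbouring point.\<close>

lemma gam_near_superbase:
  assumes A: "transpose A = A" and e: "superbase e" and f: "superbase f"
    and se: "\<And>i. i < 3 \<Longrightarrow> sel A e i \<ge> 0" and sf: "\<And>i. i < 3 \<Longrightarrow> sel A f i \<ge> - \<epsilon>"
    and ne: "\<And>i. i < 3 \<Longrightarrow> norm (e i) \<le> R" and nf: "\<And>i. i < 3 \<Longrightarrow> norm (f i) \<le> R"
    and R: "R \<ge> 1" and eps: "\<epsilon> \<ge> 0"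
  shows "\<bar>gam A e v - gam A f v\<bar> \<le> 18 * R ^ 8 * \<epsilon>"
proof (cases "\<exists>j<3. v = e j \<or> v = - e j")
  case True
  then obtain j where j: "j < 3" "v = e j \<or> v = - e j" by blast
  have "e j = f i \<or> e j = - f i \<longleftrightarrow> v = f i \<or> v = - f i" for i
    using j(2) by (metis minus_minus)
  then have "gam A f (e j) = gam A f v" by (simp add: gam_def)
  then show ?thesis
    using sel_common_gap[OF A e f se sf ne nf R eps j(1)] gam_superbase[OF e j, of A] by simp
next
  case False
  then have ge: "gam A e v = 0" by (intro gam_outside) auto
  have nonneg: "0 \<le> 18 * R ^ 8 * \<epsilon>" using R eps by simp
  show ?thesis
  proof (cases "\<exists>j<3. v = f j \<or> v = - f j")
    case True
    then obtain j where j: "j < 3" "v = f j \<or> v = - f j" by blast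
    have "\<bar>sel A f j\<bar> \<le> 6 * R ^ 4 * \<epsilon>"
      using sel_not_common_small[OF A e f se sf ne nf R eps j(1)] False j(2) by (metis minus_minus)
    moreover have "6 * R ^ 4 * \<epsilon> \<le> 18 * R ^ 8 * \<epsilon>"
    proof (rule mult_right_mono[OF _ eps])
      have "R ^ 4 \<le> R ^ 8" "0 \<le> R ^ 4" using power_increasing[of 4 8 R] R by simp_all
      then show "6 * R ^ 4 \<le> 18 * R ^ 8" by linarith
    qed
    ultimately show ?thesis using ge gam_superbase[OF f j, of A] by linarith
  next
    case False
    then have "gam A f v = 0" by (intro gam_outside) auto
    then show ?thesis using ge nonneg by simp
  qed
qed

section \<open>Anisotropic Voronoi cells on a fine grid\<close>

lemma vec2_eq_0_iff: "(v::vec2) = 0 \<longleftrightarrow> v $ 1 = 0 \<and> v $ 2 = 0"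
  by (simp add: vec_eq_iff forall_2)

lemma norm_vec2_sq: "(norm (v::vec2))\<^sup>2 = (v $ 1)\<^sup>2 + (v $ 2)\<^sup>2"
  unfolding power2_norm_eq_inner inner_vec2 by (simp add: power2_eq_square)

lemma lattice_norm_ge:
  assumes p: "p \<in> lattice h" "p \<noteq> 0" and h: "h > 0"
  shows "norm p \<ge> h"
proof -
  obtain a b :: int where ab: "p $ 1 = h * of_int a" "p $ 2 = h * of_int b"
    using p(1) by (auto simp: lattice_iff)
  have "a \<noteq> 0 \<or> b \<noteq> 0" using p(2) ab by (auto simp: vec2_eq_0_iff)
  then have "\<bar>a\<bar> \<ge> 1 \<or> \<bar>b\<bar> \<ge> 1" by linarith
  then have "\<bar>of_int a\<bar> \<ge> (1::real) \<or> \<bar>of_int b\<bar> \<ge> (1::real)" by linarith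
  then have "\<bar>p $ 1\<bar> \<ge> h \<or> \<bar>p $ 2\<bar> \<ge> h" using ab h by (simp add: abs_mult)
  then show ?thesis using component_le_norm_cart[of p 1] component_le_norm_cart[of p 2] by linarith
qed

lemma finite_lattice_bounded:
  assumes h: "h > 0" and S: "bounded S"
  shows "finite (lattice h \<inter> S)"
proof -
  obtain b where b: "\<And>x. x \<in> S \<Longrightarrow> norm x \<le> b" using S by (auto simp: bounded_iff)
  define N where "N = \<lceil>b / h\<rceil>"
  let ?g = "\<lambda>(i::int, j::int). (vector [h * of_int i, h * of_int j] :: vec2)"
  have "lattice h \<inter> S \<subseteq> ?g ` ({-N..N} \<times> {-N..N})"
  proof
    fix p assume p: "p \<in> lattice h \<inter> S"
    obtain i j :: int where ij: "p $ 1 = h * of_int i" "p $ 2 = h * of_int j"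
      using p by (auto simp: lattice_iff)
    have bd: "\<bar>k\<bar> \<le> N" if "\<bar>h * of_int k\<bar> \<le> b" for k :: int
    proof -
      have "\<bar>of_int k\<bar> \<le> b / h" using that h by (simp add: abs_mult field_simps)
      then have "of_int \<bar>k\<bar> \<le> b / h" by simp
      then have "of_int \<bar>k\<bar> \<le> (of_int N :: real)"
        unfolding N_def by (rule order_trans) (rule le_of_int_ceiling)
      then show ?thesis by linarith
    qed
    have "\<bar>p $ 1\<bar> \<le> b" "\<bar>p $ 2\<bar> \<le> b"
      using b[of p] p component_le_norm_cart[of p 1] component_le_norm_cart[of p 2] by auto
    then have "\<bar>i\<bar> \<le> N" "\<bar>j\<bar> \<le> N" using bd ij by auto
    moreover have "p = ?g (i, j)" using ij by (simp add: vec_eq_iff forall_2)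
    ultimately show "p \<in> ?g ` ({-N..N} \<times> {-N..N})" by (intro image_eqI[of _ _ "(i, j)"]) auto
  qed
  then show ?thesis by (rule finite_subset) auto
qed

lemma countable_lattice: "countable (lattice h)"
proof -
  have "lattice h \<subseteq> (\<lambda>(i::int, j::int). (vector [h * of_int i, h * of_int j] :: vec2)) ` UNIV"
  proof
    fix p assume "p \<in> lattice h"
    then obtain i j :: int where "p $ 1 = h * of_int i" "p $ 2 = h * of_int j"
      by (auto simp: lattice_iff)
    then have "p = (\<lambda>(i::int, j::int). (vector [h * of_int i, h * of_int j] :: vec2)) (i, j)"
      by (simp add: vec_eq_iff forall_2)
    then show "p \<in> (\<lambda>(i::int, j::int). (vector [h * of_int i, h * of_int j] :: vec2)) ` UNIV" by blast
  qed
  then show ?thesis by (rule countable_subset) simp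
qed

lemma lattice_dense:
  assumes h: "h > 0"
  obtains p where "p \<in> lattice h" "norm (q - p) \<le> h"
proof -
  define p :: vec2 where "p = (\<chi> i. h * of_int (round (q $ i / h)))"
  have p: "p \<in> lattice h" by (auto simp: lattice_def p_def)
  have c: "\<bar>(q - p) $ i\<bar> \<le> h / 2" for i
  proof -
    have "(q - p) $ i = h * (q $ i / h - of_int (round (q $ i / h)))"
      using h by (simp add: p_def right_diff_distrib)
    then have "\<bar>(q - p) $ i\<bar> = h * \<bar>of_int (round (q $ i / h)) - q $ i / h\<bar>"
      using h by (simp add: abs_mult abs_minus_commute)
    also have "\<dots> \<le> h * (1/2)" using h of_int_round_abs_le[of "q $ i / h"] by (intro mult_left_mono) auto
    finally show ?thesis by simp
  qed
  have "norm (q - p) \<le> (\<Sum>i\<in>UNIV. \<bar>(q - p) $ i\<bar>)" by (rule norm_le_l1_cart)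
  also have "\<dots> \<le> h" using c[of 1] c[of 2] unfolding sum_2 by linarith
  finally show ?thesis using that p by blast
qed

section \<open>Separation of convex lattice polygons\<close>

text \<open>For a fixed set A, unit normals that fail by less and less accumulate at an exact one,
  by compactness of the circle, so some tolerance suffices. The least tolerance over the finitely
  many subsets of \<open>K\<close> serves all of them.\<close>

lemma approximate_half_plane:
  assumes "finite (K :: vec2 set)"
  shows "\<exists>\<epsilon>>0. \<forall>A\<subseteq>K. \<forall>n. norm n = 1 \<longrightarrow> (\<forall>a\<in>A. a \<bullet> n \<ge> - \<epsilon>) \<longrightarrow> (\<exists>n'. n' \<noteq> 0 \<and> (\<forall>a\<in>A. a \<bullet> n' \<ge> 0))"
proof -
  have one: "\<exists>\<epsilon>>0. \<forall>n. norm n = 1 \<longrightarrow> (\<forall>a\<in>A. a \<bullet> n \<ge> - \<epsilon>) \<longrightarrow> (\<exists>n'. n' \<noteq> 0 \<and> (\<forall>a\<in>A. a \<bullet> n' \<ge> 0))"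
    for A :: "vec2 set"
  proof (rule ccontr)
    assume neg: "\<not> ?thesis"
    have "\<exists>n. norm n = 1 \<and> (\<forall>a\<in>A. a \<bullet> n \<ge> - inverse (real (Suc k)))" for k
    proof -
      have "inverse (real (Suc k)) > 0" by simp
      then show ?thesis using neg by blast
    qed
    then obtain n where n: "\<And>k. norm (n k) = 1" "\<And>k a. a \<in> A \<Longrightarrow> a \<bullet> n k \<ge> - inverse (real (Suc k))"
      by metis
    have "compact (sphere (0::vec2) 1)" by simp
    moreover have "\<forall>k. n k \<in> sphere 0 1" using n(1) by simp
    ultimately obtain l r where l: "l \<in> sphere 0 1" and r: "strict_mono r" and lim: "(n \<circ> r) \<longlonglongrightarrow> l"
      unfolding compact_def by blast
    have "a \<bullet> l \<ge> 0" if a: "a \<in> A" for a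
    proof -
      have "(\<lambda>k. a \<bullet> (n \<circ> r) k) \<longlonglongrightarrow> a \<bullet> l" by (intro tendsto_intros lim)
      moreover have "(\<lambda>k. - inverse (real (Suc (r k)))) \<longlonglongrightarrow> - 0"
        using LIMSEQ_subseq_LIMSEQ[OF LIMSEQ_inverse_real_of_nat r]
        by (intro tendsto_minus) (simp add: o_def)
      ultimately have "- 0 \<le> a \<bullet> l"
        by (intro LIMSEQ_le[of "\<lambda>k. - inverse (real (Suc (r k)))" _ "\<lambda>k. a \<bullet> (n \<circ> r) k"])
           (use n(2)[OF a] in auto)
      then show ?thesis by simp
    qed
    moreover have "l \<noteq> 0" using l by auto
    ultimately have "\<exists>n'. n' \<noteq> 0 \<and> (\<forall>a\<in>A. a \<bullet> n' \<ge> 0)" by blast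
    then show False using neg zero_less_one by blast
  qed
  define e where "e = (\<lambda>A. SOME \<epsilon>. \<epsilon> > 0 \<and> (\<forall>n. norm n = 1 \<longrightarrow> (\<forall>a\<in>A. a \<bullet> n \<ge> - \<epsilon>) \<longrightarrow>
      (\<exists>n'::vec2. n' \<noteq> 0 \<and> (\<forall>a\<in>A. a \<bullet> n' \<ge> 0))))"
  have e: "e A > 0 \<and> (\<forall>n. norm n = 1 \<longrightarrow> (\<forall>a\<in>A. a \<bullet> n \<ge> - e A) \<longrightarrow>
      (\<exists>n'::vec2. n' \<noteq> 0 \<and> (\<forall>a\<in>A. a \<bullet> n' \<ge> 0)))" for A
    unfolding e_def by (rule someI_ex) (rule one)
  define \<epsilon> where "\<epsilon> = Min (e ` Pow K)"
  have fin: "finite (e ` Pow K)" and ne: "e ` Pow K \<noteq> {}" using assms by auto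
  have "\<epsilon> > 0" unfolding \<epsilon>_def using fin ne e by simp
  moreover have "\<exists>n'. n' \<noteq> 0 \<and> (\<forall>a\<in>A. a \<bullet> n' \<ge> 0)"
    if "A \<subseteq> K" "norm n = 1" "\<forall>a\<in>A. a \<bullet> n \<ge> - \<epsilon>" for A n
  proof -
    have "\<epsilon> \<le> e A" unfolding \<epsilon>_def using fin that(1) by (intro Min_le) auto
    then have "\<forall>a\<in>A. a \<bullet> n \<ge> - e A" using that(3) by force
    then show ?thesis using e[of A] that(2) by blast
  qed
  ultimately show ?thesis by blast
qed

lemma inner_perp_eq_0:
  assumes "n \<noteq> 0" "v \<bullet> n = 0" "v \<bullet> perp n = 0"
  shows "v = 0"
proof -
  have "(v $ 1 * n $ 1 + v $ 2 * n $ 2) = 0" "v $ 2 * n $ 1 - v $ 1 * n $ 2 = 0"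
    using assms(2,3) by (simp_all add: inner_vec2)
  then have "v $ 1 * ((n $ 1)\<^sup>2 + (n $ 2)\<^sup>2) = 0" "v $ 2 * ((n $ 1)\<^sup>2 + (n $ 2)\<^sup>2) = 0"
    by algebra+
  moreover have "(n $ 1)\<^sup>2 + (n $ 2)\<^sup>2 \<noteq> 0" using assms(1) by (auto simp: vec2_eq_0_iff sum_power2_eq_zero_iff)
  ultimately show ?thesis unfolding vec2_eq_0_iff mult_eq_0_iff by blast
qed

text \<open>The vector n fixes the line, and the product with perp n is a coordinate along
  it.\<close>

lemma between_on_line:
  assumes n: "n \<noteq> 0" and "a \<bullet> n = x \<bullet> n" "b \<bullet> n = x \<bullet> n"
    and ax: "a \<bullet> perp n \<le> x \<bullet> perp n" and xb: "x \<bullet> perp n \<le> b \<bullet> perp n"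
  shows "x \<in> closed_segment a b"
proof (cases "a \<bullet> perp n = b \<bullet> perp n")
  case True
  then have "x - a = 0" using assms by (intro inner_perp_eq_0[OF n]) (auto simp: inner_diff_left)
  then show ?thesis by simp
next
  case False
  define u where "u = (x \<bullet> perp n - a \<bullet> perp n) / (b \<bullet> perp n - a \<bullet> perp n)"
  have "b \<bullet> perp n - a \<bullet> perp n > 0" using False ax xb by linarith
  then have u: "0 \<le> u" "u \<le> 1" and ueq: "u * (b \<bullet> perp n - a \<bullet> perp n) = x \<bullet> perp n - a \<bullet> perp n"
    unfolding u_def using ax xb by (auto simp: field_simps)
  have "x - ((1 - u) *\<^sub>R a + u *\<^sub>R b) = 0"
  proof (rule inner_perp_eq_0[OF n])
    show "(x - ((1 - u) *\<^sub>R a + u *\<^sub>R b)) \<bullet> n = 0"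
      using assms(2,3) by (simp add: inner_diff_left inner_add_left algebra_simps)
    show "(x - ((1 - u) *\<^sub>R a + u *\<^sub>R b)) \<bullet> perp n = 0"
      using ueq by (simp add: inner_diff_left inner_add_left algebra_simps)
  qed
  then have "x = (1 - u) *\<^sub>R a + u *\<^sub>R b" by simp
  then show ?thesis using u unfolding closed_segment_def by blast
qed

text \<open>A supporting line cuts the hull in a face, and a face of the hull of a finite set is the
  hull of some of its points; these lie on the line.\<close>

lemma convex_hull_on_supporting_line:
  fixes P :: "vec2 set"
  assumes P: "finite P" and x: "x \<in> convex hull P" and ge: "\<And>p. p \<in> P \<Longrightarrow> x \<bullet> n \<le> p \<bullet> n"
  shows "x \<in> convex hull (P \<inter> {y. y \<bullet> n = x \<bullet> n})"
proof -
  have "convex hull P \<subseteq> {y. n \<bullet> y \<ge> x \<bullet> n}"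
    using ge by (intro hull_minimal convex_halfspace_ge) (auto simp: inner_commute[of n])
  then have "(convex hull P \<inter> {y. n \<bullet> y = x \<bullet> n}) face_of convex hull P"
    by (intro face_of_Int_supporting_hyperplane_ge) auto
  then obtain s where s: "s \<subseteq> P" "convex hull P \<inter> {y. n \<bullet> y = x \<bullet> n} = convex hull s"
    using face_of_convex_hull_subset[OF finite_imp_compact[OF P]] by metis
  have "s \<subseteq> {y. n \<bullet> y = x \<bullet> n}" using s(2) hull_subset[of s convex] by blast
  then have "convex hull s \<subseteq> convex hull (P \<inter> {y. y \<bullet> n = x \<bullet> n})"
    using s(1) by (intro hull_mono) (auto simp: inner_commute[of n])
  moreover have "x \<in> convex hull s" using x s(2) by (auto simp: inner_commute[of n])
  ultimately show ?thesis by blast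
qed

text \<open>If the points of \<open>P\<close> on the line all lay strictly to one side of x in
  direction m, so would their hull, since open half-planes are convex.\<close>

lemma convex_hull_line_extremes:
  fixes P :: "vec2 set"
  assumes P: "finite P" and x: "x \<in> convex hull (P \<inter> {y. y \<bullet> n = x \<bullet> n})"
  obtains a b where "a \<in> P" "b \<in> P" "a \<bullet> n = x \<bullet> n" "b \<bullet> n = x \<bullet> n"
    "a \<bullet> m \<le> x \<bullet> m" "x \<bullet> m \<le> b \<bullet> m"
proof -
  let ?P = "P \<inter> {y. y \<bullet> n = x \<bullet> n}"
  have "\<exists>a\<in>?P. a \<bullet> m \<le> x \<bullet> m"
  proof (rule ccontr)
    assume "\<not> ?thesis"
    then have "?P \<subseteq> {y. m \<bullet> y > x \<bullet> m}" by (auto simp: inner_commute[of m] not_le)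
    then have "convex hull ?P \<subseteq> {y. m \<bullet> y > x \<bullet> m}" by (intro hull_minimal convex_halfspace_gt)
    then show False using x by (auto simp: inner_commute[of m] not_le)
  qed
  moreover have "\<exists>b\<in>?P. x \<bullet> m \<le> b \<bullet> m"
  proof (rule ccontr)
    assume "\<not> ?thesis"
    then have "?P \<subseteq> {y. m \<bullet> y < x \<bullet> m}" by (auto simp: inner_commute[of m] not_le)
    then have "convex hull ?P \<subseteq> {y. m \<bullet> y < x \<bullet> m}" by (intro hull_minimal convex_halfspace_lt)
    then show False using x by (auto simp: inner_commute[of m] not_le)
  qed
  ultimately show ?thesis using that by blast
qed

text \<open>A common point of the hulls lies on a line with normal n that weakly separates them, and
  both hulls meet it in segments with ends in \<open>P\<close> and \<open>P'\<close>. The hypothesis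
  \<open>lat\<close> puts the ends of the overlap into both sets: an end of one segment lying in the
  other is a \<Lambda>-point of the other hull.\<close>

lemma separated_lattice_polygons:
  fixes P P' :: "vec2 set"
  assumes fin: "finite P" "finite P'" and n: "n \<noteq> 0"
    and sep: "\<And>i j. i \<in> P \<Longrightarrow> j \<in> P' \<Longrightarrow> j \<bullet> n \<le> i \<bullet> n"
    and lat: "P = \<Lambda> \<inter> convex hull P" "P' = \<Lambda> \<inter> convex hull P'"
  shows "convex hull P \<inter> convex hull P' = convex hull (P \<inter> P')"
    and "interior (convex hull P) \<inter> interior (convex hull P') = {}"
proof -
  have lev: "(\<forall>i\<in>P. x \<bullet> n \<le> i \<bullet> n) \<and> (\<forall>j\<in>P'. j \<bullet> n \<le> x \<bullet> n)"
    if x: "x \<in> convex hull P" "x \<in> convex hull P'" for x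
  proof -
    have "x \<bullet> n \<le> i \<bullet> n" if i: "i \<in> P" for i
    proof -
      have "convex hull P' \<subseteq> {y. n \<bullet> y \<le> i \<bullet> n}"
        using sep[OF i] by (intro hull_minimal convex_halfspace_le) (auto simp: inner_commute[of n])
      then show ?thesis using x(2) by (auto simp: inner_commute[of n])
    qed
    moreover have "j \<bullet> n \<le> x \<bullet> n" if j: "j \<in> P'" for j
    proof -
      have "convex hull P \<subseteq> {y. n \<bullet> y \<ge> j \<bullet> n}"
        using sep[OF _ j] by (intro hull_minimal convex_halfspace_ge) (auto simp: inner_commute[of n])
      then show ?thesis using x(1) by (auto simp: inner_commute[of n])
    qed
    ultimately show ?thesis by blast
  qed
  show "convex hull P \<inter> convex hull P' = convex hull (P \<inter> P')"
  proof
    show "convex hull (P \<inter> P') \<subseteq> convex hull P \<inter> convex hull P'"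
      using hull_mono[of "P \<inter> P'" P] hull_mono[of "P \<inter> P'" P'] by blast
    show "convex hull P \<inter> convex hull P' \<subseteq> convex hull (P \<inter> P')"
    proof
      fix x assume x: "x \<in> convex hull P \<inter> convex hull P'"
      have x1: "x \<in> convex hull (P \<inter> {y. y \<bullet> n = x \<bullet> n})"
        using x lev[of x] convex_hull_on_supporting_line[OF fin(1), of x n] by blast
      have "x \<in> convex hull (P' \<inter> {y. y \<bullet> (- n) = x \<bullet> (- n)})"
        using x lev[of x] convex_hull_on_supporting_line[OF fin(2), of x "- n"] by auto
      then have x2: "x \<in> convex hull (P' \<inter> {y. y \<bullet> n = x \<bullet> n})" by simp
      obtain a b where ab: "a \<in> P" "b \<in> P" "a \<bullet> n = x \<bullet> n" "b \<bullet> n = x \<bullet> n"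
        "a \<bullet> perp n \<le> x \<bullet> perp n" "x \<bullet> perp n \<le> b \<bullet> perp n"
        using convex_hull_line_extremes[OF fin(1) x1, of "perp n"] by metis
      obtain c d where cd: "c \<in> P'" "d \<in> P'" "c \<bullet> n = x \<bullet> n" "d \<bullet> n = x \<bullet> n"
        "c \<bullet> perp n \<le> x \<bullet> perp n" "x \<bullet> perp n \<le> d \<bullet> perp n"
        using convex_hull_line_extremes[OF fin(2) x2, of "perp n"] by metis
      have inP: "y \<in> P" if "y \<in> P'" "y \<in> closed_segment a b" for y
      proof -
        have "closed_segment a b \<subseteq> convex hull P"
          using ab by (intro closed_segment_subset_convex_hull) (auto intro: hull_inc)
        then show ?thesis using that lat by blast
      qed
      have inP': "y \<in> P'" if "y \<in> P" "y \<in> closed_segment c d" for y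
      proof -
        have "closed_segment c d \<subseteq> convex hull P'"
          using cd by (intro closed_segment_subset_convex_hull) (auto intro: hull_inc)
        then show ?thesis using that lat by blast
      qed
      \<comment> \<open>The overlap of the two segments begins at the later of their first ends,
        which lies in both.\<close>
      have "\<exists>y\<in>P \<inter> P'. y \<bullet> n = x \<bullet> n \<and> y \<bullet> perp n \<le> x \<bullet> perp n"
      proof (cases "a \<bullet> perp n \<le> c \<bullet> perp n")
        case True
        have "c \<in> closed_segment a b" using n ab cd True by (intro between_on_line[OF n]) auto
        then show ?thesis using inP[OF cd(1)] cd by blast
      next
        case False
        have "a \<in> closed_segment c d" using n ab cd False by (intro between_on_line[OF n]) auto
        then show ?thesis using inP'[OF ab(1)] ab by blast
      qed
      then obtain l where l: "l \<in> P \<inter> P'" "l \<bullet> n = x \<bullet> n" "l \<bullet> perp n \<le> x \<bullet> perp n" by blast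
      have "\<exists>y\<in>P \<inter> P'. y \<bullet> n = x \<bullet> n \<and> x \<bullet> perp n \<le> y \<bullet> perp n"
      proof (cases "d \<bullet> perp n \<le> b \<bullet> perp n")
        case True
        have "d \<in> closed_segment a b" using n ab cd True by (intro between_on_line[OF n]) auto
        then show ?thesis using inP[OF cd(2)] cd by blast
      next
        case False
        have "b \<in> closed_segment c d" using n ab cd False by (intro between_on_line[OF n]) auto
        then show ?thesis using inP'[OF ab(2)] ab by blast
      qed
      then obtain r where r: "r \<in> P \<inter> P'" "r \<bullet> n = x \<bullet> n" "x \<bullet> perp n \<le> r \<bullet> perp n" by blast
      have "x \<in> closed_segment l r" using n l r by (intro between_on_line[OF n]) auto
      moreover have "closed_segment l r \<subseteq> convex hull (P \<inter> P')"
        using l r by (intro closed_segment_subset_convex_hull) (auto intro: hull_inc)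
      ultimately show "x \<in> convex hull (P \<inter> P')" by blast
    qed
  qed
  show "interior (convex hull P) \<inter> interior (convex hull P') = {}"
  proof (rule ccontr)
    assume "\<not> ?thesis"
    then obtain x where x: "x \<in> interior (convex hull P) \<inter> interior (convex hull P')" by blast
    then have "open (interior (convex hull P) \<inter> interior (convex hull P'))" by auto
    then obtain r where r: "r > 0" "cball x r \<subseteq> interior (convex hull P) \<inter> interior (convex hull P')"
      using x open_contains_cball by blast
    \<comment> \<open>A small move of x in direction n leaves the half-plane that contains
      \<open>P'\<close>, although it stays inside its hull.\<close>
    define y where "y = x + (r / norm n) *\<^sub>R n"
    have y: "y \<in> cball x r" using n r(1) by (simp add: y_def dist_norm)
    have xP: "x \<in> convex hull P" "x \<in> convex hull P'" using x interior_subset by blast+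
    have "y \<in> convex hull P'" using y r(2) interior_subset by blast
    moreover have "convex hull P' \<subseteq> {z. n \<bullet> z \<le> x \<bullet> n}"
      using lev[OF xP] by (intro hull_minimal convex_halfspace_le) (auto simp: inner_commute[of n])
    ultimately have "n \<bullet> y \<le> x \<bullet> n" by blast
    moreover have "n \<bullet> y = x \<bullet> n + (r / norm n) * (n \<bullet> n)"
      by (simp add: y_def inner_add_right inner_commute[of n x])
    moreover have "(r / norm n) * (n \<bullet> n) > 0" using n r(1) by simp
    ultimately show False by linarith
  qed
qed

lemma sym_mat2:
  assumes "transpose (A::mat2) = A"
  shows "A $ 2 $ 1 = A $ 1 $ 2"
proof -
  have "transpose A $ 1 $ 2 = A $ 1 $ 2" using assms by simp
  then show ?thesis by (simp add: transpose_def)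
qed

text \<open>The quadratic parts cancel, so that sublevel sets of the difference are
  half-planes.\<close>

lemma quadratic_difference_affine:
  assumes "transpose (A::mat2) = A"
  shows "(x - q) \<bullet> (A *v (x - q)) - (x - p) \<bullet> (A *v (x - p))
    = (A *v (2 *\<^sub>R (p - q))) \<bullet> x + (q \<bullet> (A *v q) - p \<bullet> (A *v p))"
  by (simp add: inner_vec2 mat2_mult_vec sym_mat2[OF assms] algebra_simps)

text \<open>The increment of a quadratic function is its derivative at the midpoint. The right side
  is affine in i, so once the metric is frozen, comparing two sites leaves a linear condition on
  their difference.\<close>

lemma quadratic_difference_midpoint:
  assumes "transpose (A::mat2) = A"
  shows "(q - i) \<bullet> (A *v (q - i)) - (q' - i) \<bullet> (A *v (q' - i))
    = 2 * (((1/2) *\<^sub>R (q + q') - i) \<bullet> (A *v (q - q')))"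
  by (simp add: inner_vec2 mat2_mult_vec sym_mat2[OF assms] field_simps)

section \<open>Nearest sites of a varying metric\<close>

locale metric_field =
  fixes D :: "vec2 \<Rightarrow> mat2" and lam Lam L :: real
  assumes lam_pos: "0 < lam" and lam_le: "lam \<le> Lam" and L_pos: "0 < L"
    and M_sym: "transpose (Mfield D p) = Mfield D p"
    and M_lower: "lam * (norm v)\<^sup>2 \<le> v \<bullet> (Mfield D p *v v)"
    and M_upper: "v \<bullet> (Mfield D p *v v) \<le> Lam * (norm v)\<^sup>2"
    and M_lip: "\<bar>v \<bullet> (Mfield D p *v w) - v \<bullet> (Mfield D q *v w)\<bar> \<le> L * norm (p - q) * norm v * norm w"
begin

abbreviation M where "M \<equiv> Mfield D"

text \<open>Square root of the condition number: the price for comparing Euclidean distances through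
  the metrics of two different points.\<close>

definition R where "R = sqrt (Lam / lam)"

text \<open>The squared distance \<open>delta_p\<close>; cells only compare distances, and without
  the root the functions are quadratic.\<close>

definition f where "f p q = (q - p) \<bullet> (M p *v (q - p))"

lemma R_ge_1: "R \<ge> 1" unfolding R_def using lam_pos lam_le by simp

lemma R_pos: "R > 0" using R_ge_1 by linarith

lemma R_sq: "lam * R\<^sup>2 = Lam" unfolding R_def using lam_pos lam_le by simp

lemma Lam_pos: "Lam > 0" using lam_pos lam_le by linarith

lemma f_ge: "lam * (norm (q - p))\<^sup>2 \<le> f p q" and f_le: "f p q \<le> Lam * (norm (q - p))\<^sup>2"
  unfolding f_def using M_lower M_upper by blast+

lemma f_nonneg: "f p q \<ge> 0"
  using f_ge[of q p] lam_pos by (meson mult_nonneg_nonneg order_trans less_imp_le zero_le_power2)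

lemma delta_p_eq: "delta_p D p q = sqrt (f p q)"
  by (simp add: delta_p_def Mnorm_def f_def)

lemma Vor_iff:
  assumes p: "p \<in> lattice h"
  shows "q \<in> Vor h D p \<longleftrightarrow> (\<forall>p'\<in>lattice h. f p q \<le> f p' q)"
proof
  assume "q \<in> Vor h D p"
  then have eq: "delta_p D p q = Inf {delta_p D p q | p. p \<in> lattice h}"
    by (simp add: Vor_def Delta_h_def)
  show "\<forall>p'\<in>lattice h. f p q \<le> f p' q"
  proof
    fix p' assume p': "p' \<in> lattice h"
    have "bdd_below {delta_p D p q | p. p \<in> lattice h}"
      by (rule bdd_belowI[of _ 0]) (auto simp: delta_p_eq f_nonneg)
    then have "Inf {delta_p D p q | p. p \<in> lattice h} \<le> delta_p D p' q"
      using p' by (intro cInf_lower) auto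
    then have "sqrt (f p q) \<le> sqrt (f p' q)" using eq by (simp add: delta_p_eq)
    then show "f p q \<le> f p' q" by simp
  qed
next
  assume "\<forall>p'\<in>lattice h. f p q \<le> f p' q"
  then have "Inf {delta_p D p q | p. p \<in> lattice h} = delta_p D p q"
    using p by (intro cInf_eq_minimum) (auto simp: delta_p_eq)
  then show "q \<in> Vor h D p" by (simp add: Vor_def Delta_h_def)
qed

lemma sites_iff: "p \<in> vor_sites h D q \<longleftrightarrow> p \<in> lattice h \<and> (\<forall>p'\<in>lattice h. f p q \<le> f p' q)"
  unfolding vor_sites_def using Vor_iff by blast

lemma voronoi_vertex_iff:
  "voronoi_vertex h D q \<longleftrightarrow>
    (\<exists>p1 p2 p3. distinct [p1, p2, p3] \<and> p1 \<in> vor_sites h D q \<and> p2 \<in> vor_sites h D q \<and> p3 \<in> vor_sites h D q)"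
  unfolding voronoi_vertex_def vor_sites_def by blast

lemma le_of_sq_le: "lam * x\<^sup>2 \<le> Lam * y\<^sup>2 \<Longrightarrow> 0 \<le> y \<Longrightarrow> x \<le> R * y"
proof -
  assume a: "lam * x\<^sup>2 \<le> Lam * y\<^sup>2" and y: "0 \<le> y"
  have "lam * x\<^sup>2 \<le> lam * (R * y)\<^sup>2" using a by (simp add: R_sq power_mult_distrib flip: mult.assoc)
  then have "x\<^sup>2 \<le> (R * y)\<^sup>2" using lam_pos by simp
  then show ?thesis by (rule power2_le_imp_le) (use y R_pos in simp)
qed

lemma near_site:
  assumes h: "h > 0"
  obtains p where "p \<in> lattice h" "norm (y - p) \<le> h" "f p y \<le> Lam * h\<^sup>2"
proof -
  obtain p where p: "p \<in> lattice h" "norm (y - p) \<le> h" using lattice_dense[OF h] .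
  have "f p y \<le> Lam * (norm (y - p))\<^sup>2" by (rule f_le)
  also have "\<dots> \<le> Lam * h\<^sup>2" using p(2) Lam_pos by (intro mult_left_mono power_mono) auto
  finally show ?thesis using that p by blast
qed

lemma near_site_in_ball:
  assumes h: "h > 0" and y: "y \<in> cball x (2 * R * h)"
  shows "\<exists>p\<in>lattice h \<inter> cball x (4 * R * h). f p y \<le> Lam * h\<^sup>2"
proof -
  obtain p where p: "p \<in> lattice h" "norm (y - p) \<le> h" "f p y \<le> Lam * h\<^sup>2" using near_site[OF h] .
  have "dist x p \<le> dist x y + dist y p" by (rule dist_triangle)
  also have "\<dots> \<le> 2 * R * h + h" using y p(2) by (simp add: dist_norm)
  also have "\<dots> \<le> 4 * R * h" using mult_right_mono[OF R_ge_1, of h] h by linarith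
  finally show ?thesis using p by auto
qed

text \<open>Some lattice point is within Euclidean distance h. Comparison with it, using the upper
  bound of its metric and the lower bound of the metric of p, costs the factor
  \<open>R\<close>.\<close>

lemma site_near:
  assumes h: "h > 0" and p: "p \<in> vor_sites h D q"
  shows "norm (q - p) \<le> R * h"
proof -
  obtain p' where p': "p' \<in> lattice h" "f p' q \<le> Lam * h\<^sup>2" using near_site[OF h] .
  have "lam * (norm (q - p))\<^sup>2 \<le> f p q" by (rule f_ge)
  also have "\<dots> \<le> f p' q" using p p'(1) by (simp add: sites_iff)
  also note p'(2)
  finally show ?thesis using h by (intro le_of_sq_le) auto
qed

lemma sites_subset: "h > 0 \<Longrightarrow> vor_sites h D q \<subseteq> lattice h \<inter> cball q (R * h)"
  using site_near[of h _ q] by (auto simp: sites_iff dist_norm)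

lemma finite_sites: "h > 0 \<Longrightarrow> finite (vor_sites h D q)"
  using sites_subset finite_lattice_bounded[of h "cball q (R * h)"] by (meson bounded_cball finite_subset)

lemma continuous_f: "continuous_on S (\<lambda>q. f p q)"
  unfolding f_def matrix_vector_mult_def inner_vec2 by (auto intro!: continuous_intros simp: sum_2)

text \<open>Brouwer's theorem, applied to \<open>y \<mapsto> y + x - a(y)\<close> with \<open>a(y)\<close> a continuous average of the
  almost nearest sites of \<open>y\<close>, yields \<open>y\<close> with \<open>x = a(y)\<close>.\<close>

lemma approximate_sites_cover:
  assumes h: "h > 0" and eps: "0 < \<epsilon>" "\<epsilon> \<le> Lam * h\<^sup>2" and F: "F = lattice h \<inter> cball x (4 * R * h)"
  obtains y where "y \<in> cball x (2 * R * h)"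
    "x \<in> convex hull {p\<in>F. \<forall>p'\<in>F. f p y < f p' y + \<epsilon>}"
proof -
  have finF: "finite F" unfolding F by (rule finite_lattice_bounded[OF h]) simp
  \<comment> \<open>A product of positive parts is continuous in y and positive exactly when p is
    within \<epsilon> of minimal on \<open>F\<close>.\<close>
  define w where "w = (\<lambda>p y. \<Prod>p'\<in>F. max 0 (f p' y + \<epsilon> - f p y))"
  define W where "W = (\<lambda>y. \<Sum>p\<in>F. w p y)"
  have w_pos: "w p y > 0 \<longleftrightarrow> (\<forall>p'\<in>F. f p y < f p' y + \<epsilon>)" for p y
  proof
    assume "w p y > 0"
    then have "\<forall>p'\<in>F. max 0 (f p' y + \<epsilon> - f p y) \<noteq> 0" unfolding w_def using finF by (metis less_irrefl prod_zero)
    then show "\<forall>p'\<in>F. f p y < f p' y + \<epsilon>" by (force simp: max_def split: if_splits)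
  qed (auto simp: w_def intro!: prod_pos)
  have w_nn: "w p y \<ge> 0" for p y unfolding w_def by (auto intro!: prod_nonneg)
  have near: "\<exists>p\<in>F. f p y \<le> Lam * h\<^sup>2" if "y \<in> cball x (2 * R * h)" for y
    unfolding F by (rule near_site_in_ball[OF h that])
  have W_pos: "W y > 0" if y: "y \<in> cball x (2 * R * h)" for y
  proof -
    have "F \<noteq> {}" using near[OF y] by blast
    then have "Min ((\<lambda>p. f p y) ` F) \<in> (\<lambda>p. f p y) ` F" using finF by (intro Min_in) auto
    then obtain p where p: "p \<in> F" "f p y = Min ((\<lambda>p. f p y) ` F)" by (metis imageE)
    have "f p y \<le> f p' y" if "p' \<in> F" for p' unfolding p(2) using that finF by simp
    then have "w p y > 0" unfolding w_pos using eps(1) by fastforce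
    then show ?thesis unfolding W_def using p(1) finF w_nn by (meson sum_pos2)
  qed
  have w_near: "norm (y - p) \<le> 2 * R * h" if y: "y \<in> cball x (2 * R * h)" and p: "w p y > 0" for p y
  proof -
    obtain p' where p': "p' \<in> F" "f p' y \<le> Lam * h\<^sup>2" using near[OF y] by blast
    have "lam * (norm (y - p))\<^sup>2 \<le> f p y" by (rule f_ge)
    also have "\<dots> \<le> f p' y + \<epsilon>" using p p'(1) unfolding w_pos by fastforce
    also note p'(2)
    \<comment> \<open>The bound on \<epsilon> keeps almost nearest sites within 2 R h of y; hence
      the averaging map sends the ball of that radius around x into itself.\<close>
    also have "Lam * h\<^sup>2 + \<epsilon> \<le> Lam * (2 * h)\<^sup>2"
      using eps(2) mult_pos_pos[OF Lam_pos zero_less_power[OF h, of 2]] by (simp add: power_mult_distrib)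
    finally have "norm (y - p) \<le> R * (2 * h)" using h by (intro le_of_sq_le) auto
    then show ?thesis by simp
  qed
  define av where "av = (\<lambda>y. \<Sum>p\<in>F. (w p y / W y) *\<^sub>R p)"
  have sum1: "(\<Sum>p\<in>F. w p y / W y) = 1" if "y \<in> cball x (2 * R * h)" for y
    using W_pos[OF that] by (simp add: W_def flip: sum_divide_distrib)
  have av_hull: "av y \<in> convex hull {p\<in>F. w p y > 0}" if y: "y \<in> cball x (2 * R * h)" for y
  proof -
    have "av y = (\<Sum>p\<in>{p\<in>F. w p y > 0}. (w p y / W y) *\<^sub>R p)"
      unfolding av_def using finF w_nn by (intro sum.mono_neutral_right) (force simp: less_le)+
    moreover have "(\<Sum>p\<in>F. w p y / W y) = (\<Sum>p\<in>{p\<in>F. w p y > 0}. w p y / W y)"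
      using finF w_nn by (intro sum.mono_neutral_right) (force simp: less_le)+
    moreover have "(\<Sum>p\<in>{p\<in>F. w p y > 0}. (w p y / W y) *\<^sub>R p) \<in> convex hull {p\<in>F. w p y > 0}"
      if "(\<Sum>p\<in>{p\<in>F. w p y > 0}. w p y / W y) = 1"
      by (rule convex_sum[OF _ convex_convex_hull that])
         (use finF w_nn W_pos[OF y] in \<open>auto intro: hull_inc\<close>)
    ultimately show ?thesis using sum1[OF y] by simp
  qed
  have av_near: "norm (y - av y) \<le> 2 * R * h" if y: "y \<in> cball x (2 * R * h)" for y
  proof -
    have "convex hull {p\<in>F. w p y > 0} \<subseteq> cball y (2 * R * h)"
      using w_near[OF y] by (intro hull_minimal) (auto simp: dist_norm)
    then show ?thesis using av_hull[OF y] by (auto simp: dist_norm)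
  qed
  have cont_w: "continuous_on (cball x (2 * R * h)) (w p)" for p
    unfolding w_def by (intro continuous_on_prod continuous_on_max continuous_intros continuous_f)
  have cont_W: "continuous_on (cball x (2 * R * h)) W"
    unfolding W_def by (intro continuous_on_sum cont_w)
  have W_nz: "\<forall>y\<in>cball x (2 * R * h). W y \<noteq> 0" using W_pos by (metis less_irrefl)
  have "continuous_on (cball x (2 * R * h)) av"
    unfolding av_def
    by (intro continuous_on_sum continuous_on_scaleR continuous_on_divide cont_w cont_W W_nz continuous_on_const)
  then have "continuous_on (cball x (2 * R * h)) (\<lambda>y. y + x - av y)"
    by (intro continuous_on_diff continuous_on_add continuous_on_id continuous_on_const)
  moreover have "(\<lambda>y. y + x - av y) \<in> cball x (2 * R * h) \<rightarrow> cball x (2 * R * h)"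
    using av_near by (auto simp: dist_norm norm_minus_commute algebra_simps)
  moreover have "2 * R * h > 0" using R_pos h by simp
  ultimately obtain y where y: "y \<in> cball x (2 * R * h)" "y + x - av y = y"
    using brouwer_ball[of "2 * R * h" x "\<lambda>y. y + x - av y"] by metis
  then have "x = av y" by (simp add: algebra_simps)
  then have "x \<in> convex hull {p\<in>F. w p y > 0}" using av_hull[OF y(1)] by simp
  then show ?thesis using that[OF y(1)] unfolding w_pos by simp
qed

text \<open>Let \<epsilon> tend to 0 and take a limit y of the points found. A lattice point that is
  not nearest to y is beaten by a fixed margin near y; as \<open>F\<close> is finite, the almost
  nearest sites of late members of the sequence are all sites of y.\<close>

lemma sites_hull_cover:
  assumes h: "h > 0"
  obtains y where "x \<in> convex hull (vor_sites h D y)"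
proof -
  define F where "F = lattice h \<inter> cball x (4 * R * h)"
  have finF: "finite F" unfolding F_def by (rule finite_lattice_bounded[OF h]) simp
  define \<epsilon> where "\<epsilon> = (\<lambda>k. Lam * h\<^sup>2 * inverse (real (Suc k)))"
  have eps: "0 < \<epsilon> k" "\<epsilon> k \<le> Lam * h\<^sup>2" for k
  proof -
    have c: "Lam * h\<^sup>2 > 0" using Lam_pos h by simp
    then show "0 < \<epsilon> k" unfolding \<epsilon>_def by simp
    have "inverse (real (Suc k)) \<le> 1" by (simp add: inverse_le_1_iff)
    then show "\<epsilon> k \<le> Lam * h\<^sup>2" unfolding \<epsilon>_def using c by (simp add: mult_left_le)
  qed
  have eps0: "\<epsilon> \<longlonglongrightarrow> 0"
    unfolding \<epsilon>_def using tendsto_mult_left[OF LIMSEQ_inverse_real_of_nat, of "Lam * h\<^sup>2"]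
    by (simp only: mult_zero_right)
  have "\<exists>y. y \<in> cball x (2 * R * h) \<and> x \<in> convex hull {p\<in>F. \<forall>p'\<in>F. f p y < f p' y + \<epsilon> k}" for k
    by (rule approximate_sites_cover[OF h eps(1)[of k] eps(2)[of k] F_def]) blast
  then have "\<exists>Y. \<forall>k. Y k \<in> cball x (2 * R * h) \<and>
      x \<in> convex hull {p\<in>F. \<forall>p'\<in>F. f p (Y k) < f p' (Y k) + \<epsilon> k}"
    by (intro choice allI)
  then obtain Y where "\<forall>k. Y k \<in> cball x (2 * R * h) \<and>
      x \<in> convex hull {p\<in>F. \<forall>p'\<in>F. f p (Y k) < f p' (Y k) + \<epsilon> k}" ..
  then have Y: "\<And>k. Y k \<in> cball x (2 * R * h)"
    "\<And>k. x \<in> convex hull {p\<in>F. \<forall>p'\<in>F. f p (Y k) < f p' (Y k) + \<epsilon> k}" by simp_all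
  have "compact (cball x (2 * R * h))" by simp
  then obtain y r where y: "y \<in> cball x (2 * R * h)" and r: "strict_mono r" and lim: "(Y \<circ> r) \<longlonglongrightarrow> y"
    using Y(1) unfolding compact_def by blast
  \<comment> \<open>Minimality within \<open>F\<close> suffices: a lattice point outside
    \<open>F\<close> is at distance at least 2 R h from y, and so has value at least Lam h^2, which
    some point of \<open>F\<close> does not exceed.\<close>
  have sites: "p \<in> vor_sites h D y" if p: "p \<in> F" and min: "\<And>p'. p' \<in> F \<Longrightarrow> f p y \<le> f p' y" for p
  proof -
    obtain p0 where p0: "p0 \<in> F" "f p0 y \<le> Lam * h\<^sup>2"
      using near_site_in_ball[OF h y] unfolding F_def by blast
    then have fp: "f p y \<le> Lam * h\<^sup>2" using min by (meson order_trans)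
    have "f p y \<le> f p' y" if p': "p' \<in> lattice h" for p'
    proof (cases "p' \<in> F")
      case False
      then have "4 * R * h < dist x p'" using p' unfolding F_def by auto
      also have "\<dots> \<le> dist x y + dist y p'" by (rule dist_triangle)
      finally have far: "2 * R * h \<le> norm (y - p')" using y by (simp add: dist_norm)
      have "Lam * h\<^sup>2 = lam * (R * h)\<^sup>2" using R_sq by (simp add: power_mult_distrib flip: mult.assoc)
      also have "\<dots> \<le> lam * (norm (y - p'))\<^sup>2"
        using lam_pos far R_pos h by (intro mult_left_mono power_mono) (auto simp: mult.assoc intro: order_trans[of _ "2 * (R * h)"])
      also have "\<dots> \<le> f p' y" by (rule f_ge)
      finally show ?thesis using fp by linarith
    qed (rule min)
    then show ?thesis using p unfolding sites_iff F_def by auto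
  qed
  have ev: "eventually (\<lambda>k. \<not> (\<forall>p'\<in>F. f p ((Y \<circ> r) k) < f p' ((Y \<circ> r) k) + \<epsilon> (r k))) sequentially"
    if p: "p \<in> F" "p \<notin> vor_sites h D y" for p
  proof -
    obtain p' where p': "p' \<in> F" "f p' y < f p y" using sites p by force
    have cf: "isCont (f a) y" for a
      using continuous_f[of UNIV a] by (simp add: continuous_on_eq_continuous_at)
    have "(\<lambda>k. f p ((Y \<circ> r) k)) \<longlonglongrightarrow> f p y" "(\<lambda>k. f p' ((Y \<circ> r) k)) \<longlonglongrightarrow> f p' y"
      using isCont_tendsto_compose[OF cf lim] by blast+
    moreover have "(\<lambda>k. \<epsilon> (r k)) \<longlonglongrightarrow> 0" using LIMSEQ_subseq_LIMSEQ[OF eps0 r] by (simp add: o_def)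
    ultimately have "(\<lambda>k. f p ((Y \<circ> r) k) - (f p' ((Y \<circ> r) k) + \<epsilon> (r k))) \<longlonglongrightarrow> f p y - (f p' y + 0)"
      by (intro tendsto_intros)
    then have "eventually (\<lambda>k. f p ((Y \<circ> r) k) - (f p' ((Y \<circ> r) k) + \<epsilon> (r k)) > 0) sequentially"
      by (rule order_tendstoD) (use p'(2) in simp)
    then show ?thesis by eventually_elim (use p'(1) in force)
  qed
  have "eventually (\<lambda>k. \<forall>p\<in>F - vor_sites h D y.
      \<not> (\<forall>p'\<in>F. f p ((Y \<circ> r) k) < f p' ((Y \<circ> r) k) + \<epsilon> (r k))) sequentially"
    using finF ev by (intro eventually_ball_finite) auto
  then obtain k where k: "\<forall>p\<in>F - vor_sites h D y.
      \<not> (\<forall>p'\<in>F. f p ((Y \<circ> r) k) < f p' ((Y \<circ> r) k) + \<epsilon> (r k))"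
    by (auto simp: eventually_sequentially)
  have "convex hull {p\<in>F. \<forall>p'\<in>F. f p (Y (r k)) < f p' (Y (r k)) + \<epsilon> (r k)} \<subseteq> convex hull (vor_sites h D y)"
    using k by (intro hull_mono) auto
  then show ?thesis using that Y(2) by blast
qed

end

text \<open>The last assumption is the compactness argument \<open>approximate_half_plane\<close> for the finitely
  many relative positions of two neighbouring cells; it holds as soon as \<open>h\<close> is small.\<close>

locale fine_grid = metric_field +
  fixes h :: real
  assumes h_pos: "0 < h" and h_small: "2 * L * R ^ 3 * h < lam"
    and h_sep: "\<And>A n. A \<subseteq> {k \<in> lattice 1. norm k \<le> 4 * R} \<Longrightarrow> norm n = 1 \<Longrightarrow>
      (\<And>a. a \<in> A \<Longrightarrow> a \<bullet> n \<ge> - (8 * L * R\<^sup>2 * h / lam)) \<Longrightarrow> \<exists>n'. n' \<noteq> 0 \<and> (\<forall>a\<in>A. a \<bullet> n' \<ge> 0)"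
begin

abbreviation sites where "sites q \<equiv> vor_sites h D q"

lemma frozen_metric_error:
  assumes "norm (q - p) \<le> \<rho>" "norm (z - p) \<le> \<rho>'"
  shows "\<bar>(q - p) \<bullet> (M z *v (q - p)) - f p q\<bar> \<le> L * \<rho>' * \<rho>\<^sup>2"
proof -
  have "\<bar>(q - p) \<bullet> (M z *v (q - p)) - f p q\<bar> \<le> L * norm (z - p) * norm (q - p) * norm (q - p)"
    unfolding f_def by (rule M_lip)
  also have "\<dots> = (L * norm (z - p)) * (norm (q - p))\<^sup>2" by (simp add: power2_eq_square)
  also have "\<dots> \<le> (L * \<rho>') * \<rho>\<^sup>2"
    using assms L_pos order_trans[OF norm_ge_zero assms(2)] by (intro mult_mono power_mono) auto
  finally show ?thesis .
qed

text \<open>With the metric frozen at q, the difference of the squared distances to q and to p is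
  affine. It is at most m + c - lam h^2 at all other sites, hence also at p, where it equals the
  squared distance to q. For a site p this makes p a vertex; for any other lattice point it keeps p
  out of the polygon.\<close>

lemma lattice_point_not_in_other_sites_hull:
  assumes p: "p \<in> lattice h"
  shows "p \<notin> convex hull (sites q - {p})"
proof
  assume hull: "p \<in> convex hull (sites q - {p})"
  then obtain p1 where p1: "p1 \<in> sites q" by (metis Diff_iff convex_hull_empty empty_iff ex_in_conv)
  define m where "m = f p1 q"
  have m_le: "m \<le> f p' q" if "p' \<in> lattice h" for p' using p1 that by (simp add: m_def sites_iff)
  have m_eq: "f p' q = m" if "p' \<in> sites q" for p'
    using p1 that by (intro antisym) (simp_all add: m_def sites_iff)
  define c where "c = L * R ^ 3 * h ^ 3"
  have err: "\<bar>(q - p') \<bullet> (M q *v (q - p')) - f p' q\<bar> \<le> c" if "norm (q - p') \<le> R * h" for p'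
    using frozen_metric_error[OF that that] by (simp add: c_def power_mult_distrib power3_eq_cube power2_eq_square mult_ac)
  have neg: "(q - x) \<bullet> (M q *v (q - x)) = (x - q) \<bullet> (M q *v (x - q))" for x
    by (simp add: inner_vec2 mat2_mult_vec algebra_simps)
  have "sites q - {p} \<subseteq> {x. (x - q) \<bullet> (M q *v (x - q)) - (x - p) \<bullet> (M q *v (x - p)) \<le> m + c - lam * h\<^sup>2}"
  proof clarify
    fix s assume s: "s \<in> sites q" "s \<noteq> p"
    have "(s - q) \<bullet> (M q *v (s - q)) \<le> m + c"
      using err[OF site_near[OF h_pos s(1)]] m_eq[OF s(1)] neg[of s] by linarith
    moreover have "lam * h\<^sup>2 \<le> lam * (norm (s - p))\<^sup>2"
    proof -
      have "h \<le> norm (s - p)"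
        using s p by (intro lattice_norm_ge lattice_diff h_pos) (auto simp: sites_iff)
      then show ?thesis using lam_pos h_pos by (intro mult_left_mono power_mono) auto
    qed
    moreover have "lam * (norm (s - p))\<^sup>2 \<le> (s - p) \<bullet> (M q *v (s - p))" by (rule M_lower)
    ultimately show "(s - q) \<bullet> (M q *v (s - q)) - (s - p) \<bullet> (M q *v (s - p)) \<le> m + c - lam * h\<^sup>2"
      by linarith
  qed
  moreover have "convex {x. (x - q) \<bullet> (M q *v (x - q)) - (x - p) \<bullet> (M q *v (x - p)) \<le> m + c - lam * h\<^sup>2}"
    unfolding quadratic_difference_affine[OF M_sym] le_diff_eq[symmetric] by (rule convex_halfspace_le)
  ultimately have "p \<in> {x. (x - q) \<bullet> (M q *v (x - q)) - (x - p) \<bullet> (M q *v (x - p)) \<le> m + c - lam * h\<^sup>2}"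
    using hull hull_minimal by blast
  then have "(p - q) \<bullet> (M q *v (p - q)) \<le> m + c - lam * h\<^sup>2" by simp
  moreover have "norm (q - p) \<le> R * h"
  proof -
    have "convex hull (sites q - {p}) \<subseteq> cball q (R * h)"
      using sites_subset[OF h_pos, of q] by (intro hull_minimal) auto
    then show ?thesis using hull by (auto simp: dist_norm)
  qed
  ultimately have "f p q \<le> m + 2 * c - lam * h\<^sup>2" using err[of p] neg[of p] by linarith
  \<comment> \<open>Freezing enters twice, once at the sites and once at p; \<open>h_small\<close>
    is exactly the condition that both errors stay below the lattice gap.\<close>
  moreover have "2 * c < lam * h\<^sup>2"
    using mult_strict_right_mono[OF h_small, of "h\<^sup>2"] h_pos
    by (simp add: c_def power3_eq_cube power2_eq_square mult_ac)
  ultimately show False using m_le[OF p] by linarith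
qed

lemma lattice_Int_T: "lattice h \<inter> T_q h D q = sites q"
proof
  show "lattice h \<inter> T_q h D q \<subseteq> sites q"
  proof
    fix p assume p: "p \<in> lattice h \<inter> T_q h D q"
    show "p \<in> sites q"
    proof (rule ccontr)
      assume "p \<notin> sites q"
      then have "sites q - {p} = sites q" by blast
      then show False using p lattice_point_not_in_other_sites_hull[of p q] by (simp add: T_q_def)
    qed
  qed
  show "sites q \<subseteq> lattice h \<inter> T_q h D q"
    unfolding T_q_def using hull_subset[of "sites q" convex] by (auto simp: sites_iff)
qed

lemma vertices_T: "vertices (T_q h D q) = sites q"
proof
  show "vertices (T_q h D q) \<subseteq> sites q"
    unfolding vertices_def T_q_def using extreme_point_of_convex_hull by blast
  show "sites q \<subseteq> vertices (T_q h D q)"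
  proof
    fix p assume p: "p \<in> sites q"
    then have "p extreme_point_of (convex hull (insert p (sites q - {p})))"
      using finite_sites[OF h_pos] lattice_point_not_in_other_sites_hull[of p q]
      by (intro extreme_point_of_convex_hull_insert) (auto simp: sites_iff)
    then show "p \<in> vertices (T_q h D q)" using p by (simp add: vertices_def T_q_def insert_absorb)
  qed
qed

text \<open>A convex set without interior lies on a line, and of three sites on a line the middle
  one is in the hull of the others.\<close>

lemma interior_T_nonempty:
  assumes "voronoi_vertex h D q"
  shows "interior (T_q h D q) \<noteq> {}"
proof
  assume "interior (T_q h D q) = {}"
  then obtain n b where n: "n \<noteq> 0" "T_q h D q \<subseteq> {x. n \<bullet> x = b}"
    using empty_interior_subset_hyperplane[of "T_q h D q"] unfolding T_q_def by (metis convex_convex_hull)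
  have on: "x \<bullet> n = b" if "x \<in> sites q" for x
    using that n(2) lattice_Int_T[of q] by (auto simp: inner_commute)
  have mid: False if "x \<in> sites q" "y \<in> sites q" "z \<in> sites q" "x \<noteq> y" "y \<noteq> z"
    "x \<bullet> perp n \<le> y \<bullet> perp n" "y \<bullet> perp n \<le> z \<bullet> perp n" for x y z
  proof -
    have "y \<in> closed_segment x z" using that on by (intro between_on_line[OF n(1)]) auto
    moreover have "closed_segment x z \<subseteq> convex hull (sites q - {y})"
      using that by (intro closed_segment_subset_convex_hull) (auto intro: hull_inc)
    ultimately show False using lattice_point_not_in_other_sites_hull[of y q] that(2) by (auto simp: sites_iff)
  qed
  obtain p1 p2 p3 where p: "distinct [p1, p2, p3]" "p1 \<in> sites q" "p2 \<in> sites q" "p3 \<in> sites q"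
    using assms voronoi_vertex_iff by blast
  let ?g = "\<lambda>x. x \<bullet> perp n"
  consider "?g p1 \<le> ?g p2 \<and> ?g p2 \<le> ?g p3" | "?g p1 \<le> ?g p3 \<and> ?g p3 \<le> ?g p2"
    | "?g p2 \<le> ?g p1 \<and> ?g p1 \<le> ?g p3" | "?g p2 \<le> ?g p3 \<and> ?g p3 \<le> ?g p1"
    | "?g p3 \<le> ?g p1 \<and> ?g p1 \<le> ?g p2" | "?g p3 \<le> ?g p2 \<and> ?g p2 \<le> ?g p1" by linarith
  then show False
    using p mid[of p1 p2 p3] mid[of p1 p3 p2] mid[of p2 p1 p3] mid[of p2 p3 p1] mid[of p3 p1 p2] mid[of p3 p2 p1]
    by cases auto
qed

text \<open>If q and q' are far apart, q - q' separates the balls that contain their sites.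
  Otherwise the inequalities f i q \<le> f j q and f j q' \<le> f i q' are added, so that only
  increments between q and q' remain, which the midpoint rule evaluates. The resulting normal
  separates approximately, and \<open>h_sep\<close> exchanges it for an exact one.\<close>

lemma sites_separated:
  assumes q: "q \<noteq> q'"
  obtains n where "n \<noteq> 0" "\<And>i j. i \<in> sites q \<Longrightarrow> j \<in> sites q' \<Longrightarrow> j \<bullet> n \<le> i \<bullet> n"
proof (cases "norm (q - q') \<le> 2 * R * h")
  case False
  define d where "d = q - q'"
  have d0: "d \<noteq> 0" using q by (simp add: d_def)
  have "j \<bullet> d \<le> i \<bullet> d" if i: "i \<in> sites q" and j: "j \<in> sites q'" for i j
  proof -
    have "\<bar>(i - q) \<bullet> d\<bar> \<le> norm (q - i) * norm d" using Cauchy_Schwarz_ineq2[of "i - q" d] by (simp add: norm_minus_commute)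
    also have "\<dots> \<le> (R * h) * norm d" using site_near[OF h_pos i] by (intro mult_right_mono) auto
    finally have 1: "\<bar>(i - q) \<bullet> d\<bar> \<le> (R * h) * norm d" .
    have "\<bar>(j - q') \<bullet> d\<bar> \<le> norm (q' - j) * norm d" using Cauchy_Schwarz_ineq2[of "j - q'" d] by (simp add: norm_minus_commute)
    also have "\<dots> \<le> (R * h) * norm d" using site_near[OF h_pos j] by (intro mult_right_mono) auto
    finally have 2: "\<bar>(j - q') \<bullet> d\<bar> \<le> (R * h) * norm d" .
    have "(2 * R * h) * norm d \<le> norm d * norm d" using False by (intro mult_right_mono) (auto simp: d_def)
    then have 3: "2 * ((R * h) * norm d) \<le> d \<bullet> d" by (simp add: dot_square_norm power2_eq_square)
    have "(i - j) \<bullet> d = (i - q) \<bullet> d - (j - q') \<bullet> d + d \<bullet> d" by (simp add: d_def inner_diff_left)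
    then show ?thesis using 1 2 3 by (simp add: inner_diff_left)
  qed
  then show ?thesis using that d0 by blast
next
  case True
  define d where "d = q - q'"
  define qb where "qb = (1/2) *\<^sub>R (q + q')"
  have d0: "norm d > 0" using q by (simp add: d_def)
  define n where "n = M qb *v d"
  have n_ge: "lam * norm d \<le> norm n"
  proof -
    have "lam * (norm d)\<^sup>2 \<le> d \<bullet> n" unfolding n_def by (rule M_lower)
    also have "\<dots> \<le> norm d * norm n" by (rule norm_cauchy_schwarz)
    finally show ?thesis using d0 by (simp add: power2_eq_square)
  qed
  then have n0: "norm n > 0" using d0 lam_pos by (meson mult_pos_pos order_less_le_trans)
  have dist: "norm (qb - i) \<le> 2 * R * h" if i: "i \<in> sites q \<or> i \<in> sites q'" for i
  proof -
    have eq1: "qb - i = (q - i) - (1/2) *\<^sub>R d" and eq2: "qb - i = (q' - i) + (1/2) *\<^sub>R d"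
      by (simp_all add: qb_def d_def vec_eq_iff field_simps)
    have "norm (qb - i) \<le> norm (q - i) + norm ((1/2) *\<^sub>R d)"
      using norm_triangle_ineq4[of "q - i" "(1/2) *\<^sub>R d"] unfolding eq1 .
    moreover have "norm (qb - i) \<le> norm (q' - i) + norm ((1/2) *\<^sub>R d)"
      using norm_triangle_ineq[of "q' - i" "(1/2) *\<^sub>R d"] unfolding eq2 .
    moreover have "norm ((1/2) *\<^sub>R d) \<le> R * h" using True by (simp add: d_def)
    ultimately show ?thesis using i site_near[OF h_pos, of i q] site_near[OF h_pos, of i q'] by linarith
  qed
  have err: "\<bar>(qb - i) \<bullet> (M i *v d) - (qb - i) \<bullet> n\<bar> \<le> L * (2 * R * h)\<^sup>2 * norm d"
    if i: "i \<in> sites q \<or> i \<in> sites q'" for i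
  proof -
    have "\<bar>(qb - i) \<bullet> (M i *v d) - (qb - i) \<bullet> n\<bar> \<le> L * norm (i - qb) * norm (qb - i) * norm d"
      unfolding n_def by (rule M_lip)
    also have "\<dots> = L * (norm (qb - i))\<^sup>2 * norm d" by (simp add: power2_eq_square norm_minus_commute)
    also have "\<dots> \<le> L * (2 * R * h)\<^sup>2 * norm d"
      using dist[OF i] L_pos by (intro mult_right_mono mult_left_mono power_mono) auto
    finally show ?thesis .
  qed
  \<comment> \<open>The errors at i and j add up to 8 L R^2 h^2 |d|; the bound lam |d| \<le> |n|
    expresses this as a small multiple of h |n|, the natural size of (i - j).n.\<close>
  have approx: "(i - j) \<bullet> n \<ge> - (8 * L * R\<^sup>2 * h / lam) * (h * norm n)"
    if i: "i \<in> sites q" and j: "j \<in> sites q'" for i j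
  proof -
    have "f i q \<le> f j q" "f j q' \<le> f i q'" using i j by (auto simp: sites_iff)
    moreover have "f i q - f i q' = 2 * ((qb - i) \<bullet> (M i *v d))" "f j q - f j q' = 2 * ((qb - j) \<bullet> (M j *v d))"
      unfolding f_def qb_def d_def by (rule quadratic_difference_midpoint[OF M_sym])+
    ultimately have "(qb - i) \<bullet> (M i *v d) \<le> (qb - j) \<bullet> (M j *v d)" by linarith
    then have "(i - j) \<bullet> n \<ge> - 2 * (L * (2 * R * h)\<^sup>2 * norm d)"
      using err[of i] err[of j] i j by (simp add: inner_diff_left)
    moreover have "(8 * L * R\<^sup>2 * h / lam) * (h * (lam * norm d)) \<le> (8 * L * R\<^sup>2 * h / lam) * (h * norm n)"
      using n_ge h_pos L_pos R_pos lam_pos by (intro mult_left_mono) auto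
    moreover have "(8 * L * R\<^sup>2 * h / lam) * (h * (lam * norm d)) = 2 * (L * (2 * R * h)\<^sup>2 * norm d)"
      using lam_pos by (simp add: power_mult_distrib power2_eq_square)
    ultimately show ?thesis by linarith
  qed
  \<comment> \<open>Rescaled to the unit lattice, the relative positions have length at most 4 R
    because all sites involved are within 2 R h of \<open>qb\<close>. They form a subset of a finite
    set independent of h.\<close>
  define A where "A = {(1/h) *\<^sub>R (i - j) | i j. i \<in> sites q \<and> j \<in> sites q'}"
  have "\<exists>n'. n' \<noteq> 0 \<and> (\<forall>a\<in>A. a \<bullet> n' \<ge> 0)"
  proof (rule h_sep)
    show "norm ((1 / norm n) *\<^sub>R n) = 1" using n0 by simp
    show "A \<subseteq> {k \<in> lattice 1. norm k \<le> 4 * R}"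
    proof clarify
      fix a assume "a \<in> A"
      then obtain i j where ij: "a = (1/h) *\<^sub>R (i - j)" "i \<in> sites q" "j \<in> sites q'" unfolding A_def by blast
      have "i - j \<in> lattice h" using ij by (intro lattice_diff) (auto simp: sites_iff)
      then obtain k where k: "k \<in> lattice 1" "i - j = h *\<^sub>R k" by (rule lattice_scaleRE)
      have "norm (i - j) \<le> 4 * R * h"
        using norm_triangle_ineq4[of "qb - j" "qb - i"] dist[of i] dist[of j] ij by simp
      then show "a \<in> lattice 1 \<and> norm a \<le> 4 * R" using ij(1) k h_pos by (simp add: field_simps)
    qed
    fix a assume "a \<in> A"
    then obtain i j where ij: "a = (1/h) *\<^sub>R (i - j)" "i \<in> sites q" "j \<in> sites q'" unfolding A_def by blast
    have "a \<bullet> ((1 / norm n) *\<^sub>R n) = ((i - j) \<bullet> n) / (h * norm n)" unfolding ij(1) by simp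
    moreover have "((i - j) \<bullet> n) / (h * norm n) \<ge> - (8 * L * R\<^sup>2 * h / lam)"
      using approx[OF ij(2,3)] h_pos n0 by (subst pos_le_divide_eq) auto
    ultimately show "a \<bullet> ((1 / norm n) *\<^sub>R n) \<ge> - (8 * L * R\<^sup>2 * h / lam)" by linarith
  qed
  then obtain n' where n': "n' \<noteq> 0" "\<And>a. a \<in> A \<Longrightarrow> a \<bullet> n' \<ge> 0" by blast
  have "j \<bullet> n' \<le> i \<bullet> n'" if "i \<in> sites q" "j \<in> sites q'" for i j
  proof -
    have "((1/h) *\<^sub>R (i - j)) \<bullet> n' \<ge> 0" using that by (intro n'(2)) (auto simp: A_def)
    then show ?thesis using h_pos by (simp add: inner_diff_left zero_le_divide_iff)
  qed
  then show ?thesis using that n'(1) by blast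
qed

text \<open>Distinctness is asked of the centres, not of the polygons. Since Voronoi vertices have
  polygons with interior points, two of them never produce the same polygon.\<close>

lemma T_interiors:
  assumes "q \<noteq> q'"
  shows "interior (T_q h D q) \<inter> interior (T_q h D q') = {}"
    and "T_q h D q \<inter> T_q h D q' = convex hull (vertices (T_q h D q) \<inter> vertices (T_q h D q'))"
proof -
  obtain n where n: "n \<noteq> 0" "\<And>i j. i \<in> sites q \<Longrightarrow> j \<in> sites q' \<Longrightarrow> j \<bullet> n \<le> i \<bullet> n"
    using sites_separated[OF assms] by blast
  have lat: "sites q = lattice h \<inter> convex hull (sites q)" for q
    using lattice_Int_T[of q] by (simp add: T_q_def)
  show "interior (T_q h D q) \<inter> interior (T_q h D q') = {}"
    unfolding T_q_def
    by (rule separated_lattice_polygons(2)[OF finite_sites[OF h_pos] finite_sites[OF h_pos] n lat lat])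
  show "T_q h D q \<inter> T_q h D q' = convex hull (vertices (T_q h D q) \<inter> vertices (T_q h D q'))"
    unfolding vertices_T unfolding T_q_def
    by (rule separated_lattice_polygons(1)[OF finite_sites[OF h_pos] finite_sites[OF h_pos] n lat lat])
qed

lemma T_subset_cball: "T_q h D q \<subseteq> cball q (R * h)"
  unfolding T_q_def using sites_subset[OF h_pos, of q] by (intro hull_minimal) auto

text \<open>A polygon meeting B has all its sites in a fixed bounded set, so it is the hull of one
  of finitely many sets of lattice points.\<close>

lemma finite_Q_bounded:
  assumes "bounded B"
  shows "finite {P \<in> Q_h h D. P \<inter> B \<noteq> {}}"
proof -
  obtain b where b: "\<And>x. x \<in> B \<Longrightarrow> norm x \<le> b" using assms by (auto simp: bounded_iff)
  define F where "F = lattice h \<inter> cball 0 (b + 2 * R * h)"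
  have "finite F" unfolding F_def by (rule finite_lattice_bounded[OF h_pos]) simp
  moreover have "{P \<in> Q_h h D. P \<inter> B \<noteq> {}} \<subseteq> (\<lambda>s. convex hull s) ` Pow F"
  proof
    fix P assume "P \<in> {P \<in> Q_h h D. P \<inter> B \<noteq> {}}"
    then obtain x where P: "P \<in> Q_h h D" "x \<in> P" "x \<in> B" by blast
    then obtain q where q: "P = T_q h D q" by (auto simp: Q_h_def)
    have "sites q \<subseteq> F"
    proof
      fix p assume p: "p \<in> sites q"
      have "x \<in> cball q (R * h)" using P(2) T_subset_cball q by blast
      then have "norm (q - x) \<le> R * h" by (simp add: dist_norm)
      moreover have "norm (q - p) \<le> R * h" using site_near[OF h_pos p] .
      moreover have "norm p \<le> norm (q - p) + norm (q - x) + norm x"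
        using norm_triangle_ineq4[of "q - x + x" "q - p"] norm_triangle_ineq[of "q - x" x] by simp
      ultimately have "norm p \<le> b + 2 * R * h" using b[OF P(3)] by linarith
      then show "p \<in> F" using p by (simp add: F_def sites_iff)
    qed
    then show "P \<in> (\<lambda>s. convex hull s) ` Pow F" using q by (auto simp: T_q_def)
  qed
  ultimately show ?thesis by (meson finite_Pow_iff finite_imageI finite_subset)
qed

text \<open>The uncovered set is open, since near any point only finitely many compact polygons
  occur. Each of its points lies in the hull of at most two sites, hence on one of countably many
  lattice segments, and a nonempty open set is not negligible.\<close>

lemma Union_Q: "\<Union>(Q_h h D) = UNIV"
proof (rule ccontr)
  assume "\<not> ?thesis"
  then obtain x where x: "x \<notin> \<Union>(Q_h h D)" by blast
  define N where "N = \<Union>{P \<in> Q_h h D. P \<inter> cball x 1 \<noteq> {}}"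
  have compP: "compact P" if "P \<in> Q_h h D" for P
  proof -
    obtain q where "P = convex hull (sites q)" using \<open>P \<in> Q_h h D\<close> by (auto simp: Q_h_def T_q_def)
    then show ?thesis using compact_convex_hull[OF finite_imp_compact[OF finite_sites[OF h_pos]]] by simp
  qed
  have "closed N"
    unfolding N_def using finite_Q_bounded[of "cball x 1"] compP
    by (intro closed_Union) (auto intro: compact_imp_closed)
  then have "open (- N \<inter> ball x 1)" by auto
  moreover have "x \<in> - N \<inter> ball x 1" using x by (auto simp: N_def)
  moreover have "negligible (- N \<inter> ball x 1)"
  proof (rule negligible_subset)
    let ?S = "(\<lambda>(a, b). closed_segment a b) ` (lattice h \<times> lattice h)"
    have "negligible (closed_segment a b)" for a b :: vec2
      by (simp add: negligible_convex_interior interior_closed_segment_ge2)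
    then show "negligible (\<Union>?S)"
      using countable_lattice[of h] by (intro negligible_countable_Union) auto
    show "- N \<inter> ball x 1 \<subseteq> \<Union>?S"
    proof
      fix y assume y: "y \<in> - N \<inter> ball x 1"
      obtain q where q: "y \<in> convex hull (sites q)" using sites_hull_cover[OF h_pos] .
      have "\<not> voronoi_vertex h D q"
      proof
        assume "voronoi_vertex h D q"
        then have "T_q h D q \<in> Q_h h D" by (auto simp: Q_h_def)
        moreover have "y \<in> T_q h D q" using q by (simp add: T_q_def)
        moreover have "y \<in> cball x 1" using y by auto
        ultimately have "y \<in> N" unfolding N_def by blast
        then show False using y by blast
      qed
      then have few: "\<not> (distinct [p1, p2, p3] \<and> p1 \<in> sites q \<and> p2 \<in> sites q \<and> p3 \<in> sites q)" for p1 p2 p3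
        using voronoi_vertex_iff by blast
      obtain a where a: "a \<in> sites q" using q by (metis convex_hull_empty empty_iff ex_in_conv)
      obtain b where b: "b \<in> sites q" "sites q \<subseteq> {a, b}"
      proof (cases "sites q = {a}")
        case False
        then obtain b where "b \<in> sites q" "b \<noteq> a" using a by blast
        moreover have "x \<in> {a, b}" if "x \<in> sites q" for x
          using few[of a b x] a calculation that by auto
        ultimately show ?thesis using that by blast
      qed (use that a in blast)
      have "y \<in> closed_segment a b" using q hull_mono[OF b(2), of convex] by (auto simp: segment_convex_hull)
      then show "y \<in> \<Union>?S" using a b(1) by (auto simp: sites_iff)
    qed
  qed
  ultimately show False using open_not_negligible by blast
qed

theorem Qh_polygonization: "Qh_strictly_convex_polygonization h D"
proof -
  have poly: "polygon P" if "P \<in> Q_h h D" for P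
  proof -
    obtain q where q: "P = T_q h D q" "voronoi_vertex h D q" using \<open>P \<in> Q_h h D\<close> by (auto simp: Q_h_def)
    have "compact (convex hull (sites q))"
      using finite_sites[OF h_pos] by (intro compact_convex_hull finite_imp_compact)
    then show ?thesis
      unfolding polygon_def q(1) vertices_T using interior_T_nonempty[OF q(2)] finite_sites[OF h_pos]
      by (auto simp: T_q_def)
  qed
  have meet: "interior P \<inter> interior P' = {} \<and> P \<inter> P' = convex hull (vertices P \<inter> vertices P')"
    if "P \<in> Q_h h D" "P' \<in> Q_h h D" "P \<noteq> P'" for P P'
  proof -
    obtain q q' where "P = T_q h D q" "P' = T_q h D q'" using \<open>P \<in> Q_h h D\<close> \<open>P' \<in> Q_h h D\<close> by (auto simp: Q_h_def)
    then show ?thesis using T_interiors[of q q'] \<open>P \<noteq> P'\<close> by blast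
  qed
  have verts: "\<Union>(vertices ` Q_h h D) = lattice h"
  proof
    show "\<Union>(vertices ` Q_h h D) \<subseteq> lattice h" using vertices_T by (auto simp: Q_h_def sites_iff)
    show "lattice h \<subseteq> \<Union>(vertices ` Q_h h D)"
    proof
      fix p assume p: "p \<in> lattice h"
      have "p \<in> \<Union>(Q_h h D)" using Union_Q by simp
      then obtain q where q: "p \<in> T_q h D q" "T_q h D q \<in> Q_h h D" by (auto simp: Q_h_def)
      then have "p \<in> vertices (T_q h D q)" using p lattice_Int_T[of q] vertices_T[of q] by blast
      then show "p \<in> \<Union>(vertices ` Q_h h D)" using q(2) by blast
    qed
  qed
  show ?thesis
    unfolding Qh_strictly_convex_polygonization_def polygonization_def
  proof (intro conjI ballI allI impI)
    show "vor_sites h D q \<subseteq> vertices (T_q h D q)" for q using vertices_T by simp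
    show "polygon P" if "P \<in> Q_h h D" for P using poly[OF that] .
    show "interior P \<inter> interior P' = {}" "P \<inter> P' = convex hull (vertices P \<inter> vertices P')"
      if "P \<in> Q_h h D" "P' \<in> Q_h h D" "P \<noteq> P'" for P P'
      using meet[OF that] by simp_all
    show "finite {P \<in> Q_h h D. P \<inter> B \<noteq> {}}" if "bounded B" for B using finite_Q_bounded[OF that] .
  qed (fact Union_Q verts)+
qed

end

section \<open>Anisotropic Delaunay triangulations\<close>

lemma det2_eq_perp: "det2 v w = perp v \<bullet> w"
  by (simp add: det2_def inner_vec2)

lemma det2_simps:
  "det2 (v + v') w = det2 v w + det2 v' w" "det2 (v - v') w = det2 v w - det2 v' w"
  "det2 v (w + w') = det2 v w + det2 v w'" "det2 v (w - w') = det2 v w - det2 v w'"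
  "det2 (r *\<^sub>R v) w = r * det2 v w" "det2 v (r *\<^sub>R w) = r * det2 v w"
  "det2 (- v) w = - det2 v w" "det2 v (- w) = - det2 v w" "det2 v v = 0"
  by (simp_all add: det2_def algebra_simps)

lemma convex_det2_halfspaces:
  "convex {x. det2 v (x - p) = 0}" "convex {x. det2 v (x - p) \<le> 0}" "convex {x. 0 \<le> det2 v (x - p)}"
  by (simp_all add: det2_eq_perp inner_diff_right convex_hyperplane convex_halfspace_le convex_halfspace_ge)

lemma det2_zero_imp_parallel:
  assumes "v \<noteq> 0" "det2 v w = 0"
  obtains r where "w = r *\<^sub>R v"
proof (cases "v $ 1 = 0")
  case True
  then have "v $ 2 \<noteq> 0" using assms(1) by (simp add: vec2_eq_0_iff)
  then have "w = (w $ 2 / v $ 2) *\<^sub>R v" using True assms(2) by (simp add: vec_eq_iff forall_2 det2_def)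
  then show ?thesis using that by blast
next
  case False
  then have "w = (w $ 1 / v $ 1) *\<^sub>R v"
    using assms(2) by (simp add: vec_eq_iff forall_2 det2_def field_simps)
  then show ?thesis using that by blast
qed

lemma det2_zero_imp_collinear:
  assumes "det2 (b - a) (c - a) = 0"
  shows "collinear {a, b, c}"
proof (cases "b = a")
  case False
  then obtain r where "c - a = r *\<^sub>R (b - a)" using det2_zero_imp_parallel[OF _ assms] by auto
  then have "collinear {0, b - a, c - a}" by (auto simp: collinear_lemma)
  then have "collinear {b, a, c}" using collinear_3[of b a c] by simp
  then show ?thesis by (simp add: insert_commute)
qed simp

lemma hull3E:
  assumes "x \<in> convex hull {a, b, c}"
  obtains \<alpha> \<beta> where "0 \<le> \<alpha>" "0 \<le> \<beta>" "\<alpha> + \<beta> \<le> 1" "x = a + \<alpha> *\<^sub>R (b - a) + \<beta> *\<^sub>R (c - a)"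
  using assms unfolding convex_hull_3_alt by blast

lemma hull3I:
  assumes "0 \<le> \<alpha>" "0 \<le> \<beta>" "\<alpha> + \<beta> \<le> 1"
  shows "a + \<alpha> *\<^sub>R (b - a) + \<beta> *\<^sub>R (c - a) \<in> convex hull {a, b, c}"
  using assms unfolding convex_hull_3_alt by blast

lemma det2_coords:
  "det2 ((a + \<alpha> *\<^sub>R v + \<beta> *\<^sub>R w) - a) w = \<alpha> * det2 v w" "det2 v ((a + \<alpha> *\<^sub>R v + \<beta> *\<^sub>R w) - a) = \<beta> * det2 v w"
  by (simp_all add: det2_simps)

lemma vertices_triangle:
  assumes "det2 (b - a) (c - a) \<noteq> 0"
  shows "vertices (convex hull {a, b, c}) = {a, b, c}"
proof
  show "vertices (convex hull {a, b, c}) \<subseteq> {a, b, c}"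
    unfolding vertices_def using extreme_point_of_convex_hull by blast
  have ext: "x extreme_point_of (convex hull {x, y, z})" if "det2 (y - x) (z - x) \<noteq> 0" for x y z :: vec2
  proof (rule extreme_point_of_convex_hull_insert)
    have "convex hull {y, z} \<subseteq> {w. det2 (z - y) (w - y) = 0}"
      using det2_simps(9)[of "z - y"] by (intro hull_minimal convex_det2_halfspaces) (auto simp: det2_def)
    moreover have "det2 (z - y) (x - y) \<noteq> 0" using that by (simp add: det2_def algebra_simps)
    ultimately show "x \<notin> convex hull {y, z}" by blast
  qed simp
  have "det2 (c - b) (a - b) \<noteq> 0" "det2 (a - c) (b - c) \<noteq> 0"
    using assms by (simp_all add: det2_def algebra_simps)
  then have "b extreme_point_of (convex hull {b, c, a})" "c extreme_point_of (convex hull {c, a, b})"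
    using ext by blast+
  moreover have "{b, c, a} = {a, b, c}" "{c, a, b} = {a, b, c}" by auto
  ultimately show "{a, b, c} \<subseteq> vertices (convex hull {a, b, c})"
    using ext[OF assms] by (simp add: vertices_def)
qed

text \<open>A lattice vector with a nonintegral coordinate in the basis of two edges, reduced modulo the
  edges and possibly reflected, would be a further lattice point of the triangle.\<close>

lemma empty_triangle_unimodular:
  assumes h: "h > 0" and lat: "a \<in> lattice h" "b \<in> lattice h" "c \<in> lattice h"
    and d0: "det2 (b - a) (c - a) \<noteq> 0"
    and empty: "lattice h \<inter> convex hull {a, b, c} \<subseteq> {a, b, c}"
  shows "\<bar>det2 (b - a) (c - a)\<bar> = h\<^sup>2"
proof -
  obtain v where v: "v \<in> lattice 1" "b - a = h *\<^sub>R v" using lattice_scaleRE[OF lattice_diff[OF lat(2,1)]] .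
  obtain w where w: "w \<in> lattice 1" "c - a = h *\<^sub>R w" using lattice_scaleRE[OF lattice_diff[OF lat(3,1)]] .
  define d where "d = det2 v w"
  have D: "det2 (b - a) (c - a) = h\<^sup>2 * d" using v w by (simp add: d_def det2_simps power2_eq_square)
  have dn: "d \<noteq> 0" using D d0 by auto
  have inside: "(\<alpha> = 0 \<and> \<beta> = 0) \<or> (\<alpha> = 1 \<and> \<beta> = 0) \<or> (\<alpha> = 0 \<and> \<beta> = 1)"
    if "\<alpha> *\<^sub>R v + \<beta> *\<^sub>R w \<in> lattice 1" "0 \<le> \<alpha>" "0 \<le> \<beta>" "\<alpha> + \<beta> \<le> 1" for \<alpha> \<beta>
  proof -
    let ?x = "a + \<alpha> *\<^sub>R (b - a) + \<beta> *\<^sub>R (c - a)"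
    have eq: "?x = a + h *\<^sub>R (\<alpha> *\<^sub>R v + \<beta> *\<^sub>R w)" unfolding v(2) w(2) by (simp add: algebra_simps)
    have "?x \<in> lattice h" unfolding eq by (rule lattice_add[OF lat(1) scaleR_lattice[OF that(1)]])
    then have x: "?x = a \<or> ?x = b \<or> ?x = c" using hull3I[OF that(2-4), of a b c] empty by blast
    have co: "\<alpha> * det2 (b - a) (c - a) = det2 (?x - a) (c - a)" "\<beta> * det2 (b - a) (c - a) = det2 (b - a) (?x - a)"
      by (simp_all only: det2_coords)
    show ?thesis using x
    proof (elim disjE)
      assume "?x = a" then show ?thesis using co d0 by (simp add: det2_def)
    next
      assume e: "?x = b" show ?thesis using co d0 unfolding e by (simp add: det2_simps)
    next
      assume e: "?x = c" show ?thesis using co d0 unfolding e by (simp add: det2_simps)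
    qed
  qed
  have ints: "det2 k w / d \<in> \<int> \<and> det2 v k / d \<in> \<int>" if k: "k \<in> lattice 1" for k
  proof -
    define \<alpha> where "\<alpha> = det2 k w / d" define \<beta> where "\<beta> = det2 v k / d"
    have "d *\<^sub>R k = det2 k w *\<^sub>R v + det2 v k *\<^sub>R w"
      by (simp add: vec_eq_iff forall_2 det2_def d_def algebra_simps)
    then have "(1/d) *\<^sub>R d *\<^sub>R k = (1/d) *\<^sub>R (det2 k w *\<^sub>R v + det2 v k *\<^sub>R w)" by simp
    then have kk: "k = \<alpha> *\<^sub>R v + \<beta> *\<^sub>R w" using dn by (simp add: \<alpha>_def \<beta>_def scaleR_add_right)
    have fr: "frac \<alpha> *\<^sub>R v + frac \<beta> *\<^sub>R w = k - (of_int \<lfloor>\<alpha>\<rfloor> *\<^sub>R v + of_int \<lfloor>\<beta>\<rfloor> *\<^sub>R w)"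
      unfolding kk frac_def by (simp add: algebra_simps)
    have l1: "frac \<alpha> *\<^sub>R v + frac \<beta> *\<^sub>R w \<in> lattice 1"
      unfolding fr by (intro lattice_diff lattice_add lattice_of_int k v w)
    have "(1 - frac \<alpha>) *\<^sub>R v + (1 - frac \<beta>) *\<^sub>R w = (v + w) - (frac \<alpha> *\<^sub>R v + frac \<beta> *\<^sub>R w)"
      by (simp add: algebra_simps)
    then have l2: "(1 - frac \<alpha>) *\<^sub>R v + (1 - frac \<beta>) *\<^sub>R w \<in> lattice 1"
      using lattice_diff[OF lattice_add[OF v(1) w(1)] l1] by simp
    have fb: "0 \<le> frac \<alpha>" "frac \<alpha> < 1" "0 \<le> frac \<beta>" "frac \<beta> < 1" by (simp_all add: frac_lt_1)
    have "frac \<alpha> = 0 \<and> frac \<beta> = 0"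
    proof (cases "frac \<alpha> + frac \<beta> \<le> 1")
      case True
      then show ?thesis using inside[OF l1] fb by linarith
    next
      case False
      then show ?thesis using inside[OF l2] fb by linarith
    qed
    then show ?thesis by (simp add: \<alpha>_def \<beta>_def)
  qed
  have e: "(vector [1, 0] :: vec2) \<in> lattice 1" "(vector [0, 1] :: vec2) \<in> lattice 1"
    by (simp_all add: lattice_1_iff)
  have i: "w $ 2 / d \<in> \<int>" "v $ 2 / d \<in> \<int>" "w $ 1 / d \<in> \<int>" "v $ 1 / d \<in> \<int>"
    using ints[OF e(1)] ints[OF e(2)]
    by (simp_all add: det2_def)
  \<comment> \<open>Integrality on the standard basis says that the inverse of the matrix with
    columns v, w is integral. Its determinant 1/d is then an integer, as is d.\<close>
  then have "(v $ 1 / d) * (w $ 2 / d) - (v $ 2 / d) * (w $ 1 / d) \<in> \<int>"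
    by (intro Ints_diff Ints_mult)
  moreover have "(v $ 1 / d) * (w $ 2 / d) - (v $ 2 / d) * (w $ 1 / d) = 1 / d"
  proof -
    have "(v $ 1 / d) * (w $ 2 / d) - (v $ 2 / d) * (w $ 1 / d) = d / (d * d)"
      by (simp add: d_def det2_def diff_divide_distrib)
    then show ?thesis using dn by simp
  qed
  ultimately obtain j :: int where j: "1 / d = of_int j" by (auto elim: Ints_cases)
  obtain j' :: int where j': "d = of_int j'" using det2_Ints[OF v(1) w(1)] unfolding d_def by (auto elim: Ints_cases)
  have "of_int j * of_int j' = (1::real)" unfolding j[symmetric] j'[symmetric] using dn by simp
  then have "j * j' = 1" by (metis of_int_eq_1_iff of_int_mult)
  then have "\<bar>j'\<bar> = 1" by (auto simp: zmult_eq_1_iff)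
  then have "\<bar>d\<bar> = 1" using j' by simp
  then show ?thesis unfolding D by (simp add: abs_mult)
qed

lemma half_lattice_double: "m \<in> lattice (h / 2) \<longleftrightarrow> 2 *\<^sub>R m \<in> lattice h"
  unfolding lattice_def by (auto simp: field_simps)

text \<open>Unimodularity gives points of (h/2) Z^2 half-integral coordinates in the basis of two
  edges. Only six such points lie in the triangle: three vertices and three midpoints.\<close>

lemma half_point_of_triangle:
  assumes h: "h > 0" and lat: "a \<in> lattice h" "b \<in> lattice h" "c \<in> lattice h"
    and d: "\<bar>det2 (b - a) (c - a)\<bar> = h\<^sup>2"
    and m: "m \<in> lattice (h / 2)" "m \<in> convex hull {a, b, c}" "m \<notin> lattice h"
  shows "m = (1/2) *\<^sub>R (a + b) \<or> m = (1/2) *\<^sub>R (b + c) \<or> m = (1/2) *\<^sub>R (c + a)"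
proof -
  obtain \<alpha> \<beta> where ab: "0 \<le> \<alpha>" "0 \<le> \<beta>" "\<alpha> + \<beta> \<le> 1" "m = a + \<alpha> *\<^sub>R (b - a) + \<beta> *\<^sub>R (c - a)"
    using hull3E[OF m(2)] .
  obtain v where v: "v \<in> lattice 1" "b - a = h *\<^sub>R v" using lattice_scaleRE[OF lattice_diff[OF lat(2,1)]] .
  obtain w where w: "w \<in> lattice 1" "c - a = h *\<^sub>R w" using lattice_scaleRE[OF lattice_diff[OF lat(3,1)]] .
  have "2 *\<^sub>R m - 2 *\<^sub>R a \<in> lattice h"
    using m(1) lattice_add[OF lat(1) lat(1)] by (intro lattice_diff) (simp_all add: half_lattice_double scaleR_2)
  then obtain k where k: "k \<in> lattice 1" "2 *\<^sub>R m - 2 *\<^sub>R a = h *\<^sub>R k" by (rule lattice_scaleRE)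
  define e where "e = det2 v w"
  have "det2 (b - a) (c - a) = h\<^sup>2 * e" unfolding v(2) w(2) by (simp add: e_def det2_simps power2_eq_square)
  then have "h\<^sup>2 * \<bar>e\<bar> = h\<^sup>2 * 1" using d by (simp add: abs_mult)
  then have "\<bar>e\<bar> = 1" using h by simp
  then have e: "e = 1 \<or> e = -1" by linarith
  have "h *\<^sub>R k = 2 *\<^sub>R (\<alpha> *\<^sub>R (h *\<^sub>R v) + \<beta> *\<^sub>R (h *\<^sub>R w))"
    unfolding k(2)[symmetric] ab(4) v w by (simp add: algebra_simps)
  also have "\<dots> = h *\<^sub>R ((2 * \<alpha>) *\<^sub>R v + (2 * \<beta>) *\<^sub>R w)" by (simp add: algebra_simps)
  finally have kk: "k = (2 * \<alpha>) *\<^sub>R v + (2 * \<beta>) *\<^sub>R w" using h by simp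
  have "det2 k w = 2 * \<alpha> * e" "det2 v k = 2 * \<beta> * e" unfolding kk by (simp_all add: det2_simps e_def)
  then have "2 * \<alpha> * e \<in> \<int>" "2 * \<beta> * e \<in> \<int>" using det2_Ints[OF k(1) w(1)] det2_Ints[OF v(1) k(1)] by simp_all
  then have "2 * \<alpha> \<in> \<int>" "2 * \<beta> \<in> \<int>" using e by auto
  then obtain i j :: int where ij: "2 * \<alpha> = of_int i" "2 * \<beta> = of_int j" by (auto elim!: Ints_cases)
  have "of_int i \<ge> (0::real)" "of_int j \<ge> (0::real)" "of_int (i + j) \<le> (2::real)" using ab ij by simp_all
  then have "0 \<le> i" "0 \<le> j" "i + j \<le> 2" by linarith+
  then have cases: "(i = 0 \<and> j = 0) \<or> (i = 1 \<and> j = 0) \<or> (i = 2 \<and> j = 0) \<or> (i = 0 \<and> j = 1) \<or> (i = 1 \<and> j = 1) \<or> (i = 0 \<and> j = 2)"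
    by presburger
  have \<alpha>\<beta>: "\<alpha> = of_int i / 2" "\<beta> = of_int j / 2" using ij by simp_all
  have "m \<noteq> a" "m \<noteq> b" "m \<noteq> c" using lat m(3) by auto
  then show ?thesis using cases unfolding ab(4) \<alpha>\<beta>
    by (elim disjE conjE) (auto simp: vec_eq_iff forall_2 field_simps)
qed

text \<open>Without a, the hull of W lies on the line through b and c, which misses the midpoint;
  likewise without b. This is how a midpoint in the intersection of two triangles exposes a common
  edge.\<close>

lemma midpoint_in_subhull:
  assumes d: "det2 (b - a) (c - a) \<noteq> 0" and W: "W \<subseteq> {a, b, c}"
    and m: "(1/2) *\<^sub>R (a + b) \<in> convex hull W"
  shows "a \<in> W \<and> b \<in> W"
proof -
  have "x \<in> W" if "(x = a \<and> y = b) \<or> (x = b \<and> y = a)" for x y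
  proof (rule ccontr)
    assume "x \<notin> W"
    then have "W \<subseteq> {y, c}" using W that by auto
    then have "W \<subseteq> {w. det2 (c - y) (w - y) = 0}" using det2_simps(9)[of "c - y"] by (auto simp: det2_def)
    then have "convex hull W \<subseteq> {w. det2 (c - y) (w - y) = 0}"
      using convex_det2_halfspaces by (intro hull_minimal) auto
    then have "det2 (c - y) ((1/2) *\<^sub>R (a + b) - y) = 0" using m by blast
    moreover have "(1/2) *\<^sub>R (a + b) - y = (1/2) *\<^sub>R (x - y)"
      using that by (auto simp: vec_eq_iff field_simps)
    ultimately have "det2 (c - y) (x - y) = 0" by (simp add: det2_simps(6))
    then show False using that d by (auto simp: det2_def algebra_simps)
  qed
  then show ?thesis by blast
qed

context fine_grid
begin

text \<open>The fourth vertex of the parallelogram spanned at \<open>a\<close> is not much closer to \<open>q\<close> than the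
  sites, which bounds the scalar product of the two edges from below.\<close>

lemma sites_almost_acute:
  assumes s: "a \<in> sites q" "b \<in> sites q" "c \<in> sites q" and z: "norm (z - q) \<le> \<rho> * h" and rho: "0 \<le> \<rho>"
  shows "(b - a) \<bullet> (M z *v (c - a)) \<ge> - ((15 * L * R ^ 3 + 4 * L * \<rho> * R\<^sup>2) * h ^ 3)"
proof -
  define m where "m = f a q"
  have m_le: "m \<le> f p' q" if "p' \<in> lattice h" for p' using s(1) that by (simp add: m_def sites_iff)
  have m_eq: "f p' q = m" if "p' \<in> sites q" for p'
    using s(1) that by (intro antisym) (simp_all add: m_def sites_iff)
  define C where "C = L * R ^ 3 * h ^ 3"
  have err: "\<bar>(q - p') \<bullet> (M q *v (q - p')) - m\<bar> \<le> C" if "p' \<in> sites q" for p'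
    using frozen_metric_error[OF site_near[OF h_pos that] site_near[OF h_pos that]] m_eq[OF that]
    by (simp add: C_def power_mult_distrib power3_eq_cube power2_eq_square mult_ac)
  define e where "e = b + c - a"
  have el: "e \<in> lattice h" unfolding e_def using s by (intro lattice_diff lattice_add) (auto simp: sites_iff)
  have "norm (q - e) \<le> norm (q - b) + norm (q - c) + norm (q - a)"
  proof -
    have eq: "q - e = (q - b) + (q - c) - (q - a)" by (simp add: e_def)
    show ?thesis unfolding eq using norm_triangle_ineq4[of "(q - b) + (q - c)" "q - a"] norm_triangle_ineq[of "q - b" "q - c"] by linarith
  qed
  then have ne: "norm (q - e) \<le> 3 * R * h" using s[THEN site_near[OF h_pos]] by linarith
  have "\<bar>(q - e) \<bullet> (M q *v (q - e)) - f e q\<bar> \<le> 27 * C"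
    using frozen_metric_error[OF ne ne]
    by (simp add: C_def power_mult_distrib power3_eq_cube power2_eq_square mult_ac)
  then have "(q - e) \<bullet> (M q *v (q - e)) \<ge> m - 27 * C" using m_le[OF el] by linarith
  moreover have "(q - e) \<bullet> (M q *v (q - e)) = (q - b) \<bullet> (M q *v (q - b)) + (q - c) \<bullet> (M q *v (q - c))
      - (q - a) \<bullet> (M q *v (q - a)) + 2 * ((b - a) \<bullet> (M q *v (c - a)))"
    by (simp add: e_def inner_vec2 mat2_mult_vec sym_mat2[OF M_sym] algebra_simps)
  \<comment> \<open>27 is the cube of the factor in |q - e| \<le> 3 R h. With one error
    \<open>C\<close> from each of a, b, c the total is 30 \<open>C\<close>, and the factor 2 before
    the scalar product leaves 15.\<close>
  ultimately have 1: "(b - a) \<bullet> (M q *v (c - a)) \<ge> - (15 * C)"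
    using err[OF s(1)] err[OF s(2)] err[OF s(3)] by linarith
  have edge: "norm (x - a) \<le> 2 * R * h" if "x \<in> sites q" for x
    using norm_triangle_ineq4[of "q - a" "q - x"] site_near[OF h_pos that] site_near[OF h_pos s(1)] by simp
  have "\<bar>(b - a) \<bullet> (M z *v (c - a)) - (b - a) \<bullet> (M q *v (c - a))\<bar> \<le> L * norm (z - q) * norm (b - a) * norm (c - a)"
    by (rule M_lip)
  also have "\<dots> \<le> L * (\<rho> * h) * (2 * R * h) * (2 * R * h)"
    using z edge[OF s(2)] edge[OF s(3)] L_pos R_pos h_pos rho by (intro mult_mono) auto
  also have "\<dots> = 4 * L * \<rho> * R\<^sup>2 * h ^ 3" by (simp add: power3_eq_cube power2_eq_square)
  finally show ?thesis using 1 by (simp add: C_def algebra_simps)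
qed

end

section \<open>Combinatorics of the triangulation\<close>

locale adt_grid = fine_grid +
  fixes T :: "vec2 set set"
  assumes ADT: "ADT h D T"
begin

definition H :: "vec2 set" where "H = lattice (h / 2) - lattice h"

text \<open>Fixes an ordering of the vertices and records a point q of which all three are sites;
  from q come the size of the triangle and its almost acute angles.\<close>

definition tri where
  "tri t a b c \<longleftrightarrow> t = convex hull {a, b, c} \<and> vertices t = {a, b, c} \<and> \<bar>det2 (b - a) (c - a)\<bar> = h\<^sup>2
    \<and> (\<exists>q. a \<in> sites q \<and> b \<in> sites q \<and> c \<in> sites q)"

lemma tri_rotate: "tri t a b c \<Longrightarrow> tri t b c a"
proof -
  have "{b, c, a} = {a, b, c}" by auto
  moreover have "det2 (c - b) (a - b) = det2 (b - a) (c - a)" by (simp add: det2_def algebra_simps)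
  ultimately show "tri t a b c \<Longrightarrow> tri t b c a" unfolding tri_def by metis
qed

lemma tri_swap: "tri t a b c \<Longrightarrow> tri t b a c"
proof -
  have "{b, a, c} = {a, b, c}" by auto
  moreover have "\<bar>det2 (a - b) (c - b)\<bar> = \<bar>det2 (b - a) (c - a)\<bar>" by (simp add: det2_def algebra_simps)
  ultimately show "tri t a b c \<Longrightarrow> tri t b a c" unfolding tri_def by metis
qed

lemma tri_det: "tri t a b c \<Longrightarrow> det2 (b - a) (c - a) \<noteq> 0"
  using h_pos by (auto simp: tri_def)

lemma tri_distinct: "tri t a b c \<Longrightarrow> a \<noteq> b \<and> b \<noteq> c \<and> c \<noteq> a"
  using tri_det by (fastforce simp: det2_def)

lemma tri_lattice: "tri t a b c \<Longrightarrow> a \<in> lattice h \<and> b \<in> lattice h \<and> c \<in> lattice h"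
  by (auto simp: tri_def sites_iff)

text \<open>A lattice point of t is a lattice point of the surrounding polygon, hence a vertex of
  it, and an extreme point of the polygon is extreme in t. So t is empty, and empty triangles are
  unimodular.\<close>

lemma tri_ex:
  assumes t: "t \<in> T"
  obtains a b c where "tri t a b c" "lattice h \<inter> t = {a, b, c}"
proof -
  have "triangle t" using ADT t by (auto simp: ADT_def)
  then obtain a b c where abc: "\<not> collinear {a, b, c}" "t = convex hull {a, b, c}"
    unfolding triangle_def by blast
  have d0: "det2 (b - a) (c - a) \<noteq> 0" using det2_zero_imp_collinear abc(1) by blast
  have V: "vertices t = {a, b, c}" unfolding abc(2) by (rule vertices_triangle[OF d0])
  obtain P where P: "P \<in> Q_h h D" "t \<subseteq> P" "vertices t \<subseteq> vertices P" using ADT t by (auto simp: ADT_def)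
  then obtain q where q: "P = T_q h D q" by (auto simp: Q_h_def)
  have s: "{a, b, c} \<subseteq> sites q" using P(3) unfolding V q vertices_T .
  have lat: "{a, b, c} \<subseteq> lattice h" using s by (auto simp: sites_iff)
  have "lattice h \<inter> t \<subseteq> {a, b, c}"
  proof
    fix p assume p: "p \<in> lattice h \<inter> t"
    then have "p \<in> vertices P" using P(2) lattice_Int_T[of q] unfolding q vertices_T by blast
    then have "p \<in> vertices t"
      using p P(2) unfolding vertices_def extreme_point_of_def by blast
    then show "p \<in> {a, b, c}" unfolding V .
  qed
  moreover from this have "\<bar>det2 (b - a) (c - a)\<bar> = h\<^sup>2"
    using lat empty_triangle_unimodular[OF h_pos _ _ _ d0] unfolding abc(2) by blast
  moreover have "{a, b, c} \<subseteq> t" unfolding abc(2) by (rule hull_subset)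
  ultimately show ?thesis using that[of a b c] abc(2) V s lat unfolding tri_def by blast
qed

lemma tri_midpoint:
  assumes t: "t \<in> T" "tri t a b c"
  shows "(1/2) *\<^sub>R (a + b) \<in> H \<inter> t"
proof -
  let ?m = "(1/2) *\<^sub>R (a + b)"
  have lat: "a \<in> lattice h" "b \<in> lattice h" using tri_lattice[OF t(2)] by simp_all
  have eq: "?m = a + (1/2) *\<^sub>R (b - a) + 0 *\<^sub>R (c - a)" by (simp add: vec_eq_iff field_simps)
  have "?m \<in> t" unfolding eq using hull3I[of "1/2" 0 a b c] t(2) by (simp add: tri_def)
  moreover have "?m \<notin> lattice h"
  proof
    assume "?m \<in> lattice h"
    obtain a' b' c' where "tri t a' b' c'" "lattice h \<inter> t = {a', b', c'}" using tri_ex[OF t(1)] .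
    then have "lattice h \<inter> t = {a, b, c}" using t(2) unfolding tri_def by metis
    then have "?m = a \<or> ?m = b \<or> ?m = c" using \<open>?m \<in> lattice h\<close> \<open>?m \<in> t\<close> by blast
    then show False
    proof (elim disjE)
      assume m: "?m = c"
      have "det2 (b - a) (?m - a) = 0" by (simp add: det2_def field_simps)
      then show False using tri_det[OF t(2)] m by simp
    next
      assume "?m = a"
      then have "a = b" by (simp add: vec_eq_iff)
      then show False using tri_distinct[OF t(2)] by simp
    next
      assume "?m = b"
      then have "a = b" by (simp add: vec_eq_iff)
      then show False using tri_distinct[OF t(2)] by simp
    qed
  qed
  moreover have "?m \<in> lattice (h / 2)" using lattice_add[OF lat] by (simp add: half_lattice_double)
  ultimately show ?thesis by (simp add: H_def)
qed

lemma tri_edge_of_half_point: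
  assumes t: "t \<in> T" and m: "m \<in> H" "m \<in> t"
  obtains a b c where "tri t a b c" "m = (1/2) *\<^sub>R (a + b)"
proof -
  obtain a b c where abc: "tri t a b c" using tri_ex[OF t] by metis
  have d: "\<bar>det2 (b - a) (c - a)\<bar> = h\<^sup>2" and mt: "m \<in> convex hull {a, b, c}" using abc m(2) by (auto simp: tri_def)
  have "m = (1/2) *\<^sub>R (a + b) \<or> m = (1/2) *\<^sub>R (b + c) \<or> m = (1/2) *\<^sub>R (c + a)"
    using half_point_of_triangle[OF h_pos _ _ _ d _ mt] tri_lattice[OF abc] m(1) by (auto simp: H_def)
  then show ?thesis using that abc tri_rotate by blast
qed

lemma tri_half_points:
  assumes t: "t \<in> T" "tri t a b c"
  shows "H \<inter> t = {(1/2) *\<^sub>R (b + c), (1/2) *\<^sub>R (c + a), (1/2) *\<^sub>R (a + b)}"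
    and "(1/2) *\<^sub>R (b + c) \<noteq> (1/2) *\<^sub>R (c + a)" "(1/2) *\<^sub>R (b + c) \<noteq> (1/2) *\<^sub>R (a + b)"
    "(1/2) *\<^sub>R (c + a) \<noteq> (1/2) *\<^sub>R (a + b)"
proof -
  have d: "\<bar>det2 (b - a) (c - a)\<bar> = h\<^sup>2" and t': "t = convex hull {a, b, c}" using t(2) by (auto simp: tri_def)
  have "H \<inter> t \<subseteq> {(1/2) *\<^sub>R (b + c), (1/2) *\<^sub>R (c + a), (1/2) *\<^sub>R (a + b)}"
    using half_point_of_triangle[OF h_pos _ _ _ d] tri_lattice[OF t(2)] unfolding H_def t' by blast
  moreover have "{(1/2) *\<^sub>R (b + c), (1/2) *\<^sub>R (c + a), (1/2) *\<^sub>R (a + b)} \<subseteq> H \<inter> t"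
    using tri_midpoint[OF t] tri_midpoint[OF t(1) tri_rotate[OF t(2)]]
      tri_midpoint[OF t(1) tri_rotate[OF tri_rotate[OF t(2)]]] by blast
  ultimately show "H \<inter> t = {(1/2) *\<^sub>R (b + c), (1/2) *\<^sub>R (c + a), (1/2) *\<^sub>R (a + b)}" by blast
  show "(1/2) *\<^sub>R (b + c) \<noteq> (1/2) *\<^sub>R (c + a)" "(1/2) *\<^sub>R (b + c) \<noteq> (1/2) *\<^sub>R (a + b)"
    "(1/2) *\<^sub>R (c + a) \<noteq> (1/2) *\<^sub>R (a + b)"
    using tri_distinct[OF t(2)] by (auto simp: add.commute)
qed

text \<open>Conformity makes the intersection the hull of the common vertices, and a midpoint in it
  forces both ends of the edge to be common.\<close>

lemma shared_edge:
  assumes t: "t \<in> T" "tri t a b c" and t': "t' \<in> T" and m: "(1/2) *\<^sub>R (a + b) \<in> t'"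
  obtains c' where "tri t' a b c'"
proof (cases "t = t'")
  case True then show ?thesis using that t by blast
next
  case False
  let ?m = "(1/2) *\<^sub>R (a + b)"
  have m': "?m \<in> H" "?m \<in> t" using tri_midpoint[OF t] by auto
  have "t \<inter> t' = convex hull (vertices t \<inter> vertices t')" using ADT t(1) t' False by (auto simp: ADT_def)
  then have "?m \<in> convex hull (vertices t \<inter> vertices t')" using m m' by blast
  moreover have "vertices t \<inter> vertices t' \<subseteq> {a, b, c}" using t(2) by (auto simp: tri_def)
  ultimately have ab: "a \<in> vertices t'" "b \<in> vertices t'"
    using midpoint_in_subhull[OF tri_det[OF t(2)]] by blast+
  obtain x y z where xyz: "tri t' x y z" using tri_ex[OF t'] by metis
  then have "a \<in> {x, y, z}" "b \<in> {x, y, z}" using ab by (auto simp: tri_def)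
  moreover have "a \<noteq> b" using tri_distinct[OF t(2)] by simp
  ultimately show ?thesis
    using that xyz tri_rotate[OF xyz] tri_rotate[OF tri_rotate[OF xyz]]
      tri_swap[OF xyz] tri_swap[OF tri_rotate[OF xyz]] tri_swap[OF tri_rotate[OF tri_rotate[OF xyz]]]
    by auto
qed

text \<open>With equal determinants the third vertices differ by a multiple of the edge. A point
  slightly off the midpoint then lies in both triangles, whereas conformity confines the
  intersection of distinct ones to the line of the edge.\<close>

lemma same_side_unique:
  assumes t: "t \<in> T" "tri t a b c" and t': "t' \<in> T" "tri t' a b c'"
    and side: "det2 (b - a) (c - a) = det2 (b - a) (c' - a)"
  shows "t = t'"
proof (rule ccontr)
  assume ne: "t \<noteq> t'"
  have "c \<noteq> c'" using ne t t' by (auto simp: tri_def)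
  define v where "v = b - a"
  define w where "w = c - a"
  have d0: "det2 v w \<noteq> 0" using tri_det[OF t(2)] by (simp add: v_def w_def)
  obtain l where l: "c' - a = w + l *\<^sub>R v"
  proof -
    have e: "det2 v w *\<^sub>R (c' - a) = det2 v (c' - a) *\<^sub>R w + det2 (c' - a) w *\<^sub>R v"
      by (simp add: vec_eq_iff forall_2 det2_def algebra_simps)
    have "det2 v (c' - a) = det2 v w" using side by (simp add: v_def w_def)
    then have "(1 / det2 v w) *\<^sub>R (det2 v w *\<^sub>R (c' - a)) = (1 / det2 v w) *\<^sub>R (det2 v w *\<^sub>R w + det2 (c' - a) w *\<^sub>R v)"
      using e by simp
    then have "c' - a = w + (det2 (c' - a) w / det2 v w) *\<^sub>R v" using d0 by (simp add: scaleR_add_right)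
    then show ?thesis using that by blast
  qed
  \<comment> \<open>So small that 1/2 - s l stays between 1/4 and 3/4, which keeps x in the second
    triangle.\<close>
  define s where "s = 1 / (4 * (1 + \<bar>l\<bar>))"
  have s0: "s > 0" by (simp add: s_def add_pos_nonneg)
  have s1: "s \<le> 1/4" unfolding s_def by (simp add: divide_simps)
  have sl: "\<bar>s * l\<bar> \<le> 1/4" unfolding s_def by (simp add: abs_mult divide_simps)
  define x where "x = a + (1/2) *\<^sub>R v + s *\<^sub>R w"
  have "x \<in> t" unfolding x_def v_def w_def using t(2) s0 s1 by (auto simp: tri_def intro!: hull3I)
  moreover have "x = a + (1/2 - s * l) *\<^sub>R (b - a) + s *\<^sub>R (c' - a)"
    unfolding x_def l by (simp add: v_def algebra_simps)
  then have "x \<in> t'" using t'(2) s0 s1 sl by (auto simp: tri_def intro!: hull3I)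
  moreover have "t \<inter> t' = convex hull (vertices t \<inter> vertices t')"
    using ADT t(1) t'(1) ne by (simp only: ADT_def) blast
  ultimately have "x \<in> convex hull (vertices t \<inter> vertices t')" by blast
  moreover have "vertices t \<inter> vertices t' \<subseteq> {y. det2 v (y - a) = 0}"
  proof -
    have "vertices t \<inter> vertices t' \<subseteq> {a, b}"
      using t(2) t'(2) tri_distinct[OF t(2)] tri_distinct[OF t'(2)] \<open>c \<noteq> c'\<close> by (auto simp: tri_def)
    moreover have "{a, b} \<subseteq> {y. det2 v (y - a) = 0}" by (simp add: v_def det2_simps(9)) (simp add: det2_def)
    ultimately show ?thesis by blast
  qed
  ultimately have "x \<in> {y. det2 v (y - a) = 0}"
    using hull_minimal[of _ "{y. det2 v (y - a) = 0}" convex] convex_det2_halfspaces by blast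
  moreover have "det2 v (x - a) = s * det2 v w" unfolding x_def by (simp add: det2_simps)
  ultimately show False using s0 d0 by simp
qed

lemma triangle_compact: "t \<in> T \<Longrightarrow> compact t" "t \<in> T \<Longrightarrow> convex t"
  by (metis tri_ex tri_def finite_imp_compact_convex_hull finite.emptyI finite_insert,
      metis tri_ex tri_def convex_convex_hull)

lemma tri_norm:
  assumes "tri t a b c" "x \<in> t" "y \<in> t"
  shows "norm (x - y) \<le> 2 * R * h"
proof -
  obtain q where q: "a \<in> sites q" "b \<in> sites q" "c \<in> sites q" "t = convex hull {a, b, c}"
    using assms(1) by (auto simp: tri_def)
  have "t \<subseteq> cball q (R * h)" unfolding q(4) using sites_subset[OF h_pos, of q] q by (intro hull_minimal) auto
  then have "norm (q - x) \<le> R * h" "norm (q - y) \<le> R * h" using assms by (auto simp: dist_norm)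
  then show ?thesis using norm_triangle_ineq4[of "q - y" "q - x"] by simp
qed

lemma finite_triangles:
  assumes "bounded B"
  shows "finite {t \<in> T. t \<inter> B \<noteq> {}}"
proof -
  obtain b where b: "\<And>x. x \<in> B \<Longrightarrow> norm x \<le> b" using assms by (auto simp: bounded_iff)
  define F where "F = lattice h \<inter> cball 0 (b + 2 * R * h)"
  have "finite F" unfolding F_def by (rule finite_lattice_bounded[OF h_pos]) simp
  moreover have "{t \<in> T. t \<inter> B \<noteq> {}} \<subseteq> (\<lambda>s. convex hull s) ` Pow F"
  proof
    fix t assume "t \<in> {t \<in> T. t \<inter> B \<noteq> {}}"
    then obtain x where t: "t \<in> T" "x \<in> t" "x \<in> B" by blast
    obtain p q r where abc: "tri t p q r" using tri_ex[OF t(1)] by metis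
    have "{p, q, r} \<subseteq> F"
    proof
      fix y assume y: "y \<in> {p, q, r}"
      then have "y \<in> t" using abc hull_subset[of "{p, q, r}" convex] by (auto simp: tri_def)
      then have "norm (y - x) \<le> 2 * R * h" using tri_norm[OF abc] t(2) by blast
      then have "norm y \<le> b + 2 * R * h" using norm_triangle_ineq[of "y - x" x] b[OF t(3)] by simp
      then show "y \<in> F" using y tri_lattice[OF abc] by (auto simp: F_def)
    qed
    then show "t \<in> (\<lambda>s. convex hull s) ` Pow F" using abc by (auto simp: tri_def)
  qed
  ultimately show ?thesis by (meson finite_Pow_iff finite_imageI finite_subset)
qed

lemma Union_T: "\<exists>t\<in>T. x \<in> t"
proof -
  have "x \<in> \<Union>(Q_h h D)" using Union_Q by simp
  then obtain P where P: "P \<in> Q_h h D" "x \<in> P" by blast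
  then have "P = \<Union>{t\<in>T. t \<subseteq> P}" using ADT by (auto simp: ADT_def)
  then show ?thesis using P(2) by blast
qed

text \<open>Points tending to m from the positive side lie in triangles of a finite family. Closed
  triangles that miss m are eventually left, and triangles inside the nonpositive half-plane contain
  none of these points, so some other triangle contains m.\<close>

lemma triangle_on_side:
  assumes v: "v \<noteq> 0"
  obtains t where "t \<in> T" "m \<in> t" "\<not> t \<subseteq> {x. det2 v (x - m) \<le> 0}"
proof (rule ccontr)
  assume neg: "\<not> thesis"
  note found = that
  define x where "x = (\<lambda>k. m + inverse (real (Suc k)) *\<^sub>R perp v)"
  have side: "det2 v (x k - m) > 0" for k
  proof -
    have "det2 v (x k - m) = inverse (real (Suc k)) * (perp v \<bullet> perp v)"
      by (simp add: x_def det2_eq_perp)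
    moreover have "perp v \<bullet> perp v > 0" using v inner_gt_zero_iff[of v] by (simp add: inner_vec2)
    ultimately show ?thesis by simp
  qed
  have lim: "x \<longlonglongrightarrow> m"
  proof -
    have "(\<lambda>k. inverse (real (Suc k)) *\<^sub>R perp v) \<longlonglongrightarrow> 0 *\<^sub>R perp v"
      by (intro tendsto_scaleR LIMSEQ_inverse_real_of_nat tendsto_const)
    then have "(\<lambda>k. m + inverse (real (Suc k)) *\<^sub>R perp v) \<longlonglongrightarrow> m + 0 *\<^sub>R perp v"
      by (intro tendsto_add tendsto_const)
    then show ?thesis by (simp add: x_def)
  qed
  define F where "F = {t \<in> T. t \<inter> cball m (norm v) \<noteq> {}}"
  have finF: "finite F" unfolding F_def by (rule finite_triangles) simp
  have "eventually (\<lambda>k. x k \<notin> t) sequentially" if t: "t \<in> F" for t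
  proof (cases "m \<in> t")
    case True
    then have "t \<subseteq> {x. det2 v (x - m) \<le> 0}" using neg found[of t] t by (auto simp: F_def)
    then have "x k \<notin> t" for k using side[of k] by force
    then show ?thesis by simp
  next
    case False
    have "open (- t)" using t triangle_compact(1)[of t] by (auto simp: F_def dest: compact_imp_closed)
    then have "eventually (\<lambda>k. x k \<in> - t) sequentially" using False lim by (intro topological_tendstoD) auto
    then show ?thesis by simp
  qed
  then have "eventually (\<lambda>k. \<forall>t\<in>F. x k \<notin> t) sequentially" using finF by (intro eventually_ball_finite) auto
  then obtain k where k: "\<forall>t\<in>F. x k \<notin> t" by (auto simp: eventually_sequentially)
  obtain t where t: "t \<in> T" "x k \<in> t" using Union_T by blast
  have "x k \<in> cball m (norm v)"
  proof -
    have "dist m (x k) = inverse (real (Suc k)) * norm v" by (simp add: x_def dist_norm)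
    also have "\<dots> \<le> 1 * norm v" by (intro mult_right_mono) (auto simp: inverse_le_1_iff)
    finally show ?thesis by simp
  qed
  then have "t \<in> F" using t unfolding F_def by blast
  then show False using t(2) k by blast
qed

text \<open>All triangles at m contain the edge through m. Both orientations of
  \<open>triangle_on_side\<close> give one on each side; the determinant takes only the values h^2
  and -h^2, so each side has only one.\<close>

lemma two_triangles:
  assumes m: "m \<in> H"
  shows "card {t \<in> T. m \<in> t} = 2"
proof -
  obtain t where t: "t \<in> T" "m \<in> t" using Union_T by blast
  obtain a b c where abc: "tri t a b c" and m_eq: "m = (1/2) *\<^sub>R (a + b)" using tri_edge_of_half_point[OF t(1) m t(2)] .
  define v where "v = b - a"
  have v0: "v \<noteq> 0" using tri_distinct[OF abc] by (auto simp: v_def)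
  have on_line: "det2 v (x - m) = det2 v (x - a)" for x
    unfolding m_eq v_def by (simp add: det2_def field_simps)
  have ex: "\<exists>c'. tri t' a b c'" if "t' \<in> T" "m \<in> t'" for t'
    using shared_edge[OF t(1) abc that(1)] that(2) m_eq by metis
  have sub: "t' \<subseteq> {x. det2 (s *\<^sub>R v) (x - m) \<le> 0}" if "tri t' a b c'" "det2 (s *\<^sub>R v) (c' - a) \<le> 0" for t' c' s
  proof -
    have "t' = convex hull {a, b, c'}" using that by (simp add: tri_def)
    moreover have "{a, b, c'} \<subseteq> {x. det2 (s *\<^sub>R v) (x - m) \<le> 0}"
    proof -
      have "det2 v (a - a) = 0" "det2 v (b - a) = 0" by (simp_all add: det2_def v_def)
      then show ?thesis using that(2) by (simp add: det2_simps(5) on_line)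
    qed
    ultimately show ?thesis using convex_det2_halfspaces(2) by (simp add: hull_minimal)
  qed
  have one_side: "\<exists>t'\<in>T. m \<in> t' \<and> (\<exists>c'. tri t' a b c' \<and> det2 (s *\<^sub>R v) (c' - a) > 0)" if s: "s \<noteq> 0" for s
  proof -
    have "s *\<^sub>R v \<noteq> 0" using v0 s by simp
    then obtain t' where t': "t' \<in> T" "m \<in> t'" "\<not> t' \<subseteq> {x. det2 (s *\<^sub>R v) (x - m) \<le> 0}"
      using triangle_on_side by metis
    obtain c' where "tri t' a b c'" using ex[OF t'(1,2)] by blast
    then show ?thesis using sub t' by (meson not_le)
  qed
  obtain t1 c1 where t1: "t1 \<in> T" "m \<in> t1" "tri t1 a b c1" "det2 v (c1 - a) > 0"
    using one_side[of 1] by auto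
  obtain t2 c2 where t2: "t2 \<in> T" "m \<in> t2" "tri t2 a b c2" "det2 v (c2 - a) < 0"
    using one_side[of "-1"] by (auto simp: det2_simps)
  have d: "det2 v (c' - a) = h\<^sup>2 \<or> det2 v (c' - a) = - h\<^sup>2" if "tri t' a b c'" for t' c'
    using that by (auto simp: tri_def v_def abs_eq_iff)
  have h2: "h\<^sup>2 > 0" using h_pos by simp
  have d1: "det2 v (c1 - a) = h\<^sup>2" and d2: "det2 v (c2 - a) = - h\<^sup>2"
    using d[OF t1(3)] d[OF t2(3)] t1(4) t2(4) h2 by auto
  have "t1 \<noteq> t2"
  proof
    assume "t1 = t2"
    then have "{a, b, c1} = {a, b, c2}" using t1(3) t2(3) unfolding tri_def by metis
    then have "c1 = c2" using tri_distinct[OF t1(3)] tri_distinct[OF t2(3)] by auto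
    then show False using t1(4) t2(4) by simp
  qed
  moreover have "{t \<in> T. m \<in> t} = {t1, t2}"
  proof
    show "{t \<in> T. m \<in> t} \<subseteq> {t1, t2}"
    proof
      fix t' assume "t' \<in> {t \<in> T. m \<in> t}"
      then have t': "t' \<in> T" "m \<in> t'" by auto
      obtain c' where c': "tri t' a b c'" using ex[OF t'] by blast
      show "t' \<in> {t1, t2}"
        using d[OF c'] same_side_unique[OF t'(1) c' t1(1) t1(3)] same_side_unique[OF t'(1) c' t2(1) t2(3)] d1 d2
        by (auto simp: v_def)
    qed
  qed (use t1 t2 in auto)
  ultimately show ?thesis by simp
qed

end

section \<open>Comparison of the stencil weights with the finite element weights\<close>

text \<open>For symmetric A this is det(A) times the inverse, and it is A conjugated by the quarter
  turn. It absorbs the rotations in the stencil weights, which become halved Selling parameters of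
  cof(D).\<close>

definition cof :: "mat2 \<Rightarrow> mat2" where
  "cof A = vector [vector [A $ 2 $ 2, - A $ 2 $ 1], vector [- A $ 1 $ 2, A $ 1 $ 1]]"

lemma cof_form: "v \<bullet> (cof A *v w) = perp v \<bullet> (A *v perp w)"
  by (simp add: inner_vec2 mat2_mult_vec cof_def algebra_simps)

lemma sel_scaleR: "sel (r *\<^sub>R A) e i = r * sel A e i"
  by (simp add: sel_def scaleR_matrix_vector_assoc[symmetric])

lemma sel_gap:
  assumes lip: "\<And>v w. \<bar>v \<bullet> (A *v w) - v \<bullet> (B *v w)\<bar> \<le> \<eta> * norm v * norm w"
    and n: "\<And>i. i < 3 \<Longrightarrow> norm (e i) \<le> K" and eta: "0 \<le> \<eta>"
  shows "\<bar>sel A e i - sel B e i\<bar> \<le> \<eta> * K\<^sup>2"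
proof -
  let ?v = "e ((i + 1) mod 3)" and ?w = "e ((i + 2) mod 3)"
  have m: "(i + 1) mod 3 < 3" "(i + 2) mod 3 < 3" by simp_all
  have "\<bar>sel A e i - sel B e i\<bar> = \<bar>?v \<bullet> (A *v ?w) - ?v \<bullet> (B *v ?w)\<bar>" unfolding sel_def by linarith
  also have "\<dots> \<le> \<eta> * norm ?v * norm ?w" by (rule lip)
  also have "\<dots> \<le> \<eta> * K * K"
    using n[OF m(1)] n[OF m(2)] eta order_trans[OF norm_ge_zero n[OF m(1)]] by (intro mult_mono mult_nonneg_nonneg) auto
  finally show ?thesis by (simp add: power2_eq_square)
qed

lemma superbase_norm_sq:
  assumes A: "transpose A = A" and e: "superbase e"
  shows "e 0 \<bullet> (A *v e 0) = sel A e 1 + sel A e 2" "e 1 \<bullet> (A *v e 1) = sel A e 0 + sel A e 2"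
    "e 2 \<bullet> (A *v e 2) = sel A e 0 + sel A e 1"
proof -
  have z: "e 0 $ 1 = - e 1 $ 1 - e 2 $ 1" "e 0 $ 2 = - e 1 $ 2 - e 2 $ 2"
    unfolding superbase_sum[OF e] by simp_all
  show "e 0 \<bullet> (A *v e 0) = sel A e 1 + sel A e 2" "e 1 \<bullet> (A *v e 1) = sel A e 0 + sel A e 2"
    "e 2 \<bullet> (A *v e 2) = sel A e 0 + sel A e 1"
    unfolding sel_012 inner_vec2 mat2_mult_vec sym_mat2[OF A] z by (simp_all add: algebra_simps)
qed

text \<open>The sum of two parameters is the squared length of a superbase vector, and nonzero
  lattice vectors have Euclidean length at least 1.\<close>

lemma superbase_pair_lower:
  assumes A: "transpose A = A" and e: "superbase e"
    and lower: "\<And>v. lam * (norm v)\<^sup>2 \<le> v \<bullet> (A *v v)" and lam: "0 < lam"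
  shows "lam \<le> sel A e 1 + sel A e 2" "lam \<le> sel A e 0 + sel A e 2" "lam \<le> sel A e 0 + sel A e 1"
proof -
  have "lam \<le> e i \<bullet> (A *v e i)" if i: "i < 3" for i
  proof -
    have "1 \<le> norm (e i)" using lattice_norm_ge[OF superbase_lattice[OF e i] superbase_nonzero[OF e i]] by simp
    then have "lam * 1\<^sup>2 \<le> lam * (norm (e i))\<^sup>2" using lam by (intro mult_left_mono power_mono) auto
    then show ?thesis using lower[of "e i"] by simp
  qed
  from this[of 0] this[of 1] this[of 2]
  show "lam \<le> sel A e 1 + sel A e 2" "lam \<le> sel A e 0 + sel A e 2" "lam \<le> sel A e 0 + sel A e 1"
    unfolding superbase_norm_sq[OF A e] by simp_all
qed

text \<open>The Selling parameters satisfy \<open>s0 s1 + s1 s2 + s2 s0 = det A\<close>, so that none of them can be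
  large while all pairwise sums stay above \<open>lam\<close>.\<close>

lemma obtuse_superbase_norm_le:
  assumes A: "transpose A = A" and e: "superbase e" and s: "\<And>i. i < 3 \<Longrightarrow> 0 \<le> sel A e i"
    and lower: "\<And>v. lam * (norm v)\<^sup>2 \<le> v \<bullet> (A *v v)" and lam: "0 < lam"
    and upper: "\<And>v. v \<bullet> (A *v v) \<le> Lam * (norm v)\<^sup>2" and i: "i < 3"
  shows "norm (e i) \<le> 2 * (Lam / lam)"
proof -
  have z: "e 0 $ 1 = - e 1 $ 1 - e 2 $ 1" "e 0 $ 2 = - e 1 $ 2 - e 2 $ 2"
    unfolding superbase_sum[OF e] by simp_all
  have nn: "0 \<le> sel A e 0" "0 \<le> sel A e 1" "0 \<le> sel A e 2" using s by simp_all
  have diag: "A $ 1 $ 1 \<le> Lam" "A $ 2 $ 2 \<le> Lam" "0 \<le> A $ 1 $ 1" "0 \<le> A $ 2 $ 2"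
    using upper[of "vector [1, 0]"] upper[of "vector [0, 1]"] lower[of "vector [1, 0]"] lower[of "vector [0, 1]"] lam
    by (simp_all add: inner_vec2 mat2_mult_vec norm_vec2_sq)
  have "sel A e 0 * sel A e 1 + sel A e 1 * sel A e 2 + sel A e 2 * sel A e 0
      = (A $ 1 $ 1 * A $ 2 $ 2 - (A $ 1 $ 2)\<^sup>2) * (det2 (e 1) (e 2))\<^sup>2"
    unfolding sel_012 inner_vec2 mat2_mult_vec sym_mat2[OF A] z det2_def
    by (simp add: algebra_simps power2_eq_square)
  also have "\<dots> \<le> Lam * Lam"
    unfolding superbase_dets(6)[OF e] mult_1_right
    using mult_mono[OF diag(1,2)] diag zero_le_power2[of "A $ 1 $ 2"] by linarith
  finally have sum: "sel A e 0 * sel A e 1 + sel A e 1 * sel A e 2 + sel A e 2 * sel A e 0 \<le> Lam * Lam" .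
  have up: "x \<le> Lam * Lam / lam"
    if "x * y + y * z + z * x \<le> Lam * Lam" "0 \<le> y * z" "lam \<le> y + z" "0 \<le> x" for x y z :: real
  proof -
    have "x * (y + z) \<le> Lam * Lam" using that(1,2) by (simp add: algebra_simps)
    moreover have "x * lam \<le> x * (y + z)" using that by (intro mult_left_mono) auto
    ultimately show ?thesis using lam by (simp add: field_simps)
  qed
  note pl = superbase_pair_lower[OF A e lower lam]
  have b: "sel A e 0 \<le> Lam * Lam / lam" "sel A e 1 \<le> Lam * Lam / lam" "sel A e 2 \<le> Lam * Lam / lam"
  proof -
    show "sel A e 0 \<le> Lam * Lam / lam"
      by (rule up[OF sum mult_nonneg_nonneg[OF nn(2,3)] pl(1) nn(1)])
    show "sel A e 1 \<le> Lam * Lam / lam"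
      using sum pl(2) by (intro up[OF _ mult_nonneg_nonneg[OF nn(3,1)] _ nn(2)]) linarith+
    show "sel A e 2 \<le> Lam * Lam / lam"
      using sum pl(3) by (intro up[OF _ mult_nonneg_nonneg[OF nn(1,2)] _ nn(3)]) linarith+
  qed
  have "e i \<bullet> (A *v e i) \<le> 2 * (Lam * Lam / lam)"
    using less_3D[OF i] superbase_norm_sq[OF A e] b by auto
  then have "lam * (norm (e i))\<^sup>2 \<le> 2 * (Lam * Lam / lam)" using lower[of "e i"] by linarith
  then have "(norm (e i))\<^sup>2 \<le> 2 * (Lam / lam)\<^sup>2" using lam by (simp add: field_simps power2_eq_square)
  also have "2 * r\<^sup>2 \<le> (2 * r)\<^sup>2" for r :: real by (simp add: power_mult_distrib)
  finally show ?thesis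
    by (rule power2_le_imp_le) (use lam diag in auto)
qed

text \<open>Two weights below lam/2 would have sum below lam. The two strong vectors form a basis of
  Z^2, so every step can be composed of them.\<close>

lemma strong_pair:
  assumes "transpose A = A" "superbase e" "\<And>v. lam * (norm v)\<^sup>2 \<le> v \<bullet> (A *v v)" "0 < lam"
  obtains i j where "i < 3" "j < 3" "i \<noteq> j" "lam / 2 \<le> sel A e i" "lam / 2 \<le> sel A e j"
proof -
  note pl = superbase_pair_lower[OF assms]
  consider "lam / 2 \<le> sel A e 0 \<and> lam / 2 \<le> sel A e 1" | "lam / 2 \<le> sel A e 1 \<and> lam / 2 \<le> sel A e 2"
    | "lam / 2 \<le> sel A e 0 \<and> lam / 2 \<le> sel A e 2"
    using pl by linarith
  then show ?thesis
    by cases (use that[of 0 1] that[of 1 2] that[of 0 2] in auto)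
qed

lemma half_sum_in_hull: "(1/2) *\<^sub>R (a + b) \<in> convex hull {a, b :: vec2}"
proof -
  have "(1/2) *\<^sub>R (a + b) = (1 - 1/2) *\<^sub>R a + (1/2) *\<^sub>R b" by (simp add: scaleR_add_right)
  then show ?thesis unfolding segment_convex_hull[symmetric] in_segment by (intro exI[of _ "1/2"]) simp
qed

lemma not_half_lattice:
  assumes "e \<in> lattice 1" "e' \<in> lattice 1" "(det2 e e')\<^sup>2 = 1"
  shows "(1/2) *\<^sub>R e \<notin> lattice 1"
proof
  assume half: "(1/2) *\<^sub>R e \<in> lattice 1"
  have "det2 ((1/2) *\<^sub>R e) e' \<in> \<int>" using half assms(2) by (rule det2_Ints)
  then obtain k :: int where k: "det2 ((1/2) *\<^sub>R e) e' = of_int k" by (auto elim: Ints_cases)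
  have "det2 e e' = 2 * of_int k" using k by (simp add: det2_simps)
  then have "of_int ((2 * k)\<^sup>2) = (1::real)" using assms(3) by simp
  then have "(2 * k)\<^sup>2 = 1" by linarith
  then have "2 * k = 1 \<or> 2 * k = - 1" by (rule power2_eq_1_iff[THEN iffD1])
  then show False by presburger
qed

lemma superbase_det_sq: "superbase e \<Longrightarrow> i < 3 \<Longrightarrow> j < 3 \<Longrightarrow> i \<noteq> j \<Longrightarrow> (det2 (e i) (e j))\<^sup>2 = 1"
  using superbase_dets[of e] by (auto dest!: less_3D)

text \<open>The members of a superbase represent distinct classes modulo 2. Hence a half point can
  be the midpoint of a step along at most one of the three directions of a triangle.\<close>

lemma superbase_half_diff:
  assumes f: "superbase f" and ij: "i < 3" "j < 3" and half: "(1/2) *\<^sub>R (f i - f j) \<in> lattice 1"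
  shows "i = j"
proof (rule ccontr)
  assume ne: "i \<noteq> j"
  have "det2 (f i - f j) (f j) = det2 (f i) (f j)" by (simp add: det2_simps)
  then have "(det2 (f i - f j) (f j))\<^sup>2 = 1" using superbase_det_sq[OF f ij ne] by simp
  then show False
    using not_half_lattice[of "f i - f j" "f j"] superbase_lattice[OF f] ij half by (simp add: lattice_diff)
qed

text \<open>The factor s in \<open>G_M\<close> will be det(D z)^(1/2). The constants lamG, LG, sG
  are later fixed from D before h, the superbases, the triangulation and u are chosen.\<close>

locale lbr_grid = adt_grid +
  fixes sb :: "vec2 \<Rightarrow> nat \<Rightarrow> vec2" and u :: "vec2 \<Rightarrow> real" and n :: nat and lamG LG sG :: real
  assumes sb: "superbase (sb z)" "obtuse (Mfield D z) (sb z)"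
    and G_sym: "transpose (cof (D z)) = cof (D z)"
    and G_M: "\<exists>s. 0 < s \<and> s \<le> sG \<and> cof (D z) = s *\<^sub>R Mfield D z"
    and G_lower: "lamG * (norm v)\<^sup>2 \<le> v \<bullet> (cof (D z) *v v)" and lamG_pos: "0 < lamG"
    and G_lip: "\<bar>v \<bullet> (cof (D z) *v w) - v \<bullet> (cof (D z') *v w)\<bar> \<le> LG * norm (z - z') * norm v * norm w"
    and LG_pos: "0 < LG"
    and D_periodic: "k \<in> lattice 1 \<Longrightarrow> D (z + k) = D z"
    and u_periodic: "k \<in> lattice 1 \<Longrightarrow> u (z + k) = u z"
    and h_eq: "h = 1 / real n" and n_pos: "n \<ge> 1"
begin

abbreviation G where "G z \<equiv> cof (D z)"

abbreviation w where "w z \<equiv> gam (G z) (sb z)"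

text \<open>Twice the condition number Lam / lam. It bounds the length of all stencil vectors and is
  at least 2 R, the bound for rescaled triangle edges.\<close>

definition K where "K = 2 * R\<^sup>2"

text \<open>\<open>C1\<close> h bounds how far the edges of a triangle are from being obtuse for
  cof(D); the bracket is the constant of \<open>sites_almost_acute\<close> with \<rho> =
  \<open>K\<close>.\<close>

definition C1 where "C1 = sG * (15 * L * R ^ 3 + 4 * L * K * R\<^sup>2)"

lemma sG_pos: "0 < sG" using G_M by force

lemma K_ge: "2 * R \<le> K" "1 \<le> K"
proof -
  have "R * 1 \<le> R * R" using R_ge_1 by (intro mult_left_mono) auto
  then show "2 * R \<le> K" by (simp add: K_def power2_eq_square)
  then show "1 \<le> K" using R_ge_1 by linarith
qed

lemma K_eq: "K = 2 * (Lam / lam)" using R_sq lam_pos by (simp add: K_def field_simps)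

lemma C1_nonneg: "0 \<le> C1"
  unfolding C1_def using sG_pos L_pos R_pos K_ge by (intro mult_nonneg_nonneg add_nonneg_nonneg) auto

text \<open>Here h = 1/n enters: k = h (n k).\<close>

lemma lattice_1_subset: "k \<in> lattice 1 \<Longrightarrow> k \<in> lattice h"
proof -
  assume "k \<in> lattice 1"
  then have "of_int (int n) *\<^sub>R k \<in> lattice 1" by (rule lattice_of_int)
  then have "h *\<^sub>R (of_int (int n) *\<^sub>R k) \<in> lattice h" by (rule scaleR_lattice)
  then show ?thesis using h_eq n_pos by simp
qed

lemma sel_sb_nonneg: "i < 3 \<Longrightarrow> 0 \<le> sel (M z) (sb z) i" "i < 3 \<Longrightarrow> 0 \<le> sel (G z) (sb z) i"
proof -
  show M: "0 \<le> sel (M z) (sb z) i" if "i < 3" for i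
    using sb(2)[of z] less_3D[OF that] unfolding obtuse_def by (auto simp: sel_012)
  obtain s where "0 < s" "G z = s *\<^sub>R M z" using G_M by blast
  then show "i < 3 \<Longrightarrow> 0 \<le> sel (G z) (sb z) i" using M by (simp add: sel_scaleR)
qed

lemma sb_norm: "i < 3 \<Longrightarrow> norm (sb z i) \<le> K"
  unfolding K_eq
  by (rule obtuse_superbase_norm_le[OF M_sym sb(1) sel_sb_nonneg(1) M_lower lam_pos M_upper])

lemma w_near:
  assumes "superbase e" "\<And>i. i < 3 \<Longrightarrow> - \<epsilon> \<le> sel (G z) e i" "\<And>i. i < 3 \<Longrightarrow> norm (e i) \<le> K" "0 \<le> \<epsilon>"
  shows "\<bar>w z v - gam (G z) e v\<bar> \<le> 18 * K ^ 8 * \<epsilon>"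
  by (rule gam_near_superbase[OF G_sym sb(1) assms(1) sel_sb_nonneg(2) assms(2) sb_norm assms(3) K_ge(2) assms(4)])

lemma w_nonneg: "0 \<le> w z v"
  unfolding gam_def using sel_sb_nonneg(2) by (intro sum_nonneg) auto

lemma w_minus: "w z (- v) = w z v"
proof -
  have "(- v = x \<or> - v = - x) \<longleftrightarrow> (v = x \<or> v = - x)" for x by (metis minus_minus)
  then show ?thesis unfolding gam_def by simp
qed

lemma G_periodic: "k \<in> lattice 1 \<Longrightarrow> G (z + k) = G z"
  by (simp add: D_periodic)

text \<open>The choice \<open>sb\<close> is made independently at each point, so periodicity of the
  weights comes from their uniqueness, with \<epsilon> = 0.\<close>

lemma w_periodic: "k \<in> lattice 1 \<Longrightarrow> w (z + k) v = w z v"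
  using w_near[OF sb(1)[of "z + k"], of 0 z v] sel_sb_nonneg(2)[of _ "z + k"] sb_norm G_periodic[of k z]
  by simp

subsection \<open>Superbases of triangles\<close>

text \<open>The edges in cyclic order, each indexed by the opposite vertex (0 for a, 1 for b, 2 for
  c). Selling parameter i is then the rescaled scalar product of the two edges leaving vertex number
  i, which is bounded below by the almost acute angles.\<close>

definition tsb where "tsb a b c = (\<lambda>i::nat. (1 / h) *\<^sub>R (if i = 0 then c - b else if i = 1 then a - c else b - a))"

lemma tsb_012: "tsb a b c 0 = (1/h) *\<^sub>R (c - b)" "tsb a b c 1 = (1/h) *\<^sub>R (a - c)" "tsb a b c 2 = (1/h) *\<^sub>R (b - a)"
  by (simp_all add: tsb_def)

lemma lattice_unscale: "p \<in> lattice h \<Longrightarrow> (1/h) *\<^sub>R p \<in> lattice 1"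
proof -
  assume "p \<in> lattice h"
  then obtain k where "k \<in> lattice 1" "p = h *\<^sub>R k" by (rule lattice_scaleRE)
  then show ?thesis using h_pos by simp
qed

lemma tsb_superbase:
  assumes "tri t a b c"
  shows "superbase (tsb a b c)"
  unfolding superbase_def is_basis_def
proof (intro conjI)
  note lat = tri_lattice[OF assms]
  show "tsb a b c 0 \<in> lattice 1" "tsb a b c 1 \<in> lattice 1" "tsb a b c 2 \<in> lattice 1"
    unfolding tsb_012 using lat lattice_unscale[OF lattice_diff] by blast+
  show "tsb a b c 0 + tsb a b c 1 + tsb a b c 2 = 0"
    unfolding tsb_012 scaleR_add_right[symmetric] by simp
  have "det2 (tsb a b c 1) (tsb a b c 2) = (1/h) * ((1/h) * det2 (a - c) (b - a))"
    unfolding tsb_012 det2_simps(5,6) ..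
  also have "det2 (a - c) (b - a) = det2 (b - a) (c - a)" by (simp add: det2_def algebra_simps)
  finally show "\<bar>det2 (tsb a b c 1) (tsb a b c 2)\<bar> = 1"
    using assms h_pos by (simp add: tri_def abs_mult power2_eq_square)
qed

lemma tsb_norm:
  assumes "tri t a b c"
  shows "norm (tsb a b c i) \<le> 2 * R"
proof -
  have in_t: "a \<in> t" "b \<in> t" "c \<in> t" using assms hull_subset[of "{a, b, c}" convex] by (auto simp: tri_def)
  have "norm (x - y) / h \<le> 2 * R" if "x \<in> t" "y \<in> t" for x y
    using tri_norm[OF assms that] h_pos by (simp add: field_simps)
  then show ?thesis unfolding tsb_def using in_t h_pos by simp
qed

lemma tsb_norm_K: "tri t a b c \<Longrightarrow> norm (tsb a b c i) \<le> K"
  using tsb_norm[of t a b c i] K_ge(1) by linarith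

text \<open>The distance K/2 h allowed between z and the triangle is that from a midpoint to the
  start of a stencil step; adding R h \<le> K/2 h keeps z within K h of the point q having the
  vertices as sites.\<close>

lemma tsb_almost_obtuse:
  assumes t: "tri t a b c" and x: "x \<in> t" "norm (z - x) \<le> K / 2 * h" and i: "i < 3"
  shows "- (C1 * h) \<le> sel (G z) (tsb a b c) i"
proof -
  obtain q where q: "a \<in> sites q" "b \<in> sites q" "c \<in> sites q" using t by (auto simp: tri_def)
  have "convex hull {a, b, c} \<subseteq> cball q (R * h)"
    using sites_subset[OF h_pos, of q] q by (intro hull_minimal) auto
  then have "t \<subseteq> cball q (R * h)" using t by (simp add: tri_def)
  then have "norm (q - x) \<le> R * h" using x(1) by (auto simp: dist_norm)
  then have "norm (z - q) \<le> K / 2 * h + R * h"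
    using x(2) norm_triangle_ineq4[of "z - x" "q - x"] by simp
  also have "\<dots> \<le> K * h" using mult_right_mono[OF K_ge(1), of h] h_pos by linarith
  finally have zq: "norm (z - q) \<le> K * h" .
  define C where "C = 15 * L * R ^ 3 + 4 * L * K * R\<^sup>2"
  have C0: "0 \<le> C" unfolding C_def using L_pos R_pos K_ge by (intro add_nonneg_nonneg mult_nonneg_nonneg) auto
  have acute: "(y' - y) \<bullet> (M z *v (y'' - y)) \<ge> - (C * h ^ 3)" if "y \<in> sites q" "y' \<in> sites q" "y'' \<in> sites q" for y y' y''
    unfolding C_def using sites_almost_acute[OF that zq] K_ge by simp
  have scale: "- (C * h) \<le> (1/h) * ((1/h) * X)" if "- (C * h ^ 3) \<le> X" for X
  proof -
    have "(1/h)\<^sup>2 * (- (C * h ^ 3)) \<le> (1/h)\<^sup>2 * X" using that by (intro mult_left_mono) auto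
    then show ?thesis using h_pos by (simp add: power2_eq_square power3_eq_cube)
  qed
  have flip: "- ((x1 - x2) \<bullet> (M z *v (x3 - x1))) = (x2 - x1) \<bullet> (M z *v (x3 - x1))" for x1 x2 x3
    by (simp add: inner_diff_left)
  have M: "- (C * h) \<le> sel (M z) (tsb a b c) i"
    using less_3D[OF i]
  proof (elim disjE)
    assume i: "i = 0"
    show ?thesis
      using scale[OF acute[OF q(1) q(3) q(2), unfolded flip[of a c b, symmetric]]]
      unfolding i sel_012 tsb_012 by (simp add: matrix_vector_mult_scaleR)
  next
    assume i: "i = 1"
    show ?thesis
      using scale[OF acute[OF q(2) q(1) q(3), unfolded flip[of b a c, symmetric]]]
      unfolding i sel_012 tsb_012 by (simp add: matrix_vector_mult_scaleR)
  next
    assume i: "i = 2"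
    show ?thesis
      using scale[OF acute[OF q(3) q(2) q(1), unfolded flip[of c b a, symmetric]]]
      unfolding i sel_012 tsb_012 by (simp add: matrix_vector_mult_scaleR)
  qed
  obtain s where s: "0 < s" "s \<le> sG" "G z = s *\<^sub>R M z" using G_M by blast
  have "s * - (C * h) \<le> sel (G z) (tsb a b c) i"
    unfolding s(3) sel_scaleR using M s(1) by (intro mult_left_mono) auto
  moreover have "s * (C * h) \<le> sG * (C * h)" using s C0 h_pos by (intro mult_right_mono) auto
  moreover have "C1 * h = sG * (C * h)" by (simp add: C1_def C_def)
  ultimately show ?thesis by linarith
qed

lemma w_near_tsb:
  assumes "tri t a b c" "x \<in> t" "norm (z - x) \<le> K / 2 * h"
  shows "\<bar>w z v - gam (G z) (tsb a b c) v\<bar> \<le> 18 * K ^ 8 * (C1 * h)"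
  using assms tsb_almost_obtuse[OF assms] C1_nonneg h_pos tsb_norm_K[OF assms(1)]
  by (intro w_near tsb_superbase) auto

text \<open>\<open>ew z a b c\<close> is the finite element weight, at diffusion \<open>D z\<close>, of the edge \<open>a b\<close> in the
  triangle \<open>a b c\<close>.\<close>

definition ew where "ew z a b c = sel (G z) (tsb a b c) 2"

text \<open>\<open>eb m\<close> is determined only up to its sign: all triangles containing the half point \<open>m\<close>
  share the edge with midpoint \<open>m\<close>.\<close>

definition eb where
  "eb m = (SOME e. \<exists>t\<in>T. \<exists>a b c. tri t a b c \<and> m = (1/2) *\<^sub>R (a + b) \<and> e = (1/h) *\<^sub>R (b - a))"

lemma eb_edge:
  assumes m: "m \<in> H" and t: "t \<in> T" "m \<in> t"
  obtains a b c where "tri t a b c" "m = (1/2) *\<^sub>R (a + b)" "eb m = (1/h) *\<^sub>R (b - a)"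
proof -
  obtain a b c where abc: "tri t a b c" "m = (1/2) *\<^sub>R (a + b)" using tri_edge_of_half_point[OF t(1) m t(2)] .
  then have "\<exists>e. \<exists>t\<in>T. \<exists>a b c. tri t a b c \<and> m = (1/2) *\<^sub>R (a + b) \<and> e = (1/h) *\<^sub>R (b - a)" using t(1) by blast
  then have "\<exists>t\<in>T. \<exists>a b c. tri t a b c \<and> m = (1/2) *\<^sub>R (a + b) \<and> eb m = (1/h) *\<^sub>R (b - a)"
    unfolding eb_def by (rule someI_ex)
  then obtain t' a' b' c' where t': "t' \<in> T" "tri t' a' b' c'" "m = (1/2) *\<^sub>R (a' + b')" "eb m = (1/h) *\<^sub>R (b' - a')"
    by blast
  obtain c'' where "tri t a' b' c''" using shared_edge[OF t'(1,2) t(1)] t(2) t'(3) by metis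
  then show ?thesis using that t' by blast
qed

lemma eb_ends:
  assumes "m = (1/2) *\<^sub>R (a + b)" "eb m = (1/h) *\<^sub>R (b - a)"
  shows "m + (h/2) *\<^sub>R eb m = b" "m - (h/2) *\<^sub>R eb m = a"
  unfolding assms(2) unfolding assms(1) using h_pos by (simp_all add: vec_eq_iff field_simps)

lemma eb_of_edge:
  assumes t: "t \<in> T" "tri t a b c" and m: "m = (1/2) *\<^sub>R (a + b)"
  shows "eb m = (1/h) *\<^sub>R (b - a) \<or> eb m = - ((1/h) *\<^sub>R (b - a))"
proof -
  have mH: "m \<in> H" "m \<in> t" using tri_midpoint[OF t] m by auto
  obtain a' b' c' where t': "tri t a' b' c'" "m = (1/2) *\<^sub>R (a' + b')" "eb m = (1/h) *\<^sub>R (b' - a')"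
    using eb_edge[OF mH(1) t(1) mH(2)] .
  have "{a', b'} = {a, b}"
  proof -
    have V: "{a', b', c'} = {a, b, c}" using t(2) t'(1) unfolding tri_def by metis
    have "(1/2) *\<^sub>R (a + b) \<in> convex hull {a', b'}"
      using half_sum_in_hull[of a' b'] t'(2) m by simp
    then have "a \<in> {a', b'} \<and> b \<in> {a', b'}"
      using midpoint_in_subhull[OF tri_det[OF t(2)], of "{a', b'}"] V by auto
    then show ?thesis using tri_distinct[OF t(2)] tri_distinct[OF t'(1)] by auto
  qed
  then show ?thesis using t'(3) tri_distinct[OF t(2)] by (auto simp: doubleton_eq_iff algebra_simps)
qed

definition du where "du m = (u (m + (h/2) *\<^sub>R eb m) - u (m - (h/2) *\<^sub>R eb m))\<^sup>2"

lemma du_edge: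
  assumes t: "t \<in> T" "tri t a b c" and m: "m = (1/2) *\<^sub>R (a + b)"
  shows "du m = (u b - u a)\<^sup>2"
proof -
  have e: "(1/2) *\<^sub>R (a + b) + (1/2) *\<^sub>R (b - a) = b" "(1/2) *\<^sub>R (a + b) - (1/2) *\<^sub>R (b - a) = a"
    "(1/2) *\<^sub>R (a + b) + (1/2) *\<^sub>R (a - b) = a" "(1/2) *\<^sub>R (a + b) - (1/2) *\<^sub>R (a - b) = b"
    by (simp_all add: vec_eq_iff field_simps)
  from eb_of_edge[OF assms] show ?thesis
  proof
    assume eq: "eb m = (1/h) *\<^sub>R (b - a)"
    show ?thesis unfolding du_def eq unfolding m using h_pos e by simp
  next
    assume "eb m = - ((1/h) *\<^sub>R (b - a))"
    then have eq: "eb m = (1/h) *\<^sub>R (a - b)" by (simp add: algebra_simps)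
    show ?thesis unfolding du_def eq unfolding m using h_pos e by (simp add: power2_commute)
  qed
qed

text \<open>Coefficient of the edge with midpoint m in the sum to which both energies are compared.
  The weight is taken at m itself, which is not a lattice point; \<open>sb\<close> provides a
  superbase there too.\<close>

definition Gm where "Gm m = w m (eb m)"

text \<open>The first term is the change of cof(D) over distance K h, the second the passage from an
  obtuse superbase to the edges of a triangle.\<close>

definition C2 where "C2 = LG * K ^ 3 + 18 * K ^ 8 * C1"

lemma G_sel_gap:
  assumes "\<And>i. i < 3 \<Longrightarrow> norm (e i) \<le> K" "norm (z - z') \<le> K * h"
  shows "\<bar>sel (G z) e i - sel (G z') e i\<bar> \<le> LG * K ^ 3 * h"
proof -
  have "\<bar>sel (G z) e i - sel (G z') e i\<bar> \<le> (LG * norm (z - z')) * K\<^sup>2"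
    by (rule sel_gap[OF _ assms(1)]) (use G_lip LG_pos in auto)
  also have "\<dots> \<le> (LG * (K * h)) * K\<^sup>2"
    using assms(2) LG_pos by (intro mult_right_mono mult_left_mono) auto
  finally show ?thesis by (simp add: power3_eq_cube power2_eq_square mult_ac)
qed

lemma gam_tsb_edge:
  assumes "tri t a b c" "v = (1/h) *\<^sub>R (b - a) \<or> v = - ((1/h) *\<^sub>R (b - a))"
  shows "gam (G z) (tsb a b c) v = ew z a b c"
  unfolding ew_def using assms(2) tsb_012(3)[of a b c] by (intro gam_superbase[OF tsb_superbase[OF assms(1)]]) auto

lemma ew_near_Gm:
  assumes t: "t \<in> T" "tri t a b c" and m: "m = (1/2) *\<^sub>R (a + b)" and z: "norm (z - m) \<le> K * h"
  shows "\<bar>ew z a b c - Gm m\<bar> \<le> C2 * h"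
proof -
  have mt: "m \<in> t" using tri_midpoint[OF t] m by simp
  have "\<bar>ew z a b c - ew m a b c\<bar> \<le> LG * K ^ 3 * h"
    unfolding ew_def using tsb_norm_K[OF t(2)] z by (intro G_sel_gap) auto
  moreover have "\<bar>Gm m - ew m a b c\<bar> \<le> 18 * K ^ 8 * (C1 * h)"
    using w_near_tsb[OF t(2) mt, of m "eb m"] gam_tsb_edge[OF t(2) eb_of_edge[OF t m], of m] K_ge h_pos
    by (simp add: Gm_def)
  ultimately show ?thesis by (simp add: C2_def algebra_simps)
qed

lemma half_lattice_pm:
  assumes "m - (h/2) *\<^sub>R e \<in> lattice h" "e \<in> lattice 1"
  shows "m - (h/2) *\<^sub>R (- e) \<in> lattice h"
proof -
  have eq: "m - (h/2) *\<^sub>R (- e) = (m - (h/2) *\<^sub>R e) + h *\<^sub>R e" by (simp add: vec_eq_iff field_simps)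
  show ?thesis unfolding eq by (rule lattice_add[OF assms(1) scaleR_lattice[OF assms(2)]])
qed

text \<open>At z the edges of a triangle containing m reproduce the stencil weights up to O(h). If e
  is one of those edges up to sign, it differs from \<open>eb m\<close> by an element of 2 Z^2,
  because both half steps from m end in the lattice; then e is plus or minus \<open>eb m\<close>. In
  all other cases the reference weight is 0.\<close>

lemma w_at_half_step:
  assumes m: "m \<in> H" and e: "e \<in> lattice 1" "norm e \<le> K" "m - (h/2) *\<^sub>R e \<in> lattice h"
  shows "\<bar>w (m - (h/2) *\<^sub>R e) e - (if e = eb m \<or> e = - eb m then Gm m else 0)\<bar> \<le> 2 * C2 * h"
proof -
  obtain t where t: "t \<in> T" "m \<in> t" using Union_T by blast
  obtain a b c where abc: "tri t a b c" and m_eq: "m = (1/2) *\<^sub>R (a + b)" and ebm: "eb m = (1/h) *\<^sub>R (b - a)"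
    using eb_edge[OF m t] .
  define z where "z = m - (h/2) *\<^sub>R e"
  have zm: "norm (z - m) \<le> K / 2 * h" using e(2) h_pos by (simp add: z_def mult.commute)
  also have "\<dots> \<le> K * h" using K_ge h_pos by simp
  finally have zm': "norm (z - m) \<le> K * h" .
  have near: "\<bar>w z e - gam (G z) (tsb a b c) e\<bar> \<le> 18 * K ^ 8 * (C1 * h)"
    by (rule w_near_tsb[OF abc t(2) zm])
  have le: "18 * K ^ 8 * (C1 * h) \<le> C2 * h"
    using LG_pos K_ge h_pos by (simp add: C2_def algebra_simps)
  have C2h: "0 \<le> C2 * h" using le C1_nonneg K_ge h_pos by (intro order_trans[OF _ le]) simp
  show ?thesis
  proof (cases "e = eb m \<or> e = - eb m")
    case True
    then have "gam (G z) (tsb a b c) e = ew z a b c" using ebm by (intro gam_tsb_edge[OF abc]) auto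
    then show ?thesis using near le ew_near_Gm[OF t(1) abc m_eq zm'] True unfolding z_def by simp
  next
    case False
    have f: "superbase (tsb a b c)" by (rule tsb_superbase[OF abc])
    have "gam (G z) (tsb a b c) e = 0"
    proof (rule gam_outside, rule ccontr)
      fix j :: nat assume j: "j < 3" and "\<not> (e \<noteq> tsb a b c j \<and> e \<noteq> - tsb a b c j)"
      then have ej: "e = tsb a b c j \<or> e = - tsb a b c j" by blast
      have "m - (h/2) *\<^sub>R tsb a b c j \<in> lattice h"
        using ej e half_lattice_pm[OF e(3,1)] by auto
      moreover have "m - (h/2) *\<^sub>R tsb a b c 2 \<in> lattice h"
        using eb_ends(2)[OF m_eq ebm] tri_lattice[OF abc] ebm unfolding tsb_012 by simp
      ultimately have "(m - (h/2) *\<^sub>R tsb a b c j) - (m - (h/2) *\<^sub>R tsb a b c 2) \<in> lattice h" by (rule lattice_diff)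
      then have "(1/h) *\<^sub>R ((m - (h/2) *\<^sub>R tsb a b c j) - (m - (h/2) *\<^sub>R tsb a b c 2)) \<in> lattice 1"
        by (rule lattice_unscale)
      moreover have "(1/h) *\<^sub>R ((m - (h/2) *\<^sub>R tsb a b c j) - (m - (h/2) *\<^sub>R tsb a b c 2))
          = (1/2) *\<^sub>R (tsb a b c 2 - tsb a b c j)" using h_pos by (simp add: vec_eq_iff field_simps)
      ultimately have "2 = j" using superbase_half_diff[OF f _ j, of 2] by simp
      then show False using ej False ebm tsb_012(3)[of a b c] by simp
    qed
    then show ?thesis using near le C2h False unfolding z_def by simp
  qed
qed

subsection \<open>Periodicity\<close>

lemma H_shift: "k \<in> lattice 1 \<Longrightarrow> m + k \<in> H \<longleftrightarrow> m \<in> H"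
proof -
  have *: "m + k \<in> H" if k: "k \<in> lattice 1" and m: "m \<in> H" for m k
  proof -
    have kh: "k \<in> lattice h" by (rule lattice_1_subset[OF k])
    have "2 *\<^sub>R m \<in> lattice h" using m by (simp add: H_def half_lattice_double)
    then have "2 *\<^sub>R m + (k + k) \<in> lattice h" by (rule lattice_add[OF _ lattice_add[OF kh kh]])
    moreover have eq: "2 *\<^sub>R (m + k) = 2 *\<^sub>R m + (k + k)" by (simp add: vec_eq_iff)
    moreover have "m + k \<notin> lattice h"
    proof
      assume "m + k \<in> lattice h"
      then have "m + k - k \<in> lattice h" using kh by (rule lattice_diff)
      then show False using m by (simp add: H_def)
    qed
    ultimately show ?thesis unfolding H_def half_lattice_double Diff_iff eq by blast
  qed
  assume k: "k \<in> lattice 1"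
  show "m + k \<in> H \<longleftrightarrow> m \<in> H" using *[OF k] *[OF lattice_minus[OF k], of "m + k"] by auto
qed

lemma T_shift: "k \<in> lattice 1 \<Longrightarrow> t \<in> T \<Longrightarrow> (\<lambda>x. x + k) ` t \<in> T"
  using ADT by (auto simp: ADT_def)

text \<open>The choice in \<open>eb\<close> ignores periodicity. Translating an edge gives an edge
  of the translated triangle with the translated midpoint, and triangle and midpoint determine an
  edge up to orientation.\<close>

lemma eb_shift:
  assumes k: "k \<in> lattice 1" and m: "m \<in> H"
  shows "eb (m + k) = eb m \<or> eb (m + k) = - eb m"
proof -
  obtain t where t: "t \<in> T" "m \<in> t" using Union_T by blast
  obtain a b c where abc: "tri t a b c" "m = (1/2) *\<^sub>R (a + b)" "eb m = (1/h) *\<^sub>R (b - a)"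
    using eb_edge[OF m t] .
  let ?t = "(\<lambda>x. x + k) ` t"
  have tT: "?t \<in> T" by (rule T_shift[OF k t(1)])
  have im: "?t = convex hull {a + k, b + k, c + k}"
    using convex_hull_translation[of k "{a, b, c}"] abc(1) by (simp add: tri_def add.commute)
  obtain a' b' c' where t': "tri ?t a' b' c'" using tri_ex[OF tT] by metis
  have "det2 ((b + k) - (a + k)) ((c + k) - (a + k)) \<noteq> 0" using tri_det[OF abc(1)] by simp
  then have V: "{a', b', c'} = {a + k, b + k, c + k}"
    using vertices_triangle[of "b + k" "a + k" "c + k"] t' im unfolding tri_def by metis
  have mt: "m + k \<in> ?t" using t(2) by blast
  have mk: "m + k = (1/2) *\<^sub>R ((a + k) + (b + k))" unfolding abc(2) by (simp add: vec_eq_iff field_simps)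
  obtain a2 b2 c2 where t2: "tri ?t a2 b2 c2" "m + k = (1/2) *\<^sub>R (a2 + b2)" "eb (m + k) = (1/h) *\<^sub>R (b2 - a2)"
    using eb_edge[OF _ tT mt] H_shift[OF k] m by metis
  have V2: "{a2, b2, c2} = {a + k, b + k, c + k}" using V t' t2(1) unfolding tri_def by metis
  have "(1/2) *\<^sub>R (a2 + b2) \<in> convex hull {a + k, b + k}"
    using half_sum_in_hull[of "a + k" "b + k"] unfolding t2(2)[symmetric] mk .
  then have "a2 \<in> {a + k, b + k} \<and> b2 \<in> {a + k, b + k}"
    using midpoint_in_subhull[OF tri_det[OF t2(1)], of "{a + k, b + k}"] V2 by auto
  then consider "a2 = a + k" "b2 = b + k" | "a2 = b + k" "b2 = a + k" using tri_distinct[OF t2(1)] by auto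
  then show ?thesis
  proof cases
    case 1
    then have "b2 - a2 = b - a" by simp
    then show ?thesis using t2(3) abc(3) by simp
  next
    case 2
    then have "b2 - a2 = - (b - a)" by simp
    then show ?thesis using t2(3) abc(3) by (simp only: scaleR_minus_right) simp
  qed
qed

lemma Gm_shift: "k \<in> lattice 1 \<Longrightarrow> m \<in> H \<Longrightarrow> Gm (m + k) = Gm m"
  using eb_shift[of k m] w_periodic[of k m] w_minus by (auto simp: Gm_def)

lemma du_shift:
  assumes "k \<in> lattice 1" "m \<in> H"
  shows "du (m + k) = du m"
proof -
  have "u (m + k + x) = u (m + x)" for x using u_periodic[OF assms(1), of "m + x"] by (simp add: algebra_simps)
  from this[of "(h/2) *\<^sub>R eb m"] this[of "- ((h/2) *\<^sub>R eb m)"] show ?thesis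
    using eb_shift[OF assms] by (auto simp: du_def power2_commute)
qed

end

section \<open>Periodic sums\<close>

definition red :: "vec2 \<Rightarrow> vec2" where "red x = (\<chi> i. frac (x $ i))"

lemma red_Omega: "red x \<in> Omega"
  by (simp add: red_def Omega_def frac_lt_1)

lemma red_diff_lattice: "red x - x \<in> lattice 1" "x - red x \<in> lattice 1"
  by (simp_all add: red_def frac_def lattice_1_iff)

lemma Omega_unique:
  assumes "x \<in> Omega" "y \<in> Omega" "x - y \<in> lattice 1"
  shows "x = y"
proof -
  have "x $ i = y $ i" for i
  proof -
    obtain k :: int where k: "(x - y) $ i = of_int k" using assms(3) by (auto simp: lattice_def)
    have "\<bar>of_int k\<bar> < (1::real)" using assms(1,2) k[symmetric] by (auto simp: Omega_def abs_less_iff) (smt (verit, best))+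
    then have "k = 0" by linarith
    then show ?thesis using k by simp
  qed
  then show ?thesis by (simp add: vec_eq_iff)
qed

lemma bounded_Omega: "bounded Omega"
proof -
  have "Omega \<subseteq> cbox 0 1" by (auto simp: Omega_def mem_box_cart less_imp_le)
  then show ?thesis using bounded_cbox bounded_subset by blast
qed

text \<open>A sum over one period does not depend on the cell; the bijection is x to red (x + v).
  Since v is arbitrary, half a stencil step can move the sum from lattice points to
  midpoints.\<close>

lemma sum_Omega_shift:
  assumes X: "\<And>x k. x \<in> X \<Longrightarrow> k \<in> lattice 1 \<Longrightarrow> x + k \<in> X"
    and per: "\<And>x k. x \<in> X \<Longrightarrow> k \<in> lattice 1 \<Longrightarrow> \<phi> (x + k) = (\<phi> x :: real)"
  shows "(\<Sum>x\<in>Omega \<inter> X. \<phi> x) = (\<Sum>y\<in>{y \<in> Omega. y - v \<in> X}. \<phi> (y - v))"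
proof (rule sum.reindex_bij_witness[where j = "\<lambda>x. red (x + v)" and i = "\<lambda>y. red (y - v)"])
  have ret: "red (x + v) - v \<in> X" "\<phi> (red (x + v) - v) = \<phi> x" if "x \<in> X" for x
    using X[OF that red_diff_lattice(1)[of "x + v"]] per[OF that red_diff_lattice(1)[of "x + v"]] by simp_all
  fix x assume x: "x \<in> Omega \<inter> X"
  show "red (x + v) \<in> {y \<in> Omega. y - v \<in> X}" using ret(1) x by (simp add: red_Omega)
  show "red (red (x + v) - v) = x"
  proof (rule Omega_unique[OF red_Omega])
    have "red (red (x + v) - v) - x = (red (red (x + v) - v) - (red (x + v) - v)) + (red (x + v) - (x + v))" by simp
    then show "red (red (x + v) - v) - x \<in> lattice 1" using lattice_add red_diff_lattice(1) by metis
  qed (use x in simp)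
  show "\<phi> (red (x + v) - v) = \<phi> x" using ret x by simp
next
  have X': "red x \<in> X" if "x \<in> X" for x
    using X[OF that red_diff_lattice(1)[of x]] by simp
  fix y assume y: "y \<in> {y \<in> Omega. y - v \<in> X}"
  then show "red (y - v) \<in> Omega \<inter> X" using X' by (simp add: red_Omega)
  show "red (red (y - v) + v) = y"
  proof (rule Omega_unique[OF red_Omega])
    have "red (red (y - v) + v) - y = (red (red (y - v) + v) - (red (y - v) + v)) + (red (y - v) - (y - v))" by simp
    then show "red (red (y - v) + v) - y \<in> lattice 1" using lattice_add red_diff_lattice(1) by metis
  qed (use y in simp)
qed

lemma superbase_not_half:
  assumes "superbase e" "i < 3"
  shows "(1/2) *\<^sub>R e i \<notin> lattice 1" "(1/2) *\<^sub>R (- e i) \<notin> lattice 1"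
proof -
  have "(i + 1) mod 3 < 3" "(i + 1) mod 3 \<noteq> i" using less_3D[OF assms(2)] by auto
  then have "(det2 (e i) (e ((i + 1) mod 3)))\<^sup>2 = 1" using superbase_det_sq assms by metis
  then show *: "(1/2) *\<^sub>R e i \<notin> lattice 1"
    using not_half_lattice superbase_lattice assms \<open>(i + 1) mod 3 < 3\<close> by blast
  show "(1/2) *\<^sub>R (- e i) \<notin> lattice 1" using * lattice_minus[of "(1/2) *\<^sub>R (- e i)" 1] by auto
qed

lemma telescope_abs_le:
  fixes a :: "nat \<Rightarrow> real"
  assumes "\<And>j. j < N \<Longrightarrow> \<bar>a (Suc j) - a j\<bar> \<le> X"
  shows "\<bar>a N - a 0\<bar> \<le> real N * X"
  using assms
proof (induction N)
  case (Suc N)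
  have "\<bar>a N - a 0\<bar> \<le> real N * X" using Suc by simp
  moreover have "\<bar>a (Suc N) - a N\<bar> \<le> X" using Suc.prems by simp
  ultimately show ?case by (simp add: algebra_simps)
qed simp

context lbr_grid
begin

section \<open>Regrouping the stencil energy by midpoints\<close>

text \<open>One finite index set containing every stencil, so that the sums over z and e can be
  exchanged. Leaving out 2 Z^2 makes the midpoint of a step from a lattice point a half point in
  \<open>H\<close>.\<close>

definition NK where "NK = {e \<in> lattice 1. norm e \<le> K \<and> (1/2) *\<^sub>R e \<notin> lattice 1}"

definition HO where "HO = Omega \<inter> H"

definition NKm where "NKm m = {e \<in> NK. m - (h/2) *\<^sub>R e \<in> lattice h}"

text \<open>Unweighted local energy over all admissible steps; errors are measured in it until
  coercivity absorbs them.\<close>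

definition S where "S z = (\<Sum>e\<in>NK. (u (z + h *\<^sub>R e) - u z)\<^sup>2)"

definition g where "g z = (\<Sum>e\<in>NK. w z e * (u (z + h *\<^sub>R e) - u z)\<^sup>2)"

lemma finite_NK: "finite NK"
proof -
  have "finite (lattice 1 \<inter> cball 0 K)" by (rule finite_lattice_bounded) auto
  then show ?thesis by (rule rev_finite_subset) (auto simp: NK_def)
qed

lemma finite_HO: "finite HO"
proof -
  have "finite (lattice (h/2) \<inter> Omega)" using h_pos bounded_Omega by (intro finite_lattice_bounded) auto
  then show ?thesis by (rule rev_finite_subset) (auto simp: HO_def H_def)
qed

lemma lattice_h_shift: "x \<in> lattice h \<Longrightarrow> k \<in> lattice 1 \<Longrightarrow> x + k \<in> lattice h"
  using lattice_add lattice_1_subset by blast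

lemma stencil_NK: "stencil sb z \<subseteq> NK"
proof
  fix e assume "e \<in> stencil sb z"
  then obtain i where i: "i < 3" "e = sb z i \<or> e = - sb z i" by (auto simp: stencil_def)
  then show "e \<in> NK"
    using superbase_lattice[OF sb(1) i(1)] lattice_minus sb_norm[OF i(1)] superbase_not_half[OF sb(1) i(1)]
    by (auto simp: NK_def)
qed

lemma gamma_eq: "gamma D sb z e = w z e / 2"
proof -
  have "lbr_weight D sb z i = sel (G z) (sb z) i / 2" for i
    unfolding lbr_weight_def sel_def cof_form by simp
  then show ?thesis unfolding gamma_def gam_def sum_divide_distrib by (intro sum.cong) auto
qed

lemma energy_h_eq: "energy_h h D sb u = (\<Sum>z\<in>Omega_h h. g z) / 2"
proof -
  have pt: "(\<Sum>e\<in>stencil sb z. gamma D sb z e * (u (z + h *\<^sub>R e) - u z)\<^sup>2) = g z / 2" for z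
  proof -
    have "(\<Sum>e\<in>stencil sb z. gamma D sb z e * (u (z + h *\<^sub>R e) - u z)\<^sup>2)
        = (\<Sum>e\<in>NK. gamma D sb z e * (u (z + h *\<^sub>R e) - u z)\<^sup>2)"
    proof (rule sum.mono_neutral_left[OF finite_NK stencil_NK], rule ballI)
      fix e assume "e \<in> NK - stencil sb z"
      then have "w z e = 0" by (intro gam_outside) (auto simp: stencil_def)
      then show "gamma D sb z e * (u (z + h *\<^sub>R e) - u z)\<^sup>2 = 0" by (simp add: gamma_eq)
    qed
    then show ?thesis by (simp add: gamma_eq g_def sum_divide_distrib)
  qed
  show ?thesis unfolding energy_h_def pt sum_divide_distrib ..
qed

text \<open>For each fixed e, the sum over z is shifted by h e / 2; afterwards the sums over e and m
  are exchanged.\<close>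

lemma sum_by_midpoints:
  assumes per: "\<And>e z k. e \<in> NK \<Longrightarrow> k \<in> lattice 1 \<Longrightarrow> \<phi> e (z + k) = (\<phi> e z :: real)"
  shows "(\<Sum>z\<in>Omega_h h. \<Sum>e\<in>NK. \<phi> e z) = (\<Sum>m\<in>HO. \<Sum>e\<in>NKm m. \<phi> e (m - (h/2) *\<^sub>R e))"
proof -
  have "(\<Sum>z\<in>Omega_h h. \<phi> e z) = (\<Sum>m\<in>{m \<in> HO. m - (h/2) *\<^sub>R e \<in> lattice h}. \<phi> e (m - (h/2) *\<^sub>R e))" if e: "e \<in> NK" for e
  proof -
    have "m \<in> H" if m: "m - (h/2) *\<^sub>R e \<in> lattice h" for m
    proof -
      have "2 *\<^sub>R m = ((m - (h/2) *\<^sub>R e) + (m - (h/2) *\<^sub>R e)) + h *\<^sub>R e" by (simp add: vec_eq_iff field_simps)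
      then have "m \<in> lattice (h/2)"
        unfolding half_lattice_double using lattice_add[OF lattice_add[OF m m] scaleR_lattice, of e] e by (simp add: NK_def)
      moreover have "m \<notin> lattice h"
      proof
        assume "m \<in> lattice h"
        then have "m - (m - (h/2) *\<^sub>R e) \<in> lattice h" using m by (rule lattice_diff)
        then have "(h/2) *\<^sub>R e \<in> lattice h" by simp
        then have "(1/h) *\<^sub>R ((h/2) *\<^sub>R e) \<in> lattice 1" by (rule lattice_unscale)
        then have "(1/2) *\<^sub>R e \<in> lattice 1" using h_pos by simp
        then show False using e by (simp add: NK_def)
      qed
      ultimately show ?thesis by (simp add: H_def)
    qed
    then have eq: "{m \<in> HO. m - (h/2) *\<^sub>R e \<in> lattice h} = {m \<in> Omega. m - (h/2) *\<^sub>R e \<in> lattice h}"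
      by (auto simp: HO_def)
    show ?thesis unfolding eq Omega_h_def
      by (rule sum_Omega_shift) (use lattice_h_shift per[OF e] in auto)
  qed
  then have "(\<Sum>z\<in>Omega_h h. \<Sum>e\<in>NK. \<phi> e z)
      = (\<Sum>e\<in>NK. \<Sum>m\<in>{m \<in> HO. m - (h/2) *\<^sub>R e \<in> lattice h}. \<phi> e (m - (h/2) *\<^sub>R e))"
    by (subst sum.swap) simp
  also have "\<dots> = (\<Sum>m\<in>HO. \<Sum>e\<in>NKm m. \<phi> e (m - (h/2) *\<^sub>R e))"
    unfolding NKm_def by (rule sum.swap_restrict[OF finite_NK finite_HO])
  finally show ?thesis .
qed

definition dd where "dd e m = (u (m + (h/2) *\<^sub>R e) - u (m - (h/2) *\<^sub>R e))\<^sup>2"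

lemma step_shift:
  assumes "k \<in> lattice 1"
  shows "(u (z + k + h *\<^sub>R e) - u (z + k))\<^sup>2 = (u (z + h *\<^sub>R e) - u z)\<^sup>2"
  using u_periodic[OF assms, of "z + h *\<^sub>R e"] u_periodic[OF assms, of z] by (simp add: algebra_simps)

lemma g_shift: "k \<in> lattice 1 \<Longrightarrow> g (z + k) = g z"
  unfolding g_def by (simp add: step_shift w_periodic)

lemma half_step:
  fixes m e :: vec2
  shows "(m - (h/2) *\<^sub>R e) + h *\<^sub>R e = m + (h/2) *\<^sub>R e"
  by (simp add: vec_eq_iff field_simps)

lemma sum_S: "(\<Sum>z\<in>Omega_h h. S z) = (\<Sum>m\<in>HO. \<Sum>e\<in>NKm m. dd e m)"
  unfolding S_def dd_def half_step[symmetric]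
  by (rule sum_by_midpoints) (rule step_shift)

lemma sum_g: "(\<Sum>z\<in>Omega_h h. g z) = (\<Sum>m\<in>HO. \<Sum>e\<in>NKm m. w (m - (h/2) *\<^sub>R e) e * dd e m)"
  unfolding g_def dd_def half_step[symmetric]
  by (rule sum_by_midpoints) (simp add: step_shift w_periodic)

lemma eb_NKm:
  assumes m: "m \<in> H"
  shows "eb m \<in> NKm m" "- eb m \<in> NKm m" "eb m \<noteq> - eb m"
proof -
  obtain t where t: "t \<in> T" "m \<in> t" using Union_T by blast
  obtain a b c where abc: "tri t a b c" "m = (1/2) *\<^sub>R (a + b)" "eb m = (1/h) *\<^sub>R (b - a)"
    using eb_edge[OF m t] .
  have f: "superbase (tsb a b c)" by (rule tsb_superbase[OF abc(1)])
  have e: "eb m = tsb a b c 2" using abc(3) by (simp add: tsb_012)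
  have l: "eb m \<in> lattice 1" unfolding e by (rule superbase_lattice[OF f]) simp
  have mm: "m - (h/2) *\<^sub>R eb m \<in> lattice h" using eb_ends(2)[OF abc(2,3)] tri_lattice[OF abc(1)] by simp
  have nh: "(1/2) *\<^sub>R eb m \<notin> lattice 1" "(1/2) *\<^sub>R (- eb m) \<notin> lattice 1"
    unfolding e by (rule superbase_not_half[OF f]; simp)+
  show "eb m \<in> NKm m" using l nh mm tsb_norm_K[OF abc(1), of 2] by (simp add: NKm_def NK_def e)
  show "- eb m \<in> NKm m"
    using lattice_minus[OF l] nh half_lattice_pm[OF mm l] tsb_norm_K[OF abc(1), of 2] by (simp add: NKm_def NK_def e)
  have "eb m \<noteq> 0" unfolding e by (rule superbase_nonzero[OF f]) simp
  then show "eb m \<noteq> - eb m" by (simp add: vec_eq_iff forall_2 vec2_eq_0_iff)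
qed

lemma finite_NKm: "finite (NKm m)" using finite_NK by (simp add: NKm_def)

lemma dd_eb: "dd (eb m) m = du m" "dd (- eb m) m = du m"
  by (simp_all add: dd_def du_def power2_commute)

lemma sum_du_le: "(\<Sum>m\<in>HO. du m) \<le> (\<Sum>z\<in>Omega_h h. S z)"
  unfolding sum_S
proof (rule sum_mono)
  fix m assume "m \<in> HO"
  then have "eb m \<in> NKm m" using eb_NKm(1) by (simp add: HO_def)
  then have "dd (eb m) m \<le> (\<Sum>e\<in>NKm m. dd e m)"
    using finite_NKm by (intro member_le_sum) (auto simp: dd_def)
  then show "du m \<le> (\<Sum>e\<in>NKm m. dd e m)" by (simp add: dd_eb)
qed

text \<open>At a half point only the steps \<open>eb m\<close> and \<open>- eb m\<close> have a
  reference coefficient. They count the edge twice, which cancels the 1/2 of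
  \<open>energy_h_eq\<close>; the rest is an error of order h in every step.\<close>

lemma energy_h_near: "\<bar>energy_h h D sb u - (\<Sum>m\<in>HO. Gm m * du m)\<bar> \<le> C2 * h * (\<Sum>z\<in>Omega_h h. S z)"
proof -
  have pt: "\<bar>(\<Sum>e\<in>NKm m. w (m - (h/2) *\<^sub>R e) e * dd e m) / 2 - Gm m * du m\<bar> \<le> C2 * h * (\<Sum>e\<in>NKm m. dd e m)"
    if "m \<in> HO" for m
  proof -
    have m: "m \<in> H" using that by (simp add: HO_def)
    define c where "c = (\<lambda>e. if e = eb m \<or> e = - eb m then Gm m else 0)"
    have "(\<Sum>e\<in>NKm m. c e * dd e m) = (\<Sum>e\<in>{eb m, - eb m}. c e * dd e m)"
      using eb_NKm[OF m] by (intro sum.mono_neutral_right finite_NKm) (auto simp: c_def)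
    also have "\<dots> = 2 * (Gm m * du m)" using eb_NKm(3)[OF m] by (simp add: c_def dd_eb)
    finally have two: "(\<Sum>e\<in>NKm m. c e * dd e m) = 2 * (Gm m * du m)" .
    have "\<bar>(\<Sum>e\<in>NKm m. w (m - (h/2) *\<^sub>R e) e * dd e m) - (\<Sum>e\<in>NKm m. c e * dd e m)\<bar>
        \<le> (\<Sum>e\<in>NKm m. \<bar>(w (m - (h/2) *\<^sub>R e) e - c e) * dd e m\<bar>)"
      unfolding sum_subtractf[symmetric] left_diff_distrib[symmetric] by (rule sum_abs)
    also have "\<dots> \<le> (\<Sum>e\<in>NKm m. (2 * C2 * h) * dd e m)"
    proof (rule sum_mono)
      fix e assume "e \<in> NKm m"
      then have "\<bar>w (m - (h/2) *\<^sub>R e) e - c e\<bar> \<le> 2 * C2 * h"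
        unfolding c_def by (intro w_at_half_step[OF m]) (auto simp: NKm_def NK_def)
      then show "\<bar>(w (m - (h/2) *\<^sub>R e) e - c e) * dd e m\<bar> \<le> (2 * C2 * h) * dd e m"
        using mult_right_mono[of _ "2 * C2 * h" "dd e m"] by (simp add: abs_mult dd_def)
    qed
    finally have "\<bar>(\<Sum>e\<in>NKm m. w (m - (h/2) *\<^sub>R e) e * dd e m) - 2 * (Gm m * du m)\<bar> \<le> 2 * (C2 * h * (\<Sum>e\<in>NKm m. dd e m))"
      unfolding two by (simp add: sum_distrib_left mult.assoc)
    then show ?thesis by (simp add: abs_le_iff)
  qed
  have eq: "energy_h h D sb u - (\<Sum>m\<in>HO. Gm m * du m)
      = (\<Sum>m\<in>HO. (\<Sum>e\<in>NKm m. w (m - (h/2) *\<^sub>R e) e * dd e m) / 2 - Gm m * du m)"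
    unfolding energy_h_eq sum_g by (simp add: sum_subtractf sum_divide_distrib)
  show ?thesis unfolding eq sum_S sum_distrib_left[of _ _ HO]
    by (rule order_trans[OF sum_abs sum_mono[OF pt]])
qed

subsection \<open>Coercivity of the stencil energy\<close>

text \<open>\<open>C5\<close> h bounds the change of a Selling parameter of \<open>sb z\<close> over
  distance 2 K^3 h.\<close>

definition C5 where "C5 = LG * (2 * K ^ 3) * K\<^sup>2"

text \<open>Window for the paths used below: two legs of at most K^2 steps, each of length at most
  K.\<close>

definition WS where "WS = {k \<in> lattice 1. norm k \<le> 2 * K ^ 3}"

text \<open>At one point each vector of \<open>NK\<close> costs 16 K^4 / lamG; summation over z
  repeats g once per element of \<open>WS\<close>; the remaining factor 2 undoes the half in
  \<open>energy_h_eq\<close>.\<close>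

definition C4 where "C4 = 32 * K ^ 4 / lamG * real (card NK) * real (card WS)"

lemma finite_WS: "finite WS"
proof -
  have "finite (lattice 1 \<inter> cball 0 (2 * K ^ 3))" by (rule finite_lattice_bounded) auto
  then show ?thesis by (rule rev_finite_subset) (auto simp: WS_def)
qed

lemma g_nonneg: "0 \<le> g z"
  unfolding g_def by (intro sum_nonneg mult_nonneg_nonneg w_nonneg) simp

lemma C5_nonneg: "0 \<le> C5" unfolding C5_def using LG_pos K_ge by simp

text \<open>The stencil at y may use another superbase, but \<open>sb z\<close> is obtuse for the
  matrix at y up to \<open>C5\<close> h, so the weight of v survives. 19 = 18 + 1: uniqueness of
  weights plus the change of the parameter itself.\<close>

lemma strong_weight:
  assumes small: "19 * K ^ 8 * C5 * h \<le> lamG / 4"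
    and i: "i < 3" "lamG / 2 \<le> sel (G z) (sb z) i" and y: "norm (y - z) \<le> 2 * K ^ 3 * h"
    and v: "v = sb z i \<or> v = - sb z i"
  shows "lamG / 4 \<le> w y v"
proof -
  have gap: "\<bar>sel (G y) (sb z) j - sel (G z) (sb z) j\<bar> \<le> C5 * h" for j
  proof -
    have "\<bar>sel (G y) (sb z) j - sel (G z) (sb z) j\<bar> \<le> (LG * norm (y - z)) * K\<^sup>2"
      by (rule sel_gap[OF _ sb_norm]) (use G_lip LG_pos in auto)
    also have "\<dots> \<le> (LG * (2 * K ^ 3 * h)) * K\<^sup>2"
      using y LG_pos by (intro mult_right_mono mult_left_mono) auto
    finally show ?thesis by (simp add: C5_def mult_ac)
  qed
  have C5h: "0 \<le> C5 * h" using C5_nonneg h_pos by simp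
  have low: "- (C5 * h) \<le> sel (G y) (sb z) j" if "j < 3" for j
    using gap[of j] sel_sb_nonneg(2)[OF that, of z] by linarith
  have "\<bar>w y v - gam (G y) (sb z) v\<bar> \<le> 18 * K ^ 8 * (C5 * h)"
    by (rule w_near[OF sb(1) low sb_norm C5h])
  moreover have "gam (G y) (sb z) v = sel (G y) (sb z) i" by (rule gam_superbase[OF sb(1) i(1) v])
  moreover have "C5 * h \<le> K ^ 8 * (C5 * h)"
    using mult_right_mono[OF one_le_power[OF K_ge(2), of 8] C5h] by simp
  ultimately show ?thesis using small gap[of i] i(2) by (simp add: mult.assoc)
qed

text \<open>A walk along a strong direction: each squared increment is at most 4 / lamG times the
  local energy at its start, and all starts stay in the window.\<close>

lemma steps_bound:
  assumes small: "19 * K ^ 8 * C5 * h \<le> lamG / 4"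
    and i: "i < 3" "lamG / 2 \<le> sel (G z) (sb z) i" and v: "v = sb z i \<or> v = - sb z i"
    and k: "k \<in> lattice 1" and far: "norm k + real N * K \<le> 2 * K ^ 3"
  shows "\<bar>u (z + h *\<^sub>R (k + real N *\<^sub>R v)) - u (z + h *\<^sub>R k)\<bar>
    \<le> real N * sqrt (4 / lamG * (\<Sum>k\<in>WS. g (z + h *\<^sub>R k)))"
proof -
  define X where "X = sqrt (4 / lamG * (\<Sum>k\<in>WS. g (z + h *\<^sub>R k)))"
  have vl: "v \<in> lattice 1" using v superbase_lattice[OF sb(1) i(1)] lattice_minus by auto
  have vn: "norm v \<le> K" using v sb_norm[OF i(1), of z] by auto
  have vNK: "v \<in> NK" using stencil_NK[of z] v i(1) by (auto simp: stencil_def)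
  have "\<bar>u (z + h *\<^sub>R (k + real (Suc j) *\<^sub>R v)) - u (z + h *\<^sub>R (k + real j *\<^sub>R v))\<bar> \<le> X" if j: "j < N" for j
  proof -
    define k' where "k' = k + real j *\<^sub>R v"
    have k'l: "k' \<in> lattice 1"
      unfolding k'_def using lattice_of_int[OF vl, of "int j"] k by (intro lattice_add) auto
    have "norm k' \<le> norm k + real j * norm v" unfolding k'_def using norm_triangle_ineq[of k "real j *\<^sub>R v"] by simp
    also have "\<dots> \<le> norm k + real N * K" using j vn by (intro add_left_mono mult_mono) auto
    finally have k'n: "norm k' \<le> 2 * K ^ 3" using far by linarith
    define y where "y = z + h *\<^sub>R k'"
    have "norm (y - z) \<le> 2 * K ^ 3 * h" using k'n h_pos by (simp add: y_def mult.commute)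
    then have wy: "lamG / 4 \<le> w y v" by (rule strong_weight[OF small i _ v])
    have "lamG / 4 * (u (y + h *\<^sub>R v) - u y)\<^sup>2 \<le> w y v * (u (y + h *\<^sub>R v) - u y)\<^sup>2"
      using wy by (intro mult_right_mono) auto
    also have "\<dots> \<le> g y"
      unfolding g_def using vNK finite_NK w_nonneg by (intro member_le_sum[of v]) auto
    also have "\<dots> \<le> (\<Sum>k\<in>WS. g (z + h *\<^sub>R k))"
      unfolding y_def using k'l k'n finite_WS g_nonneg
      by (intro member_le_sum[of k' WS "\<lambda>k. g (z + h *\<^sub>R k)"]) (auto simp: WS_def)
    finally have "(u (y + h *\<^sub>R v) - u y)\<^sup>2 \<le> 4 / lamG * (\<Sum>k\<in>WS. g (z + h *\<^sub>R k))"
      using lamG_pos by (simp add: field_simps)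
    then have "\<bar>u (y + h *\<^sub>R v) - u y\<bar> \<le> X" unfolding X_def by (simp add: real_le_rsqrt)
    moreover have e1: "y + h *\<^sub>R v = z + h *\<^sub>R (k + real (Suc j) *\<^sub>R v)"
      by (simp add: y_def k'_def algebra_simps)
    ultimately show ?thesis unfolding e1[symmetric] unfolding y_def k'_def by simp
  qed
  then have "\<bar>u (z + h *\<^sub>R (k + real N *\<^sub>R v)) - u (z + h *\<^sub>R (k + real 0 *\<^sub>R v))\<bar> \<le> real N * X"
    by (rule telescope_abs_le[where a = "\<lambda>j. u (z + h *\<^sub>R (k + real j *\<^sub>R v))"])
  then show ?thesis by (simp add: X_def)
qed

text \<open>Any e is reached by at most K^2 steps along one strong vector and then at most K^2 along
  the other. Squaring 2 K^2 sqrt (4 Q / lamG) gives 16 K^4 / lamG.\<close>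

lemma S_le:
  assumes small: "19 * K ^ 8 * C5 * h \<le> lamG / 4"
  shows "S z \<le> 16 * K ^ 4 / lamG * real (card NK) * (\<Sum>k\<in>WS. g (z + h *\<^sub>R k))"
proof -
  define Q where "Q = (\<Sum>k\<in>WS. g (z + h *\<^sub>R k))"
  have Q0: "0 \<le> 4 / lamG * Q" unfolding Q_def using g_nonneg lamG_pos by (intro mult_nonneg_nonneg sum_nonneg) auto
  obtain i j where ij: "i < 3" "j < 3" "i \<noteq> j" "lamG / 2 \<le> sel (G z) (sb z) i" "lamG / 2 \<le> sel (G z) (sb z) j"
    using strong_pair[OF G_sym sb(1) G_lower lamG_pos] by metis
  define a where "a = sb z i"
  define b where "b = sb z j"
  have ab: "a \<in> lattice 1" "b \<in> lattice 1" "norm a \<le> K" "norm b \<le> K" "(det2 a b)\<^sup>2 = 1"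
    using superbase_lattice[OF sb(1)] sb_norm superbase_det_sq[OF sb(1)] ij by (auto simp: a_def b_def)
  have "(u (z + h *\<^sub>R e) - u z)\<^sup>2 \<le> 16 * K ^ 4 / lamG * Q" if e: "e \<in> NK" for e
  proof -
    have el: "e \<in> lattice 1" "norm e \<le> K" using e by (auto simp: NK_def)
    obtain d where d: "det2 a b = of_int d" using det2_Ints[OF ab(1,2)] by (auto elim: Ints_cases)
    obtain p where p: "det2 e b = of_int p" using det2_Ints[OF el(1) ab(2)] by (auto elim: Ints_cases)
    obtain q where q: "det2 a e = of_int q" using det2_Ints[OF ab(1) el(1)] by (auto elim: Ints_cases)
    have "of_int (d\<^sup>2) = (1::real)" using ab(5) d by simp
    then have "d\<^sup>2 = 1" by linarith
    then have d1: "\<bar>d\<bar> = 1" by (simp add: abs_square_eq_1)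
    define N where "N = nat \<bar>d * p\<bar>"
    define N' where "N' = nat \<bar>d * q\<bar>"
    \<comment> \<open>Negative coordinates are realised by walking in the opposite direction, which
      carries the same weight.\<close>
    define a' where "a' = (if d * p \<ge> 0 then a else - a)"
    define b' where "b' = (if d * q \<ge> 0 then b else - b)"
    have "(det2 a b)\<^sup>2 *\<^sub>R e = (det2 a b * det2 e b) *\<^sub>R a + (det2 a b * det2 a e) *\<^sub>R b"
      by (simp add: vec_eq_iff forall_2 det2_def) algebra
    then have "e = of_int (d * p) *\<^sub>R a + of_int (d * q) *\<^sub>R b" using ab(5) d p q by simp
    moreover have "of_int x *\<^sub>R y = real (nat \<bar>x\<bar>) *\<^sub>R (if x \<ge> 0 then y else - y)" for x :: int and y :: vec2
      by (cases "x \<ge> 0") simp_all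
    then have "of_int (d * p) *\<^sub>R a = real N *\<^sub>R a'" "of_int (d * q) *\<^sub>R b = real N' *\<^sub>R b'"
      unfolding N_def N'_def a'_def b'_def by blast+
    ultimately have e_eq: "e = real N *\<^sub>R a' + real N' *\<^sub>R b'" by simp
    have NK2: "real N \<le> K\<^sup>2" "real N' \<le> K\<^sup>2"
    proof -
      have "real N = \<bar>det2 e b\<bar>" using d1 p by (simp add: N_def abs_mult)
      also have "\<dots> \<le> norm e * norm b" by (rule abs_det2_le)
      also have "\<dots> \<le> K * K" using el ab K_ge by (intro mult_mono) auto
      finally show "real N \<le> K\<^sup>2" by (simp add: power2_eq_square)
      have "real N' = \<bar>det2 a e\<bar>" using d1 q by (simp add: N'_def abs_mult)
      also have "\<dots> \<le> norm a * norm e" by (rule abs_det2_le)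
      also have "\<dots> \<le> K * K" using el ab K_ge by (intro mult_mono) auto
      finally show "real N' \<le> K\<^sup>2" by (simp add: power2_eq_square)
    qed
    have NK3: "real N * K \<le> K ^ 3" "real N' * K \<le> K ^ 3"
      using NK2[THEN mult_right_mono, of K] K_ge by (simp_all add: power2_eq_square power3_eq_cube)
    have K3: "0 \<le> K ^ 3" using K_ge by simp
    have far1: "norm (0::vec2) + real N * K \<le> 2 * K ^ 3" unfolding norm_zero using NK3(1) K3 by linarith
    have a'v: "a' = sb z i \<or> a' = - sb z i" and b'v: "b' = sb z j \<or> b' = - sb z j"
      by (auto simp: a'_def a_def b'_def b_def)
    have a'l: "real N *\<^sub>R a' \<in> lattice 1"
      using lattice_of_int[of a' "int N"] ab lattice_minus by (auto simp: a'_def)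
    have na: "norm (real N *\<^sub>R a') \<le> K ^ 3"
    proof -
      have "norm (real N *\<^sub>R a') = real N * norm a" by (simp add: a'_def)
      also have "\<dots> \<le> real N * K" using ab by (intro mult_left_mono) auto
      finally show ?thesis using NK3 by linarith
    qed
    have 1: "\<bar>u (z + h *\<^sub>R (0 + real N *\<^sub>R a')) - u (z + h *\<^sub>R 0)\<bar> \<le> real N * sqrt (4 / lamG * Q)"
      unfolding Q_def by (rule steps_bound[OF small ij(1,4) a'v lattice_0 far1])
    have 2: "\<bar>u (z + h *\<^sub>R (real N *\<^sub>R a' + real N' *\<^sub>R b')) - u (z + h *\<^sub>R (real N *\<^sub>R a'))\<bar> \<le> real N' * sqrt (4 / lamG * Q)"
      unfolding Q_def by (rule steps_bound[OF small ij(2,5) b'v a'l]) (use NK3 na in linarith)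
    have "\<bar>u (z + h *\<^sub>R e) - u z\<bar> \<le> real N * sqrt (4 / lamG * Q) + real N' * sqrt (4 / lamG * Q)"
      using 1 2 unfolding e_eq by simp
    also have "\<dots> \<le> K\<^sup>2 * sqrt (4 / lamG * Q) + K\<^sup>2 * sqrt (4 / lamG * Q)"
      using NK2 Q0 by (intro add_mono mult_right_mono) auto
    finally have "\<bar>u (z + h *\<^sub>R e) - u z\<bar> \<le> (2 * K\<^sup>2) * sqrt (4 / lamG * Q)" by simp
    then have "\<bar>u (z + h *\<^sub>R e) - u z\<bar>\<^sup>2 \<le> ((2 * K\<^sup>2) * sqrt (4 / lamG * Q))\<^sup>2"
      by (intro power_mono) auto
    also have "\<dots> = 16 * K ^ 4 / lamG * Q"
    proof -
      have "(sqrt (4 / lamG * Q))\<^sup>2 = 4 / lamG * Q" using Q0 by (rule real_sqrt_pow2)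
      then show ?thesis unfolding power_mult_distrib by (simp flip: power_mult)
    qed
    finally show ?thesis by simp
  qed
  then have "S z \<le> (\<Sum>e\<in>NK. 16 * K ^ 4 / lamG * Q)" unfolding S_def by (rule sum_mono)
  then show ?thesis by (simp add: Q_def mult_ac)
qed

text \<open>Summed over a period, the local energies at z + h k do not depend on k, so the window
  only contributes its cardinality.\<close>

lemma coercive:
  assumes small: "19 * K ^ 8 * C5 * h \<le> lamG / 4"
  shows "(\<Sum>z\<in>Omega_h h. S z) \<le> C4 * energy_h h D sb u"
proof -
  have shift: "(\<Sum>z\<in>Omega_h h. g (z + h *\<^sub>R k)) = (\<Sum>z\<in>Omega_h h. g z)" if k: "k \<in> WS" for k
  proof -
    have kh: "h *\<^sub>R k \<in> lattice h" using k by (intro scaleR_lattice) (simp add: WS_def)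
    have "y - - (h *\<^sub>R k) \<in> lattice h \<longleftrightarrow> y \<in> lattice h" for y
      using lattice_add[of y h "h *\<^sub>R k"] lattice_diff[of "y + h *\<^sub>R k" h "h *\<^sub>R k"] kh by auto
    then have "{y \<in> Omega. y - - (h *\<^sub>R k) \<in> lattice h} = Omega_h h" by (auto simp: Omega_h_def)
    moreover have "(\<Sum>z\<in>Omega \<inter> lattice h. g z) = (\<Sum>y\<in>{y \<in> Omega. y - - (h *\<^sub>R k) \<in> lattice h}. g (y - - (h *\<^sub>R k)))"
      by (rule sum_Omega_shift) (use lattice_h_shift g_shift in auto)
    ultimately show ?thesis by (simp add: Omega_h_def)
  qed
  have "(\<Sum>z\<in>Omega_h h. S z) \<le> (\<Sum>z\<in>Omega_h h. 16 * K ^ 4 / lamG * real (card NK) * (\<Sum>k\<in>WS. g (z + h *\<^sub>R k)))"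
    by (rule sum_mono[OF S_le[OF small]])
  also have "\<dots> = 16 * K ^ 4 / lamG * real (card NK) * (\<Sum>k\<in>WS. \<Sum>z\<in>Omega_h h. g (z + h *\<^sub>R k))"
    by (simp add: sum_distrib_left sum.swap[of _ WS])
  also have "(\<Sum>k\<in>WS. \<Sum>z\<in>Omega_h h. g (z + h *\<^sub>R k)) = real (card WS) * (\<Sum>z\<in>Omega_h h. g z)"
    by (simp add: shift)
  finally show ?thesis by (simp add: C4_def energy_h_eq mult_ac)
qed

lemma energy_h_nonneg: "0 \<le> energy_h h D sb u"
  unfolding energy_h_eq using g_nonneg by (simp add: sum_nonneg)

end

section \<open>The finite element energy\<close>

lemma Omega_lmeasurable: "Omega \<in> lmeasurable"
proof (rule bounded_set_imp_lmeasurable[OF bounded_Omega])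
  have "closed {x::vec2. 0 \<le> x $ 1 \<and> 0 \<le> x $ 2}" "open {x::vec2. x $ 1 < 1 \<and> x $ 2 < 1}"
    by (auto intro!: closed_Collect_conj closed_Collect_le open_Collect_conj open_Collect_less continuous_intros)
  then have "{x::vec2. 0 \<le> x $ 1 \<and> 0 \<le> x $ 2} \<inter> {x. x $ 1 < 1 \<and> x $ 2 < 1} \<in> sets borel" by auto
  moreover have "Omega = {x. 0 \<le> x $ 1 \<and> 0 \<le> x $ 2} \<inter> {x. x $ 1 < 1 \<and> x $ 2 < 1}"
    by (auto simp: Omega_def forall_2)
  ultimately show "Omega \<in> sets lebesgue" by simp
qed

lemma has_integral_near_constant:
  fixes f :: "vec2 \<Rightarrow> real"
  assumes f: "(f has_integral J) S" and S: "S \<in> lmeasurable" and near: "\<And>x. x \<in> S \<Longrightarrow> \<bar>f x - c\<bar> \<le> B"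
  shows "\<bar>J - measure lebesgue S * c\<bar> \<le> measure lebesgue S * B"
proof -
  have one: "((\<lambda>x. 1::real) has_integral measure lebesgue S) S"
    using S by (simp add: lmeasure_integral lmeasurable_iff_integrable_on integrable_integral)
  have const: "((\<lambda>x. d) has_integral d * measure lebesgue S) S" for d :: real
    using has_integral_mult_right[OF one, of d] by simp
  have "J \<le> (c + B) * measure lebesgue S"
    by (rule has_integral_le[OF f const]) (use near in \<open>auto simp: abs_le_iff algebra_simps\<close>)
  moreover have "(c - B) * measure lebesgue S \<le> J"
    by (rule has_integral_le[OF const f]) (use near in \<open>auto simp: abs_le_iff algebra_simps\<close>)
  ultimately show ?thesis by (simp add: abs_le_iff algebra_simps)
qed

lemma negligible_segment: "negligible (closed_segment a (b :: vec2))"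
  by (simp add: negligible_convex_interior interior_closed_segment_ge2)

text \<open>\<open>grad\<close> is a choice among derivatives; on an open set where the function is
  affine, uniqueness of the derivative determines it.\<close>

lemma grad_affine:
  assumes "open U" "x \<in> U" "\<And>y. y \<in> U \<Longrightarrow> I y = v \<bullet> y + c"
  shows "grad I x = v"
proof -
  have "((\<lambda>y. v \<bullet> y + c) has_derivative (\<lambda>d. v \<bullet> d)) (at x)"
    by (auto intro!: derivative_eq_intros)
  then have "(I has_derivative (\<lambda>d. v \<bullet> d)) (at x)"
    by (rule has_derivative_transform_within_open[OF _ assms(1,2)]) (simp add: assms(3))
  then have v: "GDERIV I x :> v" by (simp add: gderiv_def inner_commute)
  show ?thesis unfolding grad_def
  proof (rule some_equality[of "\<lambda>g. GDERIV I x :> g", OF v])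
    fix v' assume "GDERIV I x :> v'"
    then have "(\<lambda>d. d \<bullet> v') = (\<lambda>d. d \<bullet> v)" using v unfolding gderiv_def by (rule has_derivative_unique)
    then have "\<forall>d. d \<bullet> v' = d \<bullet> v" by meson
    then show "v' = v" by (metis vector_eq_ldot)
  qed
qed

context lbr_grid
begin

lemma triangle_area:
  assumes "tri t a b c"
  shows "measure lebesgue t = h\<^sup>2 / 2"
proof -
  have t: "t = convex hull {a, b, c}" and d: "\<bar>det2 (b - a) (c - a)\<bar> = h\<^sup>2" using assms by (auto simp: tri_def)
  have "closed t" unfolding t by (intro compact_imp_closed finite_imp_compact_convex_hull) simp
  then have "measure lebesgue t = measure lborel t" by (simp add: measure_completion borel_closed)
  also have "\<dots> = \<bar>(c $ 1 - a $ 1) * (b $ 2 - a $ 2) - (b $ 1 - a $ 1) * (c $ 2 - a $ 2)\<bar> / 2"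
    unfolding t by (rule content_triangle)
  also have "\<bar>(c $ 1 - a $ 1) * (b $ 2 - a $ 2) - (b $ 1 - a $ 1) * (c $ 2 - a $ 2)\<bar> = \<bar>det2 (b - a) (c - a)\<bar>"
    by (simp add: det2_def abs_minus_commute mult.commute)
  finally show ?thesis unfolding d .
qed

lemma triangle_lmeasurable: "t \<in> T \<Longrightarrow> t \<in> lmeasurable"
  using triangle_compact(1) by (rule lmeasurable_compact)

text \<open>The stiffness form of linear elements written over edges: Selling's expansion of cof(D)
  at the vector y with perp y = v, for which det(e, y) = - v.e.\<close>

lemma quad_form_edges:
  assumes t: "tri t a b c"
  shows "v \<bullet> (D x *v v) = (1 / h\<^sup>2) * (ew x b c a * (v \<bullet> (c - b))\<^sup>2 + ew x c a b * (v \<bullet> (a - c))\<^sup>2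
      + ew x a b c * (v \<bullet> (b - a))\<^sup>2)"
proof -
  define y :: vec2 where "y = vector [v $ 2, - v $ 1]"
  have py: "perp y = v" by (simp add: y_def vec_eq_iff forall_2)
  have det: "det2 e y = - (v \<bullet> e)" for e by (simp add: det2_def y_def inner_vec2)
  have e: "ew x b c a = sel (G x) (tsb a b c) 0" "ew x c a b = sel (G x) (tsb a b c) 1"
    "ew x a b c = sel (G x) (tsb a b c) 2"
    unfolding ew_def sel_012 tsb_012 by simp_all
  have "v \<bullet> (D x *v v) = y \<bullet> (G x *v y)" by (simp add: cof_form py)
  also have "\<dots> = (\<Sum>i<3. sel (G x) (tsb a b c) i * det2 (tsb a b c i) y * det2 (tsb a b c i) y)"
    by (rule selling_expansion[OF G_sym tsb_superbase[OF t]])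
  also have "\<dots> = (1 / h\<^sup>2) * (ew x b c a * (v \<bullet> (c - b))\<^sup>2 + ew x c a b * (v \<bullet> (a - c))\<^sup>2
      + ew x a b c * (v \<bullet> (b - a))\<^sup>2)"
  proof -
    have "s0 * - ((1/h) * p) * - ((1/h) * p) + s1 * - ((1/h) * q) * - ((1/h) * q) + s2 * - ((1/h) * r) * - ((1/h) * r)
      = (1 / h\<^sup>2) * (s0 * p\<^sup>2 + s1 * q\<^sup>2 + s2 * r\<^sup>2)" for s0 s1 s2 p q r :: real
      by (simp add: power2_eq_square distrib_left mult_ac)
    then show ?thesis unfolding sum_less_3 e tsb_012 det inner_scaleR_right .
  qed
  finally show ?thesis .
qed

lemma D_nonneg: "0 \<le> v \<bullet> (D x *v v)"
proof -
  define y :: vec2 where "y = vector [v $ 2, - v $ 1]"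
  have py: "perp y = v" by (simp add: y_def vec_eq_iff forall_2)
  have "0 \<le> lamG * (norm y)\<^sup>2" using lamG_pos by simp
  also have "\<dots> \<le> y \<bullet> (G x *v y)" by (rule G_lower)
  finally show ?thesis by (simp add: cof_form py)
qed

definition tsum where "tsum t = (\<Sum>m\<in>H \<inter> t. Gm m * du m)"

definition dsum where "dsum t = (\<Sum>m\<in>H \<inter> t. du m)"

lemma sum_half_points:
  assumes "t \<in> T" "tri t a b c"
  shows "(\<Sum>m\<in>H \<inter> t. \<phi> m) = \<phi> ((1/2) *\<^sub>R (b + c)) + \<phi> ((1/2) *\<^sub>R (c + a)) + (\<phi> ((1/2) *\<^sub>R (a + b)) :: real)"
  unfolding tri_half_points(1)[OF assms] using tri_half_points(2-4)[OF assms] by simp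

lemma quad_form_near:
  assumes t: "t \<in> T" "tri t a b c" and x: "x \<in> t"
    and v: "v \<bullet> (b - a) = u b - u a" "v \<bullet> (c - b) = u c - u b" "v \<bullet> (a - c) = u a - u c"
  shows "\<bar>v \<bullet> (D x *v v) - tsum t / h\<^sup>2\<bar> \<le> C2 * h * dsum t / h\<^sup>2"
proof -
  note r = tri_rotate[OF t(2)]
  note rr = tri_rotate[OF r]
  let ?ma = "(1/2) *\<^sub>R (b + c)" and ?mb = "(1/2) *\<^sub>R (c + a)" and ?mc = "(1/2) *\<^sub>R (a + b)"
  have near: "norm (x - m) \<le> K * h" if "m \<in> t" for m
    using tri_norm[OF t(2) x that] mult_right_mono[OF K_ge(1), of h] h_pos by linarith
  have m: "?ma \<in> t" "?mb \<in> t" "?mc \<in> t" using tri_midpoint[OF t] tri_midpoint[OF t(1) r] tri_midpoint[OF t(1) rr] by simp_all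
  have e: "\<bar>ew x b c a - Gm ?ma\<bar> \<le> C2 * h" "\<bar>ew x c a b - Gm ?mb\<bar> \<le> C2 * h" "\<bar>ew x a b c - Gm ?mc\<bar> \<le> C2 * h"
    by (rule ew_near_Gm[OF t(1) r refl near[OF m(1)]], rule ew_near_Gm[OF t(1) rr refl near[OF m(2)]],
        rule ew_near_Gm[OF t refl near[OF m(3)]])
  have d: "du ?ma = (u c - u b)\<^sup>2" "du ?mb = (u a - u c)\<^sup>2" "du ?mc = (u b - u a)\<^sup>2"
    by (rule du_edge[OF t(1) r refl], rule du_edge[OF t(1) rr refl], rule du_edge[OF t refl])
  have sc: "\<bar>(y - y') * z\<bar> \<le> C2 * h * z" if "\<bar>y - y'\<bar> \<le> C2 * h" "0 \<le> z" for y y' z :: real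
    using mult_right_mono[OF that] that(2) by (simp add: abs_mult)
  have "\<bar>(ew x b c a - Gm ?ma) * du ?ma\<bar> \<le> C2 * h * du ?ma"
    "\<bar>(ew x c a b - Gm ?mb) * du ?mb\<bar> \<le> C2 * h * du ?mb"
    "\<bar>(ew x a b c - Gm ?mc) * du ?mc\<bar> \<le> C2 * h * du ?mc"
    using e by (auto intro!: sc simp: du_def)
  moreover have "h\<^sup>2 * (v \<bullet> (D x *v v)) - tsum t = (ew x b c a - Gm ?ma) * du ?ma
      + (ew x c a b - Gm ?mb) * du ?mb + (ew x a b c - Gm ?mc) * du ?mc"
  proof -
    have q: "h\<^sup>2 * (v \<bullet> (D x *v v)) = ew x b c a * du ?ma + ew x c a b * du ?mb + ew x a b c * du ?mc"
      unfolding quad_form_edges[OF t(2)] v d using h_pos by simp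
    show ?thesis unfolding q tsum_def sum_half_points[OF t] left_diff_distrib by linarith
  qed
  ultimately have "\<bar>h\<^sup>2 * (v \<bullet> (D x *v v)) - tsum t\<bar> \<le> C2 * h * dsum t"
    unfolding dsum_def sum_half_points[OF t] distrib_left by linarith
  then have "\<bar>h\<^sup>2 * (v \<bullet> (D x *v v)) - tsum t\<bar> / h\<^sup>2 \<le> C2 * h * dsum t / h\<^sup>2"
    by (intro divide_right_mono) auto
  moreover have "\<bar>h\<^sup>2 * (v \<bullet> (D x *v v)) - tsum t\<bar> / h\<^sup>2 = \<bar>v \<bullet> (D x *v v) - tsum t / h\<^sup>2\<bar>"
  proof -
    have "\<bar>h\<^sup>2 * (v \<bullet> (D x *v v)) - tsum t\<bar> / h\<^sup>2 = \<bar>(h\<^sup>2 * (v \<bullet> (D x *v v)) - tsum t) / h\<^sup>2\<bar>"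
      by (simp only: abs_divide abs_power2)
    then show ?thesis using h_pos by (simp only: diff_divide_distrib) simp
  qed
  ultimately show ?thesis by simp
qed

lemma continuous_ew: "continuous_on UNIV (\<lambda>x. ew x a b c)"
proof -
  have lip: "(LG * norm v * norm w)-lipschitz_on UNIV (\<lambda>x. v \<bullet> (G x *v w))" for v w
  proof (rule lipschitz_onI)
    show "dist (v \<bullet> (G x *v w)) (v \<bullet> (G y *v w)) \<le> LG * norm v * norm w * dist x y" for x y
      using G_lip[of v x w y] by (simp add: dist_norm mult_ac)
    show "0 \<le> LG * norm v * norm w" using LG_pos by simp
  qed
  show ?thesis unfolding ew_def sel_def
    by (intro continuous_on_minus lipschitz_on_continuous_on[OF lip])
qed

text \<open>The locale controls D through cof(D), so continuity is read off from the edge weights of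
  any one triangle.\<close>

lemma continuous_quad_form: "continuous_on UNIV (\<lambda>x. v \<bullet> (D x *v v))"
proof -
  obtain t where "t \<in> T" using Union_T by blast
  then obtain a b c where t: "tri t a b c" using tri_ex by metis
  show ?thesis unfolding quad_form_edges[OF t] by (intro continuous_intros continuous_ew)
qed

text \<open>Distinct triangles share at most two vertices, so conformity puts their intersection
  into a segment.\<close>

lemma triangles_overlap_negligible:
  assumes t: "t \<in> T" "t' \<in> T" "t \<noteq> t'"
  shows "negligible (t \<inter> t')"
proof -
  obtain a b c where abc: "tri t a b c" using tri_ex[OF t(1)] by metis
  obtain a' b' c' where abc': "tri t' a' b' c'" using tri_ex[OF t(2)] by metis
  have eq: "t \<inter> t' = convex hull (vertices t \<inter> vertices t')" using ADT t by (simp only: ADT_def) blast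
  have "\<exists>x y. vertices t \<inter> vertices t' \<subseteq> {x, y}"
  proof (rule ccontr)
    assume neg: "\<not> ?thesis"
    have V: "vertices t = {a, b, c}" "vertices t' = {a', b', c'}" using abc abc' by (auto simp: tri_def)
    have "{a, b, c} \<subseteq> {a', b', c'}"
    proof (rule ccontr)
      assume "\<not> ?thesis"
      then have "a \<notin> {a', b', c'} \<or> b \<notin> {a', b', c'} \<or> c \<notin> {a', b', c'}" by blast
      then have "{a, b, c} \<inter> {a', b', c'} \<subseteq> {b, c} \<or> {a, b, c} \<inter> {a', b', c'} \<subseteq> {a, c} \<or> {a, b, c} \<inter> {a', b', c'} \<subseteq> {a, b}"
        by blast
      then show False using neg unfolding V by blast
    qed
    then have "{a, b, c} = {a', b', c'}"
      using tri_distinct[OF abc] tri_distinct[OF abc'] by (intro card_subset_eq) auto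
    then show False using t(3) abc abc' by (simp add: tri_def)
  qed
  then obtain x y where "vertices t \<inter> vertices t' \<subseteq> {x, y}" by blast
  then have "t \<inter> t' \<subseteq> closed_segment x y" unfolding eq segment_convex_hull by (rule hull_mono)
  then show ?thesis using negligible_segment negligible_subset by blast
qed

definition TO where "TO = {t \<in> T. t \<inter> Omega \<noteq> {}}"

definition At where "At t = measure lebesgue (t \<inter> Omega)"

lemma finite_TO: "finite TO" unfolding TO_def by (rule finite_triangles[OF bounded_Omega])

text \<open>Inside t the gradient is constant, and the boundary is negligible. The integral runs
  over t cut by Omega because triangles may stick out of the period cell.\<close>

lemma triangle_integral:
  assumes I: "pl_interpolant T u I" and t: "t \<in> T"
  obtains J where "((\<lambda>x. (Mnorm (D x) (grad I x))\<^sup>2) has_integral J) (t \<inter> Omega)"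
    "\<bar>J - At t * (tsum t / h\<^sup>2)\<bar> \<le> At t * (C2 * h * dsum t / h\<^sup>2)"
proof -
  obtain a b c where abc: "tri t a b c" using tri_ex[OF t] by metis
  obtain v d where vd: "\<And>x. x \<in> t \<Longrightarrow> I x = v \<bullet> x + d" using I t by (auto simp: pl_interpolant_def)
  have V: "vertices t = {a, b, c}" "{a, b, c} \<subseteq> t"
    using abc hull_subset[of "{a, b, c}" convex] by (auto simp: tri_def)
  have ends: "u x = v \<bullet> x + d" if "x \<in> {a, b, c}" for x
    using I t that V vd[of x] by (auto simp: pl_interpolant_def)
  have v: "v \<bullet> (b - a) = u b - u a" "v \<bullet> (c - b) = u c - u b" "v \<bullet> (a - c) = u a - u c"
    using ends by (simp_all add: inner_diff_right)
  have meas: "t \<inter> Omega \<in> lmeasurable" using triangle_lmeasurable[OF t] Omega_lmeasurable by (rule fmeasurable.Int)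
  have "(\<lambda>x. v \<bullet> (D x *v v)) absolutely_integrable_on cbox 0 1"
    by (intro absolutely_integrable_continuous continuous_on_subset[OF continuous_quad_form]) simp
  moreover have "t \<inter> Omega \<subseteq> cbox 0 1" by (auto simp: Omega_def mem_box_cart less_imp_le)
  moreover have "t \<inter> Omega \<in> sets lebesgue" using meas by (rule fmeasurableD)
  ultimately have "(\<lambda>x. v \<bullet> (D x *v v)) absolutely_integrable_on (t \<inter> Omega)"
    by (metis set_integrable_subset)
  then have "(\<lambda>x. v \<bullet> (D x *v v)) integrable_on (t \<inter> Omega)" by (simp add: absolutely_integrable_on_def)
  then obtain J where J: "((\<lambda>x. v \<bullet> (D x *v v)) has_integral J) (t \<inter> Omega)" by blast
  have "((\<lambda>x. (Mnorm (D x) (grad I x))\<^sup>2) has_integral J) (t \<inter> Omega)"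
  proof (rule has_integral_spike[OF _ _ J])
    show "negligible (frontier t)" using triangle_compact(2)[OF t] by (rule negligible_convex_frontier)
    fix x assume x: "x \<in> t \<inter> Omega - frontier t"
    then have xi: "x \<in> interior t"
      using closure_subset[of t] by (auto simp: frontier_def)
    have "grad I x = v"
      by (rule grad_affine[OF open_interior xi, of I v d]) (use vd interior_subset in blast)
    then show "(Mnorm (D x) (grad I x))\<^sup>2 = v \<bullet> (D x *v v)" by (simp add: Mnorm_def D_nonneg)
  qed
  moreover have "\<bar>J - At t * (tsum t / h\<^sup>2)\<bar> \<le> At t * (C2 * h * dsum t / h\<^sup>2)"
    unfolding At_def by (rule has_integral_near_constant[OF J meas]) (use quad_form_near[OF t abc _ v] in auto)
  ultimately show ?thesis using that by blast
qed

lemma energy_fe_near_sum: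
  assumes I: "pl_interpolant T u I"
  shows "\<bar>energy_fe D I - (\<Sum>t\<in>TO. At t * tsum t) / h\<^sup>2\<bar> \<le> C2 * h * (\<Sum>t\<in>TO. At t * dsum t) / h\<^sup>2"
proof -
  have "\<forall>t\<in>TO. \<exists>J. ((\<lambda>x. (Mnorm (D x) (grad I x))\<^sup>2) has_integral J) (t \<inter> Omega) \<and>
      \<bar>J - At t * (tsum t / h\<^sup>2)\<bar> \<le> At t * (C2 * h * dsum t / h\<^sup>2)"
  proof
    fix t assume "t \<in> TO"
    then have "t \<in> T" by (simp add: TO_def)
    then show "\<exists>J. ((\<lambda>x. (Mnorm (D x) (grad I x))\<^sup>2) has_integral J) (t \<inter> Omega) \<and>
      \<bar>J - At t * (tsum t / h\<^sup>2)\<bar> \<le> At t * (C2 * h * dsum t / h\<^sup>2)"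
      by (rule triangle_integral[OF I]) blast
  qed
  from bchoice[OF this] obtain J where J: "\<And>t. t \<in> TO \<Longrightarrow> ((\<lambda>x. (Mnorm (D x) (grad I x))\<^sup>2) has_integral J t) (t \<inter> Omega)"
    "\<And>t. t \<in> TO \<Longrightarrow> \<bar>J t - At t * (tsum t / h\<^sup>2)\<bar> \<le> At t * (C2 * h * dsum t / h\<^sup>2)"
    by blast
  have "((\<lambda>x. (Mnorm (D x) (grad I x))\<^sup>2) has_integral (sum J TO)) (\<Union>t\<in>TO. t \<inter> Omega)"
  proof (rule has_integral_UN[OF finite_TO J(1)])
    show "pairwise (\<lambda>i i'. negligible (i \<inter> Omega \<inter> (i' \<inter> Omega))) TO"
    proof (rule pairwiseI)
      fix t t' assume "t \<in> TO" "t' \<in> TO" "t \<noteq> t'"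
      then have "negligible (t \<inter> t')" by (intro triangles_overlap_negligible) (auto simp: TO_def)
      then show "negligible (t \<inter> Omega \<inter> (t' \<inter> Omega))" by (rule negligible_subset) blast
    qed
  qed
  moreover have "(\<Union>t\<in>TO. t \<inter> Omega) = Omega" using Union_T unfolding TO_def by blast
  ultimately have E: "energy_fe D I = sum J TO" unfolding energy_fe_def by (simp add: integral_unique)
  have eq: "energy_fe D I - (\<Sum>t\<in>TO. At t * tsum t) / h\<^sup>2 = (\<Sum>t\<in>TO. J t - At t * (tsum t / h\<^sup>2))"
    unfolding E by (simp add: sum_subtractf sum_divide_distrib)
  have eq2: "C2 * h * (\<Sum>t\<in>TO. At t * dsum t) / h\<^sup>2 = (\<Sum>t\<in>TO. At t * (C2 * h * dsum t / h\<^sup>2))"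
    by (simp add: sum_distrib_left sum_divide_distrib mult_ac)
  show ?thesis unfolding eq eq2 by (rule order_trans[OF sum_abs sum_mono[OF J(2)]])
qed

subsection \<open>Unfolding the torus\<close>

text \<open>Enough translations to bring every point of a triangle that meets Omega into Omega: the
  bounds 2 R h and 2 for the two diameters are added.\<close>

definition Kf where "Kf = {k \<in> lattice 1. norm k \<le> 2 * R * h + 2}"

lemma finite_Kf: "finite Kf"
proof -
  have "finite (lattice 1 \<inter> cball 0 (2 * R * h + 2))" by (rule finite_lattice_bounded) auto
  then show ?thesis by (rule rev_finite_subset) (auto simp: Kf_def)
qed

lemma Omega_diameter: "x \<in> Omega \<Longrightarrow> y \<in> Omega \<Longrightarrow> norm (x - y) \<le> 2"
proof -
  assume xy: "x \<in> Omega" "y \<in> Omega"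
  have c: "\<bar>(x - y) $ i\<bar> \<le> 1" for i
  proof -
    have "0 \<le> x $ i" "x $ i < 1" "0 \<le> y $ i" "y $ i < 1" using xy by (auto simp: Omega_def)
    then show ?thesis by (simp add: abs_le_iff)
  qed
  have "norm (x - y) \<le> (\<Sum>i\<in>UNIV. \<bar>(x - y) $ i\<bar>)" by (rule norm_le_l1_cart)
  then show ?thesis using c[of 1] c[of 2] by (simp add: sum_2)
qed

text \<open>The translates of Omega tile the plane, so moving t by all k and cutting with Omega
  dissects t into disjoint pieces.\<close>

lemma translates_area:
  assumes t: "t \<in> T" and m: "m \<in> t" "m \<in> Omega"
  shows "(\<Sum>k\<in>Kf. At ((\<lambda>x. x + k) ` t)) = h\<^sup>2 / 2"
proof -
  obtain a b c where abc: "tri t a b c" using tri_ex[OF t] by metis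
  define W where "W = (\<lambda>k. (+) (- k) ` Omega)"
  have W: "x \<in> W k \<longleftrightarrow> x + k \<in> Omega" for x k
  proof -
    have "x \<in> W k \<longleftrightarrow> (\<exists>y\<in>Omega. x = - k + y)" by (auto simp: W_def)
    also have "\<dots> \<longleftrightarrow> x + k \<in> Omega"
    proof
      assume "x + k \<in> Omega"
      then show "\<exists>y\<in>Omega. x = - k + y" by (intro bexI[of _ "x + k"]) auto
    qed auto
    finally show ?thesis .
  qed
  have Wm: "t \<inter> W k \<in> lmeasurable" for k
    unfolding W_def using triangle_lmeasurable[OF t] measurable_translation[OF Omega_lmeasurable] by (rule fmeasurable.Int)
  have At: "At ((\<lambda>x. x + k) ` t) = measure lebesgue (t \<inter> W k)" for k
  proof -
    have "(\<lambda>x. x + k) ` t \<inter> Omega = (+) k ` (t \<inter> W k)"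
      using W by (auto simp: add.commute image_iff)
    then show ?thesis by (simp add: At_def measure_translation)
  qed
  have "(\<Sum>k\<in>Kf. measure lebesgue (t \<inter> W k)) = measure lebesgue (\<Union>k\<in>Kf. t \<inter> W k)"
  proof (rule measure_UNION'[symmetric, OF finite_Kf Wm])
    show "pairwise (\<lambda>i j. disjnt (t \<inter> W i) (t \<inter> W j)) Kf"
    proof (rule pairwiseI)
      fix k l assume kl: "k \<in> Kf" "l \<in> Kf" "k \<noteq> l"
      have False if "x + k \<in> Omega" "x + l \<in> Omega" for x
      proof -
        have "(x + k) - (x + l) \<in> lattice 1" using kl lattice_diff[of k 1 l] by (simp add: Kf_def)
        then have "x + k = x + l" by (rule Omega_unique[OF that])
        then show False using kl(3) by simp
      qed
      then show "disjnt (t \<inter> W k) (t \<inter> W l)" using W by (auto simp: disjnt_def)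
    qed
  qed
  also have "(\<Union>k\<in>Kf. t \<inter> W k) = t"
  proof
    show "t \<subseteq> (\<Union>k\<in>Kf. t \<inter> W k)"
    proof
      fix x assume x: "x \<in> t"
      define k where "k = red x - x"
      have "norm k \<le> norm (red x - m) + norm (m - x)"
        unfolding k_def using norm_triangle_ineq[of "red x - m" "m - x"] by simp
      also have "\<dots> \<le> 2 + 2 * R * h" using Omega_diameter[OF red_Omega m(2)] tri_norm[OF abc m(1) x] by (rule add_mono)
      finally have "k \<in> Kf" unfolding Kf_def k_def using red_diff_lattice(1) by simp
      moreover have "x \<in> W k" unfolding W k_def using red_Omega by simp
      ultimately show "x \<in> (\<Union>k\<in>Kf. t \<inter> W k)" using x by blast
    qed
  qed blast
  finally show ?thesis unfolding At triangle_area[OF abc] .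
qed

lemma finite_triangles_at: "finite {t \<in> T. m \<in> t}"
  using finite_triangles[of "{m}"] by simp

lemma T_unshift: "k \<in> lattice 1 \<Longrightarrow> (\<lambda>x. x - k) ` t \<in> T \<longleftrightarrow> t \<in> T"
proof -
  assume k: "k \<in> lattice 1"
  have 1: "(\<lambda>x. x + - k) ` t \<in> T" if "t \<in> T" using T_shift[OF lattice_minus[OF k] that] .
  have 2: "(\<lambda>x. x + k) ` (\<lambda>x. x - k) ` t \<in> T" if "(\<lambda>x. x - k) ` t \<in> T" using T_shift[OF k that] .
  have "(\<lambda>x. x + k) ` (\<lambda>x. x - k) ` t = t" by (simp add: image_image)
  then show ?thesis using 1 2 by auto
qed

text \<open>Triangles crossing the boundary of Omega are cut, so \<open>At t\<close> alone is not
  h^2 / 2. Counting triples of a half point in Omega, a triangle containing it and a translation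
  restores the full area, and two triangles at each half point give h^2.\<close>

lemma unfold_torus:
  assumes per: "\<And>m k. m \<in> H \<Longrightarrow> k \<in> lattice 1 \<Longrightarrow> \<phi> (m + k) = (\<phi> m :: real)"
  shows "(\<Sum>t\<in>TO. At t * (\<Sum>m\<in>H \<inter> t. \<phi> m)) = h\<^sup>2 * (\<Sum>m\<in>HO. \<phi> m)"
proof -
  define X where "X = (SIGMA m:HO. {t \<in> T. m \<in> t} \<times> Kf)"
  \<comment> \<open>Translates that miss Omega have area zero. Without them the triples correspond
    one to one to pairs of a triangle meeting Omega and one of its half points.\<close>
  define X' where "X' = {(m, t, k) \<in> X. (\<lambda>x. x + k) ` t \<inter> Omega \<noteq> {}}"
  have finX: "finite X" unfolding X_def using finite_HO finite_triangles_at finite_Kf by auto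
  have finHt: "finite (H \<inter> t)" if "t \<in> TO" for t
  proof -
    have "t \<in> T" using that by (simp add: TO_def)
    then obtain a b c where "tri t a b c" using tri_ex by metis
    then show ?thesis using tri_half_points(1)[OF \<open>t \<in> T\<close>] by simp
  qed
  have "(\<Sum>m\<in>HO. h\<^sup>2 * \<phi> m) = (\<Sum>m\<in>HO. \<Sum>t\<in>{t \<in> T. m \<in> t}. \<Sum>k\<in>Kf. At ((\<lambda>x. x + k) ` t) * \<phi> m)"
  proof (rule sum.cong[OF refl])
    fix m assume m: "m \<in> HO"
    then have mH: "m \<in> H" "m \<in> Omega" by (auto simp: HO_def)
    have "(\<Sum>k\<in>Kf. At ((\<lambda>x. x + k) ` t) * \<phi> m) = h\<^sup>2 / 2 * \<phi> m" if "t \<in> T" "m \<in> t" for t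
      unfolding sum_distrib_right[symmetric] translates_area[OF that mH(2)] ..
    then have "(\<Sum>t\<in>{t \<in> T. m \<in> t}. \<Sum>k\<in>Kf. At ((\<lambda>x. x + k) ` t) * \<phi> m) = (\<Sum>t\<in>{t \<in> T. m \<in> t}. h\<^sup>2 / 2 * \<phi> m)"
      by (intro sum.cong) auto
    also have "\<dots> = h\<^sup>2 * \<phi> m" using two_triangles[OF mH(1)] by simp
    finally show "h\<^sup>2 * \<phi> m = (\<Sum>t\<in>{t \<in> T. m \<in> t}. \<Sum>k\<in>Kf. At ((\<lambda>x. x + k) ` t) * \<phi> m)" by simp
  qed
  also have "\<dots> = (\<Sum>(m, t, k)\<in>X. At ((\<lambda>x. x + k) ` t) * \<phi> m)"
    unfolding X_def using finite_HO finite_triangles_at finite_Kf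
    by (simp add: sum.Sigma sum.cartesian_product split_def)
  also have "\<dots> = (\<Sum>(m, t, k)\<in>X'. At ((\<lambda>x. x + k) ` t) * \<phi> m)"
    by (rule sum.mono_neutral_right[OF finX]) (auto simp: X'_def At_def)
  also have "\<dots> = (\<Sum>(t, m)\<in>Sigma TO (\<lambda>t. H \<inter> t). At t * \<phi> m)"
  proof (rule sum.reindex_bij_witness[where
        j = "\<lambda>(m, t, k). ((\<lambda>x. x + k) ` t, m + k)" and
        i = "\<lambda>(t, m). (red m, (\<lambda>x. x - (m - red m)) ` t, m - red m)"])
    fix p assume p: "p \<in> X'"
    obtain m t k where mtk: "p = (m, t, k)" by (cases p) auto
    have a: "m \<in> H" "m \<in> Omega" "t \<in> T" "m \<in> t" "k \<in> lattice 1" "(\<lambda>x. x + k) ` t \<inter> Omega \<noteq> {}"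
      using p unfolding mtk X'_def X_def HO_def Kf_def by auto
    have "red (m + k) = m"
    proof (rule Omega_unique[OF red_Omega a(2)])
      have "red (m + k) - m = (red (m + k) - (m + k)) + k" by simp
      then show "red (m + k) - m \<in> lattice 1" using lattice_add[OF red_diff_lattice(1) a(5)] by metis
    qed
    then show "(case case p of (m, t, k) \<Rightarrow> ((\<lambda>x. x + k) ` t, m + k) of
          (t, m) \<Rightarrow> (red m, (\<lambda>x. x - (m - red m)) ` t, m - red m)) = p"
      unfolding mtk by (simp add: image_image)
    show "(case p of (m, t, k) \<Rightarrow> ((\<lambda>x. x + k) ` t, m + k)) \<in> Sigma TO (\<lambda>t. H \<inter> t)"
      unfolding mtk using a T_shift[OF a(5,3)] H_shift[OF a(5), of m] by (auto simp: TO_def)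
    show "(case case p of (m, t, k) \<Rightarrow> ((\<lambda>x. x + k) ` t, m + k) of (t, m) \<Rightarrow> At t * \<phi> m)
        = (case p of (m, t, k) \<Rightarrow> At ((\<lambda>x. x + k) ` t) * \<phi> m)"
      unfolding mtk using per[OF a(1,5)] by simp
  next
    fix p assume p: "p \<in> Sigma TO (\<lambda>t. H \<inter> t)"
    obtain t m where tm: "p = (t, m)" by (cases p) auto
    have a: "t \<in> T" "t \<inter> Omega \<noteq> {}" "m \<in> H" "m \<in> t" using p unfolding tm TO_def by auto
    define k where "k = m - red m"
    have k: "k \<in> lattice 1" unfolding k_def by (rule red_diff_lattice(2))
    have ret: "(\<lambda>x. x + k) ` (\<lambda>x. x - k) ` t = t" by (simp add: image_image)
    obtain y where y: "y \<in> t" "y \<in> Omega" using a(2) by blast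
    obtain a' b' c' where abc: "tri t a' b' c'" using tri_ex[OF a(1)] by metis
    have "norm k \<le> norm (m - y) + norm (y - red m)"
      unfolding k_def using norm_triangle_ineq[of "m - y" "y - red m"] by simp
    also have "\<dots> \<le> 2 * R * h + 2" using tri_norm[OF abc a(4) y(1)] Omega_diameter[OF y(2) red_Omega] by (rule add_mono)
    finally have "k \<in> Kf" using k by (simp add: Kf_def)
    moreover have "red m \<in> HO"
      using H_shift[OF lattice_minus[OF k], of m] a(3) red_Omega[of m] by (simp add: HO_def k_def)
    moreover have "(\<lambda>x. x - k) ` t \<in> T" using T_unshift[OF k] a(1) by simp
    moreover have "red m \<in> (\<lambda>x. x - k) ` t" using a(4) by (force simp: k_def)
    ultimately show "(case p of (t, m) \<Rightarrow> (red m, (\<lambda>x. x - (m - red m)) ` t, m - red m)) \<in> X'"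
      using a(2) ret unfolding tm X'_def X_def k_def by auto
    show "(case case p of (t, m) \<Rightarrow> (red m, (\<lambda>x. x - (m - red m)) ` t, m - red m) of
        (m, t, k) \<Rightarrow> ((\<lambda>x. x + k) ` t, m + k)) = p"
      unfolding tm by (simp add: image_image)
  qed
  also have "\<dots> = (\<Sum>t\<in>TO. \<Sum>m\<in>H \<inter> t. At t * \<phi> m)"
    using finite_TO finHt by (subst sum.Sigma) auto
  finally show ?thesis by (simp add: sum_distrib_left)
qed

text \<open>\<open>C2\<close> enters twice, once for each energy compared with the common sum over
  half points; \<open>coercive\<close> then bounds the unweighted energy.\<close>

lemma energies_close:
  assumes I: "pl_interpolant T u I" and small: "19 * K ^ 8 * C5 * h \<le> lamG / 4"
  shows "\<bar>energy_fe D I - energy_h h D sb u\<bar> \<le> (2 * C2 * C4) * h * energy_h h D sb u"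
proof -
  have h2: "h\<^sup>2 \<noteq> 0" using h_pos by simp
  have 1: "(\<Sum>t\<in>TO. At t * tsum t) / h\<^sup>2 = (\<Sum>m\<in>HO. Gm m * du m)"
    unfolding tsum_def using h2 by (subst unfold_torus) (simp_all add: Gm_shift du_shift)
  have 2: "(\<Sum>t\<in>TO. At t * dsum t) / h\<^sup>2 = (\<Sum>m\<in>HO. du m)"
    unfolding dsum_def using h2 by (subst unfold_torus) (simp_all add: du_shift)
  have C2h: "0 \<le> C2 * h"
    unfolding C2_def using C1_nonneg LG_pos K_ge h_pos by simp
  have "\<bar>energy_fe D I - (\<Sum>m\<in>HO. Gm m * du m)\<bar> \<le> C2 * h * (\<Sum>m\<in>HO. du m)"
    using energy_fe_near_sum[OF I] unfolding 1 times_divide_eq_right[symmetric] 2 .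
  also have "\<dots> \<le> C2 * h * (\<Sum>z\<in>Omega_h h. S z)" using sum_du_le C2h by (rule mult_left_mono)
  finally have "\<bar>energy_fe D I - energy_h h D sb u\<bar> \<le> 2 * (C2 * h * (\<Sum>z\<in>Omega_h h. S z))"
    using energy_h_near by linarith
  also have "\<dots> \<le> 2 * (C2 * h * (C4 * energy_h h D sb u))"
    using mult_left_mono[OF coercive[OF small] C2h] by simp
  finally show ?thesis by (simp add: mult_ac)
qed

end

section \<open>Uniform constants\<close>

lemma mat2_form_bound: "\<bar>v \<bullet> ((A::mat2) *v w)\<bar> \<le> 2 * norm A * norm v * norm w"
proof -
  have eq: "v \<bullet> (A *v w) = v $ 1 * (A $ 1 \<bullet> w) + v $ 2 * (A $ 2 \<bullet> w)"
    by (simp add: inner_vec2 mat2_mult_vec)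
  have b: "\<bar>v $ i * (A $ i \<bullet> w)\<bar> \<le> norm v * (norm A * norm w)" for i
  proof -
    have "\<bar>A $ i \<bullet> w\<bar> \<le> norm (A $ i) * norm w" by (rule Cauchy_Schwarz_ineq2)
    also have "\<dots> \<le> norm A * norm w" by (intro mult_right_mono Finite_Cartesian_Product.norm_nth_le) simp
    finally show ?thesis unfolding abs_mult by (intro mult_mono component_le_norm_cart) auto
  qed
  have "\<bar>v \<bullet> (A *v w)\<bar> \<le> \<bar>v $ 1 * (A $ 1 \<bullet> w)\<bar> + \<bar>v $ 2 * (A $ 2 \<bullet> w)\<bar>" unfolding eq by (rule abs_triangle_ineq)
  then show ?thesis using b[of 1] b[of 2] by (simp add: mult_ac)
qed

lemma transpose_scaleR_mat2: "transpose (r *\<^sub>R A) = r *\<^sub>R transpose (A::mat2)"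
  by (simp add: transpose_def vec_eq_iff)

lemma cof_sym:
  assumes "transpose A = A"
  shows "transpose (cof A) = cof A"
  using sym_mat2[OF assms] unfolding transpose_def cof_def vec_eq_iff forall_2 by simp

lemma Mfield_eq_cof:
  assumes sym: "transpose (D z) = D z" and det: "0 < det (D z)"
  shows "Mfield D z = (1 / sqrt (det (D z))) *\<^sub>R cof (D z)"
proof -
  let ?d = "det (D z)"
  have s21: "D z $ 2 $ 1 = D z $ 1 $ 2" using sym by (rule sym_mat2)
  have d: "?d = D z $ 1 $ 1 * D z $ 2 $ 2 - D z $ 1 $ 2 * D z $ 1 $ 2" by (simp add: det_2 s21)
  have right: "D z ** ((1 / ?d) *\<^sub>R cof (D z)) = mat 1"
    using det by (simp add: vec_eq_iff forall_2 matrix_matrix_mult_def sum_2 mat_def cof_def s21 field_simps) (simp add: d algebra_simps)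
  then have left: "((1 / ?d) *\<^sub>R cof (D z)) ** D z = mat 1" by (simp add: matrix_left_right_inverse)
  have "matrix_inv (D z) = (1 / ?d) *\<^sub>R cof (D z)"
  proof -
    have "D z ** matrix_inv (D z) = mat 1 \<and> matrix_inv (D z) ** D z = mat 1"
      unfolding matrix_inv_def by (rule someI_ex) (use left right in blast)
    then have "matrix_inv (D z) = (((1 / ?d) *\<^sub>R cof (D z)) ** D z) ** matrix_inv (D z)"
      unfolding left by simp
    also have "\<dots> = ((1 / ?d) *\<^sub>R cof (D z)) ** (D z ** matrix_inv (D z))" by (simp add: matrix_mul_assoc)
    also have "\<dots> = (1 / ?d) *\<^sub>R cof (D z)"
      using \<open>D z ** matrix_inv (D z) = mat 1 \<and> matrix_inv (D z) ** D z = mat 1\<close> by simp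
    finally show ?thesis .
  qed
  then have "Mfield D z = (sqrt ?d * (1 / ?d)) *\<^sub>R cof (D z)" by (simp add: Mfield_def)
  also have "sqrt ?d * (1 / ?d) = 1 / sqrt ?d" using det by (simp add: real_div_sqrt real_sqrt_divide divide_simps)
  finally show ?thesis .
qed

text \<open>Periodicity moves every point into the unit cell; compactness bounds D there and gives a
  positive minimum of the quadratic form over cell times unit circle.\<close>

lemma field_constants:
  fixes D :: "vec2 \<Rightarrow> mat2"
  assumes spd: "\<forall>x. spd (D x)" and per: "\<forall>x. \<forall>k\<in>lattice 1. D (x + k) = D x"
    and lip: "\<exists>L. \<forall>x y. norm (D x - D y) \<le> L * norm (x - y)"
  obtains m B Ld where "0 < m" "0 < B" "0 < Ld" "\<And>x y. norm (D x - D y) \<le> Ld * norm (x - y)"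
    "\<And>x. norm (D x) \<le> B" "\<And>x v. m * (norm v)\<^sup>2 \<le> v \<bullet> (D x *v v)"
proof -
  obtain L0 where L0: "\<And>x y. norm (D x - D y) \<le> L0 * norm (x - y)" using lip by blast
  \<comment> \<open>A constant field admits the Lipschitz constant 0, while a positive one is
    wanted.\<close>
  define Ld where "Ld = \<bar>L0\<bar> + 1"
  have Ld: "norm (D x - D y) \<le> Ld * norm (x - y)" for x y
  proof -
    have "L0 * norm (x - y) \<le> Ld * norm (x - y)" unfolding Ld_def by (intro mult_right_mono) auto
    then show ?thesis using L0[of x y] by linarith
  qed
  have Ld_pos: "0 < Ld" by (simp add: Ld_def)
  have "Ld-lipschitz_on UNIV D"
    using Ld Ld_pos by (intro lipschitz_onI) (auto simp: dist_norm)
  then have cont: "continuous_on UNIV D" by (rule lipschitz_on_continuous_on)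
  have reduce: "D x = D (red x)" "red x \<in> cbox 0 1" for x
  proof -
    have "D (x + (red x - x)) = D x" using per red_diff_lattice(1) by blast
    then show "D x = D (red x)" by simp
    have "red x \<in> Omega" by (rule red_Omega)
    then show "red x \<in> cbox 0 1" by (auto simp: Omega_def mem_box_cart less_imp_le)
  qed
  have "compact (D ` cbox 0 1)"
    by (intro compact_continuous_image continuous_on_subset[OF cont]) auto
  then obtain B0 where B0: "\<And>x. x \<in> cbox 0 1 \<Longrightarrow> norm (D x) \<le> B0"
    by (meson bounded_iff compact_imp_bounded imageI)
  have B: "norm (D x) \<le> \<bar>B0\<bar> + 1" for x using B0[OF reduce(2)[of x]] reduce(1)[of x] by simp
  let ?C = "cbox 0 1 \<times> sphere 0 1 :: (vec2 \<times> vec2) set"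
  have C: "compact ?C" by (intro compact_Times) auto
  have "(0, axis 1 1) \<in> ?C" by (simp add: mem_box_cart)
  then have C_ne: "?C \<noteq> {}" by blast
  have C_cont: "continuous_on ?C (\<lambda>p. snd p \<bullet> (D (fst p) *v snd p))"
  proof -
    have "continuous_on ?C (\<lambda>p. D (fst p))"
      by (rule continuous_on_compose2[OF cont]) (auto intro!: continuous_intros)
    then show ?thesis unfolding inner_vec2 mat2_mult_vec by (intro continuous_intros)
  qed
  obtain p where p: "p \<in> ?C" "\<forall>p'\<in>?C. snd p \<bullet> (D (fst p) *v snd p) \<le> snd p' \<bullet> (D (fst p') *v snd p')"
    using continuous_attains_inf[OF C C_ne C_cont] by blast
  define m where "m = snd p \<bullet> (D (fst p) *v snd p)"
  have "snd p \<noteq> 0" using p(1) by auto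
  then have m_pos: "0 < m" unfolding m_def using spd by (simp add: spd_def)
  have "m * (norm v)\<^sup>2 \<le> v \<bullet> (D x *v v)" for x v
  proof (cases "v = 0")
    case False
    define v' where "v' = (1 / norm v) *\<^sub>R v"
    have "(red x, v') \<in> ?C" using False reduce(2)[of x] by (simp add: v'_def)
    then have "m \<le> v' \<bullet> (D (red x) *v v')" unfolding m_def using p(2) by fastforce
    also have "\<dots> = (v \<bullet> (D x *v v)) / (norm v)\<^sup>2"
      unfolding reduce(1)[symmetric] v'_def by (simp add: matrix_vector_mult_scaleR power2_eq_square)
    finally show ?thesis using False by (simp add: pos_le_divide_eq)
  qed simp
  then show ?thesis using that[of m "\<bar>B0\<bar> + 1" Ld] m_pos Ld_pos Ld B by simp
qed

text \<open>The factor det(D)^(1/2) lies between m and 2 B. It is Lipschitz because a difference of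
  roots is the difference of determinants divided by a sum of roots, at least 2 m. So M inherits the
  bounds of cof(D).\<close>

lemma metric_constants:
  fixes D :: "vec2 \<Rightarrow> mat2"
  assumes spd: "\<forall>x. spd (D x)" and per: "\<forall>x. \<forall>k\<in>lattice 1. D (x + k) = D x"
    and lip: "\<exists>L. \<forall>x y. norm (D x - D y) \<le> L * norm (x - y)"
  obtains lam Lam L lamG LG sG where "metric_field D lam Lam L"
    "0 < lamG" "0 < LG" "0 < sG"
    "\<And>z. transpose (cof (D z)) = cof (D z)"
    "\<And>z. \<exists>s. 0 < s \<and> s \<le> sG \<and> cof (D z) = s *\<^sub>R Mfield D z"
    "\<And>z v. lamG * (norm v)\<^sup>2 \<le> v \<bullet> (cof (D z) *v v)"
    "\<And>z z' v w. \<bar>v \<bullet> (cof (D z) *v w) - v \<bullet> (cof (D z') *v w)\<bar> \<le> LG * norm (z - z') * norm v * norm w"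
proof -
  obtain m B Ld where mBL: "0 < m" "0 < B" "0 < Ld" "\<And>x y. norm (D x - D y) \<le> Ld * norm (x - y)"
    "\<And>x. norm (D x) \<le> B" "\<And>x v. m * (norm v)\<^sup>2 \<le> v \<bullet> (D x *v v)"
    using field_constants[OF assms] by metis
  have sym: "transpose (D z) = D z" for z using spd by (simp add: spd_def)
  have entry: "\<bar>D z $ i $ j\<bar> \<le> B" for z i j
    using component_le_norm_cart[of "D z $ i" j] Finite_Cartesian_Product.norm_nth_le[of "D z" i] mBL(5)[of z] by linarith
  have entry_lip: "\<bar>D z $ i $ j - D z' $ i $ j\<bar> \<le> Ld * norm (z - z')" for z z' i j
    using component_le_norm_cart[of "(D z - D z') $ i" j] Finite_Cartesian_Product.norm_nth_le[of "D z - D z'" i] mBL(4)[of z z']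
    by simp
  have det_eq: "det (D z) = D z $ 1 $ 1 * D z $ 2 $ 2 - D z $ 1 $ 2 * D z $ 1 $ 2" for z
    by (simp add: det_2 sym_mat2[OF sym])
  have det_ge: "m\<^sup>2 \<le> det (D z)" for z
  proof -
    let ?a = "D z $ 1 $ 1" and ?b = "D z $ 1 $ 2"
    have a: "m \<le> ?a" using mBL(6)[of "vector [1, 0]" z] by (simp add: inner_vec2 mat2_mult_vec norm_vec2_sq)
    \<comment> \<open>On the test vector (-b, a) the form takes the value a det(D z), which bounds
      the determinant from below without eigenvalues.\<close>
    have "m * (norm (vector [- ?b, ?a] :: vec2))\<^sup>2 \<le> ?a * det (D z)"
      using mBL(6)[of "vector [- ?b, ?a]" z]
      by (simp add: inner_vec2 mat2_mult_vec det_eq sym_mat2[OF sym] algebra_simps)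
    moreover have "m * ?a\<^sup>2 \<le> m * (norm (vector [- ?b, ?a] :: vec2))\<^sup>2"
      using mBL(1) by (intro mult_left_mono) (simp_all add: norm_vec2_sq)
    ultimately have "?a * (m * ?a) \<le> ?a * det (D z)" by (simp add: power2_eq_square mult_ac)
    then have "m * ?a \<le> det (D z)" using a mBL(1) by simp
    moreover have "m * m \<le> m * ?a" using a mBL(1) by (intro mult_left_mono) auto
    ultimately show ?thesis by (simp add: power2_eq_square)
  qed
  define s where "s = (\<lambda>z. sqrt (det (D z)))"
  have s_ge: "m \<le> s z" for z unfolding s_def using det_ge[of z] mBL(1) by (simp add: real_le_rsqrt)
  have s_pos: "0 < s z" for z using s_ge[of z] mBL(1) by linarith
  have det_pos: "0 < det (D z)" for z using s_pos[of z] by (simp add: s_def)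
  have s_sq: "(s z)\<^sup>2 = det (D z)" for z unfolding s_def using det_pos[of z] by simp
  have s_le: "s z \<le> 2 * B" for z
  proof -
    have p: "\<bar>D z $ 1 $ 1 * D z $ 2 $ 2\<bar> \<le> B * B" "\<bar>D z $ 1 $ 2 * D z $ 1 $ 2\<bar> \<le> B * B"
      unfolding abs_mult using entry mBL(2) by (intro mult_mono; simp)+
    have "det (D z) \<le> 4 * (B * B)" unfolding det_eq using p mult_pos_pos[OF mBL(2,2)] by linarith
    then have "(s z)\<^sup>2 \<le> (2 * B)\<^sup>2" unfolding s_sq by (simp add: power2_eq_square)
    then show ?thesis by (rule power2_le_imp_le) (use mBL(2) in simp)
  qed
  have s_lip: "\<bar>s z - s z'\<bar> \<le> (2 * B * Ld / m) * norm (z - z')" for z z'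
  proof -
    have prod: "\<bar>x * y - x' * y'\<bar> \<le> 2 * (B * (Ld * norm (z - z')))"
      if "\<bar>x\<bar> \<le> B" "\<bar>y'\<bar> \<le> B" "\<bar>x - x'\<bar> \<le> Ld * norm (z - z')" "\<bar>y - y'\<bar> \<le> Ld * norm (z - z')" for x y x' y' :: real
    proof -
      have "x * y - x' * y' = x * (y - y') + (x - x') * y'" by (simp add: algebra_simps)
      then have "\<bar>x * y - x' * y'\<bar> \<le> \<bar>x\<bar> * \<bar>y - y'\<bar> + \<bar>y'\<bar> * \<bar>x - x'\<bar>"
        using abs_triangle_ineq[of "x * (y - y')" "(x - x') * y'"] by (simp add: abs_mult mult.commute)
      also have "\<dots> \<le> B * (Ld * norm (z - z')) + B * (Ld * norm (z - z'))"
        using that mBL(2) by (intro add_mono mult_mono) auto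
      finally show ?thesis by simp
    qed
    have "\<bar>det (D z) - det (D z')\<bar> \<le> 4 * (B * (Ld * norm (z - z')))"
      unfolding det_eq
      using prod[OF entry entry entry_lip entry_lip, of 1 1 2 2] prod[OF entry entry entry_lip entry_lip, of 1 2 1 2]
      by linarith
    then have "\<bar>(s z - s z') * (s z + s z')\<bar> \<le> 4 * (B * (Ld * norm (z - z')))"
      unfolding s_sq[symmetric] by (simp add: power2_eq_square algebra_simps)
    then have "\<bar>s z - s z'\<bar> * (s z + s z') \<le> 4 * (B * (Ld * norm (z - z')))"
      using s_pos[of z] s_pos[of z'] by (simp add: abs_mult)
    moreover have "\<bar>s z - s z'\<bar> * (2 * m) \<le> \<bar>s z - s z'\<bar> * (s z + s z')"
      using s_ge[of z] s_ge[of z'] by (intro mult_left_mono) auto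
    ultimately have "\<bar>s z - s z'\<bar> * (2 * m) \<le> 4 * (B * (Ld * norm (z - z')))" by linarith
    then show ?thesis using mBL(1) by (simp add: field_simps)
  qed
  have G_bound: "\<bar>v \<bullet> (cof (D z) *v w)\<bar> \<le> 2 * B * norm v * norm w" for z v w
  proof -
    have "\<bar>v \<bullet> (cof (D z) *v w)\<bar> \<le> 2 * norm (D z) * norm v * norm w"
      unfolding cof_form using mat2_form_bound[of "perp v" "D z" "perp w"] by simp
    also have "\<dots> \<le> 2 * B * norm v * norm w"
      using mBL(5)[of z] by (intro mult_right_mono) auto
    finally show ?thesis .
  qed
  have G_lip: "\<bar>v \<bullet> (cof (D z) *v w) - v \<bullet> (cof (D z') *v w)\<bar> \<le> 2 * Ld * norm (z - z') * norm v * norm w" for z z' v w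
  proof -
    have "v \<bullet> (cof (D z) *v w) - v \<bullet> (cof (D z') *v w) = perp v \<bullet> ((D z - D z') *v perp w)"
      unfolding cof_form by (simp add: matrix_vector_mult_diff_rdistrib inner_diff_right)
    then have "\<bar>v \<bullet> (cof (D z) *v w) - v \<bullet> (cof (D z') *v w)\<bar> \<le> 2 * norm (D z - D z') * norm v * norm w"
      using mat2_form_bound[of "perp v" "D z - D z'" "perp w"] by simp
    also have "\<dots> \<le> 2 * (Ld * norm (z - z')) * norm v * norm w"
      using mBL(4)[of z z'] by (intro mult_right_mono) auto
    finally show ?thesis by simp
  qed
  have G_low: "m * (norm v)\<^sup>2 \<le> v \<bullet> (cof (D z) *v v)" for z v
    unfolding cof_form using mBL(6)[of "perp v" z] by simp
  have M_eq: "Mfield D z = (1 / s z) *\<^sub>R cof (D z)" for z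
    unfolding s_def by (rule Mfield_eq_cof[OF sym det_pos])
  have M_form: "v \<bullet> (Mfield D z *v w) = (v \<bullet> (cof (D z) *v w)) / s z" for z v w
    unfolding M_eq scaleR_matrix_vector_assoc[symmetric] by simp
  define lam where "lam = m / (2 * B)"
  define Lam where "Lam = 2 * B / m"
  define L where "L = 2 * Ld / m + 2 * B * (2 * B * Ld / m) / m\<^sup>2"
  have low: "lam * (norm v)\<^sup>2 \<le> v \<bullet> (Mfield D z *v v)" for z v
  proof -
    have "lam * (norm v)\<^sup>2 = (m * (norm v)\<^sup>2) / (2 * B)" by (simp add: lam_def)
    also have "\<dots> \<le> (m * (norm v)\<^sup>2) / s z" using s_le[of z] s_pos[of z] mBL by (intro divide_left_mono) auto
    also have "\<dots> \<le> (v \<bullet> (cof (D z) *v v)) / s z" using G_low[of v z] s_pos[of z] by (intro divide_right_mono) auto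
    finally show ?thesis unfolding M_form .
  qed
  have up: "v \<bullet> (Mfield D z *v v) \<le> Lam * (norm v)\<^sup>2" for z v
  proof -
    have "(v \<bullet> (cof (D z) *v v)) / s z \<le> (2 * B * (norm v)\<^sup>2) / s z"
      using G_bound[of v z v] s_pos[of z] by (intro divide_right_mono) (auto simp: power2_eq_square mult.assoc)
    also have "\<dots> \<le> (2 * B * (norm v)\<^sup>2) / m" using s_ge[of z] s_pos[of z] mBL by (intro divide_left_mono) auto
    finally show ?thesis unfolding M_form by (simp add: Lam_def)
  qed
  have M_lip: "\<bar>v \<bullet> (Mfield D p *v w) - v \<bullet> (Mfield D q *v w)\<bar> \<le> L * norm (p - q) * norm v * norm w" for v w p q
  proof -
    define gp where "gp = v \<bullet> (cof (D p) *v w)"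
    define gq where "gq = v \<bullet> (cof (D q) *v w)"
    define X where "X = norm (p - q) * norm v * norm w"
    have X0: "0 \<le> X" by (simp add: X_def)
    have eq: "gp / s p - gq / s q = (gp - gq) / s p + gq * (s q - s p) / (s p * s q)"
      using s_pos[of p] s_pos[of q] by (simp add: field_simps)
    have "\<bar>gp / s p - gq / s q\<bar> \<le> \<bar>(gp - gq) / s p\<bar> + \<bar>gq * (s q - s p) / (s p * s q)\<bar>"
      unfolding eq by (rule abs_triangle_ineq)
    also have "\<dots> = \<bar>gp - gq\<bar> / s p + \<bar>gq\<bar> * \<bar>s q - s p\<bar> / (s p * s q)"
      using s_pos[of p] s_pos[of q] by (simp add: abs_mult abs_divide)
    also have "\<dots> \<le> (2 * Ld * X) / m + (2 * B * norm v * norm w) * ((2 * B * Ld / m) * norm (p - q)) / (m * m)"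
    proof (intro add_mono frac_le mult_mono)
      show "\<bar>gp - gq\<bar> \<le> 2 * Ld * X" using G_lip[of v p w q] by (simp add: gp_def gq_def X_def mult_ac)
      show "\<bar>gq\<bar> \<le> 2 * B * norm v * norm w" unfolding gq_def by (rule G_bound)
      show "\<bar>s q - s p\<bar> \<le> 2 * B * Ld / m * norm (p - q)" using s_lip[of q p] by (simp add: norm_minus_commute)
    qed (use mBL s_ge s_pos X0 in \<open>auto intro!: mult_nonneg_nonneg simp: less_imp_le\<close>)
    also have "\<dots> = L * X" by (simp add: L_def X_def power2_eq_square field_simps)
    finally show ?thesis unfolding M_form gp_def gq_def X_def by (simp add: mult.assoc)
  qed
  have mf: "metric_field D lam Lam L"
  proof
    show "0 < lam" unfolding lam_def using mBL by simp
    show "0 < L" unfolding L_def using mBL by (intro add_pos_nonneg) auto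
    show "transpose (Mfield D p) = Mfield D p" for p
      unfolding M_eq transpose_scaleR_mat2 cof_sym[OF sym] ..
    show "lam \<le> Lam" using low[of "vector [1, 0]" 0] up[of "vector [1, 0]" 0] by (simp add: norm_vec2_sq)
  qed (fact low up M_lip)+
  have ex: "\<exists>t. 0 < t \<and> t \<le> 2 * B \<and> cof (D z) = t *\<^sub>R Mfield D z" for z
    using s_pos[of z] s_le[of z] M_eq[of z] by (intro exI[of _ "s z"]) simp
  have "0 < 2 * Ld" "0 < 2 * B" using mBL by simp_all
  then show ?thesis by (rule that[OF mf mBL(1) _ _ cof_sym[OF sym] ex G_low G_lip])
qed

text \<open>The radius 4 R depends on the metric bounds alone, so the tolerance of the half-plane
  argument is fixed before h and can serve as a threshold for it.\<close>

lemma fine_grid_threshold: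
  assumes "metric_field D lam Lam L"
  obtains h1 where "0 < h1" "\<And>h. 0 < h \<Longrightarrow> h \<le> h1 \<Longrightarrow> fine_grid D lam Lam L h"
proof -
  interpret metric_field D lam Lam L by (rule assms)
  have "finite {k \<in> lattice 1. norm k \<le> 4 * R}"
  proof -
    have "finite (lattice 1 \<inter> cball 0 (4 * R))" by (rule finite_lattice_bounded) auto
    then show ?thesis by (rule rev_finite_subset) auto
  qed
  from approximate_half_plane[OF this] obtain \<epsilon> where eps: "0 < \<epsilon>"
    "\<forall>A\<subseteq>{k \<in> lattice 1. norm k \<le> 4 * R}. \<forall>n. norm n = 1 \<longrightarrow> (\<forall>a\<in>A. a \<bullet> n \<ge> - \<epsilon>) \<longrightarrow>
      (\<exists>n'. n' \<noteq> 0 \<and> (\<forall>a\<in>A. a \<bullet> n' \<ge> 0))"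
    by (elim exE conjE)
  define h1 where "h1 = min (lam / (4 * L * R ^ 3)) (\<epsilon> * lam / (8 * L * R\<^sup>2))"
  have pos: "0 < 4 * L * R ^ 3" "0 < 8 * L * R\<^sup>2" using L_pos R_pos by simp_all
  have "0 < h1" unfolding h1_def using pos eps(1) lam_pos by simp
  moreover have "fine_grid D lam Lam L h" if h: "0 < h" "h \<le> h1" for h
  proof
    show "0 < h" by (rule h)
    have "4 * L * R ^ 3 * h \<le> lam" using h(2) pos unfolding h1_def by (simp add: field_simps)
    then show "2 * L * R ^ 3 * h < lam" using lam_pos by linarith
    have "8 * L * R\<^sup>2 * h \<le> \<epsilon> * lam" using h(2) pos unfolding h1_def by (simp add: field_simps)
    then have le: "8 * L * R\<^sup>2 * h / lam \<le> \<epsilon>" using lam_pos by (simp add: field_simps)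
    fix A n assume A: "A \<subseteq> {k \<in> lattice 1. norm k \<le> 4 * R}" "norm n = 1"
      "\<And>a. a \<in> A \<Longrightarrow> a \<bullet> n \<ge> - (8 * L * R\<^sup>2 * h / lam)"
    show "\<exists>n'. n' \<noteq> 0 \<and> (\<forall>a\<in>A. a \<bullet> n' \<ge> 0)"
    proof -
      have "\<forall>a\<in>A. a \<bullet> n \<ge> - \<epsilon>"
      proof
        fix a assume "a \<in> A"
        then show "a \<bullet> n \<ge> - \<epsilon>" using A(3)[of a] le by linarith
      qed
      then show ?thesis using eps(2) A(1,2) by simp
    qed
  qed
  ultimately show ?thesis using that by blast
qed

theorem mainTheorem1:
  fixes D :: "real^2 \<Rightarrow> real^2^2"
  assumes spd_D: "\<forall>x. spd (D x)"
    and periodic_D: "\<forall>x. \<forall>k\<in>lattice 1. D (x + k) = D x"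
    and lipschitz_D: "\<exists>L. \<forall>x y. norm (D x - D y) \<le> L * norm (x - y)"
  shows "\<exists>h0>0. \<exists>c>0. \<forall>n::nat. \<forall>h. n \<ge> 1 \<longrightarrow> h = 1 / real n \<longrightarrow> h \<le> h0 \<longrightarrow>
           Qh_strictly_convex_polygonization h D
         \<and> (\<forall>sb. (\<forall>z. superbase (sb z) \<and> obtuse (Mfield D z) (sb z)) \<longrightarrow>
              (\<forall>T. ADT h D T \<longrightarrow>
                (\<forall>u. (\<forall>p. \<forall>k\<in>lattice 1. u (p + k) = u p) \<longrightarrow>
                  (\<forall>I. pl_interpolant T u I \<longrightarrow>
                     (1 - c * h) * energy_h h D sb u \<le> energy_fe D I
                   \<and> energy_fe D I \<le> (1 + c * h) * energy_h h D sb u))))"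
proof -
  obtain lam Lam L lamG LG sG where mf: "metric_field D lam Lam L"
    and G: "0 < lamG" "0 < LG" "0 < sG"
    "\<And>z. transpose (cof (D z)) = cof (D z)"
    "\<And>z. \<exists>s. 0 < s \<and> s \<le> sG \<and> cof (D z) = s *\<^sub>R Mfield D z"
    "\<And>z v. lamG * (norm v)\<^sup>2 \<le> v \<bullet> (cof (D z) *v v)"
    "\<And>z z' v w. \<bar>v \<bullet> (cof (D z) *v w) - v \<bullet> (cof (D z') *v w)\<bar> \<le> LG * norm (z - z') * norm v * norm w"
    by (rule metric_constants[OF assms]) blast
  interpret metric_field D lam Lam L by (rule mf)
  \<comment> \<open>The constants of \<open>lbr_grid\<close> are restated before h, the superbases,
    the triangulation and u are fixed; this makes h0 and c uniform in them.\<close>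
  define K where "K = 2 * R\<^sup>2"
  define C1 where "C1 = sG * (15 * L * R ^ 3 + 4 * L * K * R\<^sup>2)"
  define C2 where "C2 = LG * K ^ 3 + 18 * K ^ 8 * C1"
  define C5 where "C5 = LG * (2 * K ^ 3) * K\<^sup>2"
  define C4 where "C4 = 32 * K ^ 4 / lamG * real (card {e \<in> lattice 1. norm e \<le> K \<and> (1/2) *\<^sub>R e \<notin> lattice 1})
    * real (card {k \<in> lattice 1. norm k \<le> 2 * K ^ 3})"
  have K_pos: "0 < K" using R_pos by (simp add: K_def)
  have C5_pos: "0 < 76 * K ^ 8 * C5" unfolding C5_def using G(2) K_pos by simp
  have C_nonneg: "0 \<le> C2" "0 \<le> C4"
    unfolding C2_def C1_def C4_def using G K_pos L_pos R_pos by simp_all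
  obtain h1 where h1: "0 < h1" "\<And>h. 0 < h \<Longrightarrow> h \<le> h1 \<Longrightarrow> fine_grid D lam Lam L h"
    using fine_grid_threshold[OF mf] by blast
  \<comment> \<open>76 = 4 * 19: the condition under which strong weights persist along the
    paths.\<close>
  define h0 where "h0 = min h1 (lamG / (76 * K ^ 8 * C5))"
  \<comment> \<open>The added 1 makes c positive.\<close>
  define c where "c = 2 * C2 * C4 + 1"
  have "0 < h0" unfolding h0_def using h1(1) G(1) C5_pos by simp
  moreover have "0 < c" unfolding c_def using mult_nonneg_nonneg[OF C_nonneg] by simp
  moreover have "Qh_strictly_convex_polygonization h D
         \<and> (\<forall>sb. (\<forall>z. superbase (sb z) \<and> obtuse (Mfield D z) (sb z)) \<longrightarrow>
              (\<forall>T. ADT h D T \<longrightarrow>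
                (\<forall>u. (\<forall>p. \<forall>k\<in>lattice 1. u (p + k) = u p) \<longrightarrow>
                  (\<forall>I. pl_interpolant T u I \<longrightarrow>
                     (1 - c * h) * energy_h h D sb u \<le> energy_fe D I
                   \<and> energy_fe D I \<le> (1 + c * h) * energy_h h D sb u))))"
    if n: "n \<ge> 1" "h = 1 / real n" "h \<le> h0" for n :: nat and h
  proof -
    have h_pos: "0 < h" using n by simp
    have fg: "fine_grid D lam Lam L h" using n(3) by (intro h1(2) h_pos) (simp add: h0_def)
    have "h \<le> lamG / (76 * K ^ 8 * C5)" using n(3) by (simp add: h0_def)
    then have "h * (76 * K ^ 8 * C5) \<le> lamG" using C5_pos by (simp add: pos_le_divide_eq)
    then have small: "19 * K ^ 8 * C5 * h \<le> lamG / 4" by (simp add: mult_ac)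
    have "(1 - c * h) * energy_h h D sb u \<le> energy_fe D I \<and> energy_fe D I \<le> (1 + c * h) * energy_h h D sb u"
      if sb: "\<forall>z. superbase (sb z) \<and> obtuse (Mfield D z) (sb z)" and T: "ADT h D T"
        and u: "\<forall>p. \<forall>k\<in>lattice 1. u (p + k) = u p" and I: "pl_interpolant T u I" for sb T u I
    proof -
      interpret g: lbr_grid D lam Lam L h T sb u n lamG LG sG
      proof (intro lbr_grid.intro lbr_grid_axioms.intro adt_grid.intro adt_grid_axioms.intro fg T)
      qed (use sb u G n periodic_D in auto)
      have "\<bar>energy_fe D I - energy_h h D sb u\<bar> \<le> (2 * C2 * C4) * h * energy_h h D sb u"
        using g.energies_close[OF I] small
        unfolding g.C2_def g.C1_def g.C4_def g.C5_def g.NK_def g.WS_def g.K_def C2_def C1_def C4_def C5_def K_def by blast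
      also have "\<dots> \<le> c * h * energy_h h D sb u"
        using g.energy_h_nonneg h_pos by (intro mult_right_mono) (auto simp: c_def)
      finally show ?thesis by (simp add: abs_le_iff algebra_simps)
    qed
    then show ?thesis using fine_grid.Qh_polygonization[OF fg] by blast
  qed
  ultimately show ?thesis by blast
qed

end
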